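(* Let $R$ be a commutative Noetherian domain that is semilocal, let $C$ be a finite abelian group, $\mathbf{T}$ a commutative $C$-graded $R$-algebra, $W$ a group with a homomorphism $\nu\colon W\to C$, and let $\mathbf{A}$ be a $C$-graded $R$-algebra, finitely generated as an $R$-module, together with a grading-preserving surjection of $R$-algebras $\mathbf{T}[W]\to\mathbf{A}$. Let $C_{\mathrm{iso}}=C/\nu(W)$. Let $c\in C$, and let $M$ be a graded $\mathbf{A}$-module. Suppose that for all the finitely many maximal ideals $\mathfrak{p}$ of $R$, for all simple (ungraded) $\mathbf{T}$-submodules $E$ of $R/\mathfrak{p}\otimes_RM$, and for all $\chi\in\widehat{C}_{\mathrm{iso}}$ with $\chi(c)\neq1$, there exist $c_{\chi,E}\in C$ with $\chi(c_{\chi,E})\neq1$ and $T_{\chi,E}\in\mathbf{T}_{c_{\chi,E}}$ that does not annihilate $E$. Then there exists an element of $\mathbf{A}_c$ that acts invertibly on $M$.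
   Context: An $R$-algebra is a ring with a ring homomorphism from $R$ to its centre. A $C$-grading on an $R$-algebra $\mathbf{B}$ is a decomposition $\mathbf{B}=\bigoplus_{c\in C}\mathbf{B}_c$ into $R$-submodules with $\mathbf{B}_c\mathbf{B}_{c'}\subset\mathbf{B}_{cc'}$. The group algebra $\mathbf{T}[W]$ is $C$-graded by giving $t\cdot w$, with $t\in\mathbf{T}_{c'}$ and $w\in W$, degree $c'\nu(w)$. A graded $\mathbf{A}$-module is a finitely generated $\mathbf{A}$-module $M$ with a direct sum decomposition $M=\bigoplus_{c\in C}M_c$ such that $\mathbf{A}_cM_{c'}\subset M_{cc'}$; every $\mathbf{A}$-module is a $\mathbf{T}$-module via $\mathbf{T}\to\mathbf{T}[W]\to\mathbf{A}$. A commutative ring is semilocal if it has finitely many maximal ideals. $\widehat{C}_{\mathrm{iso}}=\mathrm{Hom}(C_{\mathrm{iso}},\mathbb{C}^\times)$, identified with the group of characters of $C$ that are trivial on $\nu(W)$. *)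

theory Defs
  imports Complex_Main "HOL-Algebra.Algebra"
begin

section \<open>Modules and algebras\<close>

text \<open>
  The library locale \<^locale>\<open>module\<close> requires a commutative base ring; here the base
  ring \<open>A\<close> may be noncommutative.  As in the library, the \<open>mult\<close> and \<open>one\<close> fields of a module
  record carry no meaning.
\<close>

locale left_module = A?: ring A + M?: abelian_group M
  for A :: "('a, 'x) ring_scheme" (structure) and M :: "('a, 'm, 'y) module_scheme" (structure) +
  assumes smult_closed:
      "\<lbrakk>a \<in> carrier A; x \<in> carrier M\<rbrakk> \<Longrightarrow> a \<odot>\<^bsub>M\<^esub> x \<in> carrier M"
    and smult_l_distr:
      "\<lbrakk>a \<in> carrier A; b \<in> carrier A; x \<in> carrier M\<rbrakk> \<Longrightarrow>
        (a \<oplus>\<^bsub>A\<^esub> b) \<odot>\<^bsub>M\<^esub> x = a \<odot>\<^bsub>M\<^esub> x \<oplus>\<^bsub>M\<^esub> b \<odot>\<^bsub>M\<^esub> x"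
    and smult_r_distr:
      "\<lbrakk>a \<in> carrier A; x \<in> carrier M; y \<in> carrier M\<rbrakk> \<Longrightarrow>
        a \<odot>\<^bsub>M\<^esub> (x \<oplus>\<^bsub>M\<^esub> y) = a \<odot>\<^bsub>M\<^esub> x \<oplus>\<^bsub>M\<^esub> a \<odot>\<^bsub>M\<^esub> y"
    and smult_assoc:
      "\<lbrakk>a \<in> carrier A; b \<in> carrier A; x \<in> carrier M\<rbrakk> \<Longrightarrow>
        (a \<otimes>\<^bsub>A\<^esub> b) \<odot>\<^bsub>M\<^esub> x = a \<odot>\<^bsub>M\<^esub> (b \<odot>\<^bsub>M\<^esub> x)"
    and smult_one:
      "x \<in> carrier M \<Longrightarrow> \<one>\<^bsub>A\<^esub> \<odot>\<^bsub>M\<^esub> x = x"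

definition fg_module :: "('a, 'x) ring_scheme \<Rightarrow> ('a, 'm, 'y) module_scheme \<Rightarrow> bool"
  where "fg_module A M \<longleftrightarrow>
    (\<exists>S \<subseteq> carrier M. finite S \<and>
      (\<forall>x \<in> carrier M. \<exists>f \<in> S \<rightarrow> carrier A. x = (\<Oplus>\<^bsub>M\<^esub>s\<in>S. f s \<odot>\<^bsub>M\<^esub> s)))"

definition simple_submodule ::
    "'m set \<Rightarrow> ('a, 'x) ring_scheme \<Rightarrow> ('a, 'm, 'y) module_scheme \<Rightarrow> bool"
  where "simple_submodule E A M \<longleftrightarrow>
    submodule E A M \<and> E \<noteq> {\<zero>\<^bsub>M\<^esub>} \<and>
    (\<forall>F. submodule F A M \<and> F \<subseteq> E \<longrightarrow> F = {\<zero>\<^bsub>M\<^esub>} \<or> F = E)"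

text \<open>An \<open>R\<close>-algebra is a ring \<open>B\<close> with a structure map \<open>\<phi>\<close> from \<open>R\<close> to the centre of \<open>B\<close>.\<close>

locale algebra_over = R?: cring R + B?: ring B
  for R :: "('r, 'x) ring_scheme" (structure) and B :: "('b, 'y) ring_scheme" (structure)
    and \<phi> :: "'r \<Rightarrow> 'b" +
  assumes structure_hom: "\<phi> \<in> ring_hom R B"
    and structure_central:
      "\<lbrakk>r \<in> carrier R; b \<in> carrier B\<rbrakk> \<Longrightarrow> \<phi> r \<otimes>\<^bsub>B\<^esub> b = b \<otimes>\<^bsub>B\<^esub> \<phi> r"

definition algebra_module :: "('b, 'y) ring_scheme \<Rightarrow> ('r \<Rightarrow> 'b) \<Rightarrow> ('r, 'b) module"
  where "algebra_module B \<phi> =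
    \<lparr>carrier = carrier B, monoid.mult = monoid.mult B, one = one B, ring.zero = ring.zero B, add = add B,
     smult = (\<lambda>r b. \<phi> r \<otimes>\<^bsub>B\<^esub> b)\<rparr>"

definition restrict_scalars :: "('s \<Rightarrow> 'a) \<Rightarrow> ('a, 'm, 'y) module_scheme \<Rightarrow> ('s, 'm) module"
  where "restrict_scalars f M =
    \<lparr>carrier = carrier M, monoid.mult = monoid.mult M, one = one M, ring.zero = ring.zero M, add = add M,
     smult = (\<lambda>s x. f s \<odot>\<^bsub>M\<^esub> x)\<rparr>"

definition semilocal :: "('r, 'x) ring_scheme \<Rightarrow> bool"
  where "semilocal R \<longleftrightarrow> finite {\<pp>. maximalideal \<pp> R}"


section \<open>Gradings\<close>

text \<open>Only used for finite index sets \<open>I\<close>.\<close>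

definition internal_direct_sum :: "('m, 'y) ring_scheme \<Rightarrow> 'i set \<Rightarrow> ('i \<Rightarrow> 'm set) \<Rightarrow> bool"
  where "internal_direct_sum M I N \<longleftrightarrow>
    (\<forall>i \<in> I. subgroup (N i) (add_monoid M)) \<and>
    (\<forall>x \<in> carrier M. \<exists>!f. f \<in> (\<Pi>\<^sub>E i\<in>I. N i) \<and> x = (\<Oplus>\<^bsub>M\<^esub>i\<in>I. f i))"

locale graded_algebra = algebra_over R B \<phi>
  for C :: "('c, 'z) monoid_scheme"
    and R :: "('r, 'x) ring_scheme" (structure) and B :: "('b, 'y) ring_scheme" (structure)
    and \<phi> :: "'r \<Rightarrow> 'b" and \<B> :: "'c \<Rightarrow> 'b set" +
  assumes component_submodule:
      "c \<in> carrier C \<Longrightarrow> submodule (\<B> c) R (algebra_module B \<phi>)"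
    and decomposition: "internal_direct_sum B (carrier C) \<B>"
    and component_mult:
      "\<lbrakk>c \<in> carrier C; d \<in> carrier C; x \<in> \<B> c; y \<in> \<B> d\<rbrakk> \<Longrightarrow>
        x \<otimes>\<^bsub>B\<^esub> y \<in> \<B> (c \<otimes>\<^bsub>C\<^esub> d)"

locale graded_module = left_module A M
  for C :: "('c, 'z) monoid_scheme"
    and A :: "('a, 'x) ring_scheme" (structure) and \<A> :: "'c \<Rightarrow> 'a set"
    and M :: "('a, 'm, 'y) module_scheme" (structure) and \<M> :: "'c \<Rightarrow> 'm set" +
  assumes finitely_generated: "fg_module A M"
    and decomposition: "internal_direct_sum M (carrier C) \<M>"
    and component_smult:
      "\<lbrakk>c \<in> carrier C; d \<in> carrier C; a \<in> \<A> c; x \<in> \<M> d\<rbrakk> \<Longrightarrow>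
        a \<odot>\<^bsub>M\<^esub> x \<in> \<M> (c \<otimes>\<^bsub>C\<^esub> d)"

definition graded_algebra_hom ::
    "('c, 'z) monoid_scheme \<Rightarrow> ('r, 'x) ring_scheme
      \<Rightarrow> ('b, 'y) ring_scheme \<Rightarrow> ('r \<Rightarrow> 'b) \<Rightarrow> ('c \<Rightarrow> 'b set)
      \<Rightarrow> ('a, 'u) ring_scheme \<Rightarrow> ('r \<Rightarrow> 'a) \<Rightarrow> ('c \<Rightarrow> 'a set) \<Rightarrow> ('b \<Rightarrow> 'a) \<Rightarrow> bool"
  where "graded_algebra_hom C R B \<phi> \<B> A \<psi> \<A> h \<longleftrightarrow>
    h \<in> ring_hom B A \<and> (\<forall>r \<in> carrier R. h (\<phi> r) = \<psi> r) \<and> (\<forall>c \<in> carrier C. h ` \<B> c \<subseteq> \<A> c)"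


section \<open>The group algebra\<close>

text \<open>
  Elements of \<open>T[W]\<close> are the finitely supported functions \<open>W \<rightarrow> T\<close>, extensional on \<open>carrier W\<close>,
  with the convolution product; scalars commute with group elements.
\<close>

definition group_algebra :: "('t, 'x) ring_scheme \<Rightarrow> ('w, 'z) monoid_scheme \<Rightarrow> ('w \<Rightarrow> 't) ring"
  where "group_algebra T W =
    \<lparr>carrier = {f \<in> carrier W \<rightarrow>\<^sub>E carrier T. finite {w \<in> carrier W. f w \<noteq> \<zero>\<^bsub>T\<^esub>}},
     monoid.mult = (\<lambda>f g. \<lambda>w\<in>carrier W.
       \<Oplus>\<^bsub>T\<^esub>u\<in>{u \<in> carrier W. f u \<noteq> \<zero>\<^bsub>T\<^esub>}. f u \<otimes>\<^bsub>T\<^esub> g (inv\<^bsub>W\<^esub> u \<otimes>\<^bsub>W\<^esub> w)),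
     one = (\<lambda>w\<in>carrier W. if w = \<one>\<^bsub>W\<^esub> then \<one>\<^bsub>T\<^esub> else \<zero>\<^bsub>T\<^esub>),
     ring.zero = (\<lambda>w\<in>carrier W. \<zero>\<^bsub>T\<^esub>),
     add = (\<lambda>f g. \<lambda>w\<in>carrier W. f w \<oplus>\<^bsub>T\<^esub> g w)\<rparr>"

text \<open>The element \<open>t \<cdot> w\<close>.\<close>

definition group_algebra_monom ::
    "('t, 'x) ring_scheme \<Rightarrow> ('w, 'z) monoid_scheme \<Rightarrow> 't \<Rightarrow> 'w \<Rightarrow> ('w \<Rightarrow> 't)"
  where "group_algebra_monom T W t w = (\<lambda>u\<in>carrier W. if u = w then t else \<zero>\<^bsub>T\<^esub>)"

definition group_algebra_coeff ::
    "('t, 'x) ring_scheme \<Rightarrow> ('w, 'z) monoid_scheme \<Rightarrow> 't \<Rightarrow> ('w \<Rightarrow> 't)"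
  where "group_algebra_coeff T W t = group_algebra_monom T W t \<one>\<^bsub>W\<^esub>"

text \<open>
  If \<open>t\<close> has degree \<open>d\<close> then \<open>t \<cdot> w\<close> has degree \<open>d \<nu>(w)\<close>; hence the elements of degree \<open>c\<close> are those
  whose coefficient at every \<open>w\<close> has degree \<open>c \<nu>(w)\<inverse>\<close>.
\<close>

definition group_algebra_grading ::
    "('t, 'x) ring_scheme \<Rightarrow> ('w, 'z) monoid_scheme \<Rightarrow> ('c, 'y) monoid_scheme
      \<Rightarrow> ('w \<Rightarrow> 'c) \<Rightarrow> ('c \<Rightarrow> 't set) \<Rightarrow> 'c \<Rightarrow> ('w \<Rightarrow> 't) set"
  where "group_algebra_grading T W C \<nu> \<T> c =
    {f \<in> carrier (group_algebra T W). \<forall>w \<in> carrier W. f w \<in> \<T> (c \<otimes>\<^bsub>C\<^esub> inv\<^bsub>C\<^esub> \<nu> w)}"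


section \<open>Tensor products\<close>

text \<open>
  \<open>N \<otimes>\<^sub>R M\<close> is the quotient of the free abelian group on \<open>N \<times> M\<close> by the bilinearity and balancing
  relations; \<open>frag_of (x, y)\<close> is the generator whose class is \<open>x \<otimes> y\<close>.
\<close>

definition tensor_free ::
    "('r, 'n, 'y) module_scheme \<Rightarrow> ('r, 'm, 'z) module_scheme \<Rightarrow> ('n \<times> 'm \<Rightarrow>\<^sub>0 int) monoid"
  where "tensor_free N M = free_Abelian_group (carrier N \<times> carrier M)"

definition tensor_relations ::
    "('r, 'x) ring_scheme \<Rightarrow> ('r, 'n, 'y) module_scheme \<Rightarrow> ('r, 'm, 'z) module_scheme
      \<Rightarrow> ('n \<times> 'm \<Rightarrow>\<^sub>0 int) set"
  where "tensor_relations R N M = generate (tensor_free N M)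
     ({frag_of (x \<oplus>\<^bsub>N\<^esub> x', y) - frag_of (x, y) - frag_of (x', y) | x x' y.
         x \<in> carrier N \<and> x' \<in> carrier N \<and> y \<in> carrier M} \<union>
      {frag_of (x, y \<oplus>\<^bsub>M\<^esub> y') - frag_of (x, y) - frag_of (x, y') | x y y'.
         x \<in> carrier N \<and> y \<in> carrier M \<and> y' \<in> carrier M} \<union>
      {frag_of (r \<odot>\<^bsub>N\<^esub> x, y) - frag_of (x, r \<odot>\<^bsub>M\<^esub> y) | r x y.
         r \<in> carrier R \<and> x \<in> carrier N \<and> y \<in> carrier M})"

definition tensor_group ::
    "('r, 'x) ring_scheme \<Rightarrow> ('r, 'n, 'y) module_scheme \<Rightarrow> ('r, 'm, 'z) module_scheme
      \<Rightarrow> ('n \<times> 'm \<Rightarrow>\<^sub>0 int) set monoid"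
  where "tensor_group R N M = tensor_free N M Mod tensor_relations R N M"

text \<open>
  The map \<open>id \<otimes> f\<close> for an \<open>R\<close>-linear endomorphism \<open>f\<close> of \<open>M\<close>.  All members of the union coincide,
  since \<open>(x, y) \<mapsto> (x, f y)\<close> preserves the relations.
\<close>

definition tensor_map ::
    "('r, 'x) ring_scheme \<Rightarrow> ('r, 'n, 'y) module_scheme \<Rightarrow> ('r, 'm, 'z) module_scheme
      \<Rightarrow> ('m \<Rightarrow> 'm) \<Rightarrow> ('n \<times> 'm \<Rightarrow>\<^sub>0 int) set \<Rightarrow> ('n \<times> 'm \<Rightarrow>\<^sub>0 int) set"
  where "tensor_map R N M f U =
    (\<Union>u\<in>U. tensor_relations R N M #>\<^bsub>tensor_free N M\<^esub> frag_extend (\<lambda>(x, y). frag_of (x, f y)) u)"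

text \<open>
  \<open>N \<otimes>\<^sub>R M\<close> as a module over a ring acting \<open>R\<close>-linearly on \<open>M\<close> by \<open>act\<close>.  The \<open>mult\<close> and \<open>one\<close>
  fields are unused.
\<close>

definition tensor_module ::
    "('r, 'x) ring_scheme \<Rightarrow> ('r, 'n, 'y) module_scheme \<Rightarrow> ('r, 'm, 'z) module_scheme
      \<Rightarrow> ('s \<Rightarrow> 'm \<Rightarrow> 'm) \<Rightarrow> ('s, ('n \<times> 'm \<Rightarrow>\<^sub>0 int) set) module"
  where "tensor_module R N M act =
    \<lparr>carrier = carrier (tensor_group R N M), monoid.mult = undefined, one = undefined,
     ring.zero = one (tensor_group R N M), add = monoid.mult (tensor_group R N M),
     smult = (\<lambda>s. tensor_map R N M (act s))\<rparr>"

text \<open>\<open>R/\<pp>\<close> as an \<open>R\<close>-module.\<close>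

definition quotient_module :: "('r, 'x) ring_scheme \<Rightarrow> 'r set \<Rightarrow> ('r, 'r set) module"
  where "quotient_module R \<pp> = algebra_module (R Quot \<pp>) (\<lambda>r. \<pp> +>\<^bsub>R\<^esub> r)"

text \<open>
  \<open>R/\<pp> \<otimes>\<^sub>R M\<close> as a \<open>T\<close>-module, for an \<open>A\<close>-module \<open>M\<close> that becomes an \<open>R\<close>-module via \<open>\<psi> : R \<rightarrow> A\<close>
  and a \<open>T\<close>-module via \<open>\<iota> : T \<rightarrow> A\<close>.
\<close>

definition reduction_module ::
    "('r, 'x) ring_scheme \<Rightarrow> 'r set \<Rightarrow> ('r \<Rightarrow> 'a) \<Rightarrow> ('t \<Rightarrow> 'a) \<Rightarrow> ('a, 'm, 'y) module_scheme
      \<Rightarrow> ('t, ('r set \<times> 'm \<Rightarrow>\<^sub>0 int) set) module"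
  where "reduction_module R \<pp> \<psi> \<iota> M =
    tensor_module R (quotient_module R \<pp>) (restrict_scalars \<psi> M) (smult (restrict_scalars \<iota> M))"


section \<open>Characters\<close>

definition complex_units :: "complex monoid"
  where "complex_units = \<lparr>carrier = UNIV - {0}, monoid.mult = (*), one = 1\<rparr>"

end

theory Submission
  imports Defs
begin

text \<open>
  For a maximal ideal \<open>\<pp>\<close> of \<open>R\<close> let \<open>V = R/\<pp> \<otimes> M\<close>, a finite-dimensional space over \<open>R/\<pp>\<close>.  Coefficients
  are central in \<open>T[W]\<close> and \<open>T[W] \<rightarrow> A\<close> is onto, so \<open>T\<close> acts on \<open>M\<close> through the centre of \<open>A\<close>, and
  the kernel on \<open>V\<close> of any element of \<open>A\<close> is a \<open>T\<close>-submodule.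

  Let \<open>E\<close> be a simple \<open>T\<close>-submodule of \<open>V\<close>.  An element of \<open>T\<close> is zero or injective on \<open>E\<close>, hence
  the set \<open>D\<close> of degrees \<open>d\<close> for which \<open>T\<^sub>d\<close> does not annihilate \<open>E\<close> is closed under products.  By
  hypothesis every character of \<open>C\<close> that is trivial on \<open>\<nu>(W) D\<close> is trivial on \<open>c\<close>; since characters
  separate a subgroup from the elements outside it, \<open>c = d \<nu>(w)\<close> with \<open>d \<in> D\<close> and \<open>w \<in> W\<close>
  (\<open>factor_of_characters\<close>).  So \<open>A\<^sub>c\<close> contains the image of a monomial \<open>t w\<close> with \<open>t\<close> homogeneous and
  not annihilating \<open>E\<close>; it acts injectively on \<open>E\<close>.

  The monomials for the various \<open>E\<close> are combined without leaving \<open>A\<^sub>c\<close> by coefficients of degree one.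
  Let \<open>q(E)\<close> be the annihilator of \<open>E\<close> in the degree-one part \<open>T\<^sub>1\<close>.  A homogeneous \<open>t\<close> has
  \<open>t ^ |C| \<in> T\<^sub>1\<close>, so \<open>q(E)\<close> determines which homogeneous elements annihilate \<open>E\<close>.  As \<open>V\<close> is
  finite-dimensional, \<open>q(E)\<close> is the kernel of a homomorphism from \<open>T\<^sub>1\<close> onto a field
  (\<open>vertex_field_kernel\<close>), so distinct \<open>q(E)\<close> are incomparable, and for each \<open>\<pp>\<close> there are finitely many
  (\<open>finite_vertices\<close>).  For every \<open>q\<close> in the finite set \<open>Q\<close> of all of them, for all the finitely many
  \<open>\<pp>\<close>, choose a monomial \<open>t\<^sub>q w\<^sub>q\<close> as above and \<open>s\<^sub>q \<in> T\<^sub>1\<close> outside \<open>q\<close> and inside every other member of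
  \<open>Q\<close> (\<open>field_kernels_separated\<close>), and let \<open>a \<in> A\<^sub>c\<close> be the image of \<open>\<Sum>\<^sub>q s\<^sub>q t\<^sub>q w\<^sub>q\<close>.  On \<open>E\<close> only the
  summand with \<open>q = q(E)\<close> is nonzero, and it is injective.  If the kernel of \<open>a\<close> on \<open>V\<close> were nonzero it
  would contain some \<open>E\<close>; so \<open>a\<close> is injective, hence surjective, on \<open>V\<close> (\<open>sum_surj_on_fibre\<close>).

  Thus \<open>M = a M + \<pp> M\<close> for every \<open>\<pp>\<close>, and Nakayama's lemma gives \<open>a M = M\<close>.  A second application of
  Nakayama's lemma, over a commutative subring of \<open>A\<close> that contains \<open>a\<close>, shows that \<open>a\<close> is injective
  on \<open>M\<close> (\<open>bij_of_surj_on_fibres\<close>).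
\<close>

section \<open>Nakayama's lemma\<close>

lemma (in noetherian_ring) exists_maximalideal:
  assumes "ideal I R" "I \<noteq> carrier R"
  shows "\<exists>J. maximalideal J R \<and> I \<subseteq> J"
proof -
  let ?P = "{J. ideal J R \<and> I \<subseteq> J \<and> J \<noteq> carrier R}"
  have "\<exists>J\<in>?P. \<forall>K\<in>?P. J \<subseteq> K \<longrightarrow> K = J"
  proof (rule subset_Zorn_nonempty)
    show "?P \<noteq> {}" using assms by auto
    fix K assume K: "K \<noteq> {}" "subset.chain ?P K"
    then have "subset.chain {J. ideal J R} K"
      unfolding subset.chain_def by auto
    then have "\<Union>K \<in> K" using ideal_chain_is_trivial K(1) by blast
    then show "\<Union>K \<in> ?P" using K(2) unfolding subset.chain_def by auto
  qed
  then obtain J where J: "J \<in> ?P" "\<And>K. K \<in> ?P \<Longrightarrow> J \<subseteq> K \<Longrightarrow> K = J" by auto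
  have "maximalideal J R"
    using J by (intro maximalidealI) auto
  then show ?thesis using J(1) by blast
qed

context module
begin

lemma span_insert_submodule:
  assumes "submodule L R M" "s \<in> carrier M"
  shows "submodule {l \<oplus>\<^bsub>M\<^esub> b \<odot>\<^bsub>M\<^esub> s | l b. l \<in> L \<and> b \<in> carrier R} R M" (is "submodule ?F R M")
proof (rule submoduleI)
  note L = submoduleE[OF assms(1)]
  have LM: "l \<in> carrier M" if "l \<in> L" for l using that L(1) by auto
  have L0: "\<zero>\<^bsub>M\<^esub> \<in> L" using L(2,3,5) LM by (metis M.r_neg equals0I)
  show "?F \<subseteq> carrier M" using LM assms(2) by auto
  show "\<zero>\<^bsub>M\<^esub> \<in> ?F" using L0 assms(2) 
    by (intro CollectI exI[of _ "\<zero>\<^bsub>M\<^esub>"] exI[of _ "\<zero>"]) auto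
  fix x assume "x \<in> ?F"
  then obtain l b where lb: "x = l \<oplus>\<^bsub>M\<^esub> b \<odot>\<^bsub>M\<^esub> s" "l \<in> L" "b \<in> carrier R" by auto
  show "\<ominus>\<^bsub>M\<^esub> x \<in> ?F" 
    using lb L(3) LM assms(2)
    by (intro CollectI exI[of _ "\<ominus>\<^bsub>M\<^esub> l"] exI[of _ "\<ominus> b"]) (auto simp: smult_l_minus M.minus_add)
  {
    fix y assume "y \<in> ?F"
    then obtain l' b' where lb': "y = l' \<oplus>\<^bsub>M\<^esub> b' \<odot>\<^bsub>M\<^esub> s" "l' \<in> L" "b' \<in> carrier R" by auto
    show "x \<oplus>\<^bsub>M\<^esub> y \<in> ?F"
      using lb lb' L(5) LM assms(2)
      by (intro CollectI exI[of _ "l \<oplus>\<^bsub>M\<^esub> l'"] exI[of _ "b \<oplus> b'"]) (auto simp: smult_l_distr M.a_ac)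
  }
  fix r assume "r \<in> carrier R"
  then show "r \<odot>\<^bsub>M\<^esub> x \<in> ?F"
    using lb L(4) LM assms(2)
    by (intro CollectI exI[of _ "r \<odot>\<^bsub>M\<^esub> l"] exI[of _ "r \<otimes> b"]) (auto simp: smult_r_distr smult_assoc1)
qed

text \<open>
  Both \<open>S\<close> generating \<open>M\<close> and \<open>M = N + I M\<close> are stated through the submodules (respectively subgroups)
  that contain the generating elements, so that no linear combinations occur.  The generators are
  eliminated one at a time: for a submodule \<open>L \<supseteq> N\<close> that generates \<open>M\<close> together with the remaining
  generators there is \<open>j \<in> 1 + I\<close> with \<open>j M \<subseteq> L\<close>.
\<close>

lemma nakayama:
  assumes N: "submodule N R M" and I: "ideal I R"
    and S: "finite S" "S \<subseteq> carrier M"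
    and gen: "\<And>F. submodule F R M \<Longrightarrow> S \<subseteq> F \<Longrightarrow> F = carrier M"
    and NI: "\<And>Q. subgroup Q (add_monoid M) \<Longrightarrow> N \<subseteq> Q \<Longrightarrow>
      (\<And>r x. r \<in> I \<Longrightarrow> x \<in> carrier M \<Longrightarrow> r \<odot>\<^bsub>M\<^esub> x \<in> Q) \<Longrightarrow> Q = carrier M"
  shows "\<exists>i\<in>I. \<forall>x\<in>carrier M. (\<one> \<ominus> i) \<odot>\<^bsub>M\<^esub> x \<in> N"
proof -
  interpret I: ideal I R by fact
  have IR: "i \<in> carrier R" if "i \<in> I" for i using that I.a_subset by auto
  have "\<exists>j\<in>carrier R. \<one> \<ominus> j \<in> I \<and> (\<forall>x\<in>carrier M. j \<odot>\<^bsub>M\<^esub> x \<in> L)"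
    if "submodule L R M" "N \<subseteq> L" "\<And>F. submodule F R M \<Longrightarrow> L \<union> S \<subseteq> F \<Longrightarrow> F = carrier M" for L
    using S that
  proof (induction S arbitrary: L)
    case empty
    then have "L = carrier M" by blast
    then show ?case using I.zero_closed by (intro bexI[of _ \<one>]) (auto simp: R.r_neg R.minus_eq)
  next
    case (insert s S)
    note L = submoduleE[OF insert.prems(2)]
    have LM: "l \<in> carrier M" if "l \<in> L" for l using that L(1) by auto
    have L0: "\<zero>\<^bsub>M\<^esub> \<in> L" using L(2,3,5) LM by (metis M.r_neg equals0I)
    have s: "s \<in> carrier M" using insert by auto
    let ?L = "{l \<oplus>\<^bsub>M\<^esub> b \<odot>\<^bsub>M\<^esub> s | l b. l \<in> L \<and> b \<in> carrier R}"
    have LL: "L \<subseteq> ?L"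
    proof
      fix l assume "l \<in> L"
      then show "l \<in> ?L" using LM s by (intro CollectI exI[of _ l] exI[of _ \<zero>]) auto
    qed
    have sL: "s \<in> ?L" using L0 s by (intro CollectI exI[of _ "\<zero>\<^bsub>M\<^esub>"] exI[of _ \<one>]) auto
    obtain j where j: "j \<in> carrier R" "\<one> \<ominus> j \<in> I" "\<And>x. x \<in> carrier M \<Longrightarrow> j \<odot>\<^bsub>M\<^esub> x \<in> ?L"
    proof -
      have "\<exists>j\<in>carrier R. \<one> \<ominus> j \<in> I \<and> (\<forall>x\<in>carrier M. j \<odot>\<^bsub>M\<^esub> x \<in> ?L)"
      proof (rule insert.IH)
        show "submodule ?L R M" by (rule span_insert_submodule[OF insert.prems(2) s])
        show "N \<subseteq> ?L" using LL insert.prems(3) by blast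
        show "S \<subseteq> carrier M" using insert.prems by auto
        fix F assume "submodule F R M" "?L \<union> S \<subseteq> F"
        then show "F = carrier M" using LL sL by (intro insert.prems(4)) blast+
      qed
      then show ?thesis using that by blast
    qed
    \<comment> \<open>The condition on \<open>N\<close> and \<open>I\<close> puts \<open>j \<odot> s\<close> into \<open>L + I s\<close>.\<close>
    let ?J = "{l \<oplus>\<^bsub>M\<^esub> g \<odot>\<^bsub>M\<^esub> s | l g. l \<in> L \<and> g \<in> I}"
    let ?Q = "{x \<in> carrier M. j \<odot>\<^bsub>M\<^esub> x \<in> ?J}"
    have LJ: "l \<in> ?J" if "l \<in> L" for l
      using that LM s by (intro CollectI exI[of _ l] exI[of _ \<zero>]) auto
    have "?Q = carrier M"
    proof (rule NI)
      show "N \<subseteq> ?Q"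
      proof
        fix x assume "x \<in> N"
        then have "x \<in> L" using insert.prems(3) by auto
        then show "x \<in> ?Q" using LJ[OF L(4)[OF j(1)]] LM by blast
      qed
      show "subgroup ?Q (add_monoid M)"
      proof (rule M.add.subgroupI)
        show "?Q \<subseteq> carrier M" by auto
        have "\<zero>\<^bsub>M\<^esub> \<in> ?Q" using LJ[OF L0] j(1) by simp
        then show "?Q \<noteq> {}" by blast
        fix x assume x: "x \<in> ?Q"
        then obtain l g where lg: "j \<odot>\<^bsub>M\<^esub> x = l \<oplus>\<^bsub>M\<^esub> g \<odot>\<^bsub>M\<^esub> s" "l \<in> L" "g \<in> I" by auto
        have "j \<odot>\<^bsub>M\<^esub> (\<ominus>\<^bsub>M\<^esub> x) = \<ominus>\<^bsub>M\<^esub> l \<oplus>\<^bsub>M\<^esub> (\<ominus> g) \<odot>\<^bsub>M\<^esub> s"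
          using x lg j(1) s LM IR by (simp add: smult_r_minus smult_l_minus M.minus_add)
        then show "\<ominus>\<^bsub>M\<^esub> x \<in> ?Q" using x lg L(3) by auto
        fix y assume y: "y \<in> ?Q"
        then obtain l' g' where lg': "j \<odot>\<^bsub>M\<^esub> y = l' \<oplus>\<^bsub>M\<^esub> g' \<odot>\<^bsub>M\<^esub> s" "l' \<in> L" "g' \<in> I" by auto
        have "j \<odot>\<^bsub>M\<^esub> (x \<oplus>\<^bsub>M\<^esub> y) = (l \<oplus>\<^bsub>M\<^esub> l') \<oplus>\<^bsub>M\<^esub> (g \<oplus> g') \<odot>\<^bsub>M\<^esub> s"
          using x y lg lg' j(1) s LM IR by (simp add: smult_r_distr smult_l_distr M.a_ac)
        then show "x \<oplus>\<^bsub>M\<^esub> y \<in> ?Q" using x y lg lg' L(5) I.a_closed by auto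
      qed
      fix r x assume r: "r \<in> I" and x: "x \<in> carrier M"
      obtain l b where lb: "j \<odot>\<^bsub>M\<^esub> x = l \<oplus>\<^bsub>M\<^esub> b \<odot>\<^bsub>M\<^esub> s" "l \<in> L" "b \<in> carrier R"
        using j(3)[OF x] by auto
      have "j \<odot>\<^bsub>M\<^esub> (r \<odot>\<^bsub>M\<^esub> x) = r \<odot>\<^bsub>M\<^esub> (j \<odot>\<^bsub>M\<^esub> x)"
        using j(1) r x IR by (simp add: smult_assoc1[symmetric] R.m_comm)
      also have "\<dots> = r \<odot>\<^bsub>M\<^esub> l \<oplus>\<^bsub>M\<^esub> (r \<otimes> b) \<odot>\<^bsub>M\<^esub> s"
        using lb r IR LM s by (simp add: smult_r_distr smult_assoc1)
      finally have "j \<odot>\<^bsub>M\<^esub> (r \<odot>\<^bsub>M\<^esub> x) \<in> ?J"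
        using L(4)[OF IR[OF r] lb(2)] I.I_r_closed[OF r lb(3)]
        by (intro CollectI exI[of _ "r \<odot>\<^bsub>M\<^esub> l"] exI[of _ "r \<otimes> b"]) simp
      then show "r \<odot>\<^bsub>M\<^esub> x \<in> ?Q" using r IR x by simp
    qed
    then have "s \<in> ?Q" using s by simp
    then obtain l g where lg: "j \<odot>\<^bsub>M\<^esub> s = l \<oplus>\<^bsub>M\<^esub> g \<odot>\<^bsub>M\<^esub> s" "l \<in> L" "g \<in> I" by blast
    have jg: "(j \<ominus> g) \<odot>\<^bsub>M\<^esub> s \<in> L"
    proof -
      have "(j \<ominus> g) \<odot>\<^bsub>M\<^esub> s = j \<odot>\<^bsub>M\<^esub> s \<oplus>\<^bsub>M\<^esub> \<ominus>\<^bsub>M\<^esub> (g \<odot>\<^bsub>M\<^esub> s)"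
        using j(1) lg(3) IR s by (simp add: R.minus_eq smult_l_distr smult_l_minus)
      also have "\<dots> = l"
        using lg LM IR s by (simp add: M.a_assoc M.r_neg)
      finally show ?thesis using lg by simp
    qed
    let ?j = "(j \<ominus> g) \<otimes> j"
    have "?j \<odot>\<^bsub>M\<^esub> x \<in> L" if x: "x \<in> carrier M" for x
    proof -
      obtain l b where lb: "j \<odot>\<^bsub>M\<^esub> x = l \<oplus>\<^bsub>M\<^esub> b \<odot>\<^bsub>M\<^esub> s" "l \<in> L" "b \<in> carrier R"
        using j(3)[OF x] by auto
      have "?j \<odot>\<^bsub>M\<^esub> x = (j \<ominus> g) \<odot>\<^bsub>M\<^esub> (l \<oplus>\<^bsub>M\<^esub> b \<odot>\<^bsub>M\<^esub> s)"
        using lb j(1) lg(3) IR x by (simp add: smult_assoc1)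
      also have "\<dots> = (j \<ominus> g) \<odot>\<^bsub>M\<^esub> l \<oplus>\<^bsub>M\<^esub> b \<odot>\<^bsub>M\<^esub> ((j \<ominus> g) \<odot>\<^bsub>M\<^esub> s)"
        using lb j(1) lg(3) IR LM s by (simp add: smult_r_distr smult_assoc1[symmetric] R.m_comm)
      finally show ?thesis using lb jg j(1) lg(3) IR L(4,5) by simp
    qed
    moreover have "\<one> \<ominus> ?j \<in> I"
    proof -
      have "\<one> \<ominus> ?j = (\<one> \<ominus> j) \<oplus> ((\<one> \<ominus> j) \<otimes> j \<oplus> g \<otimes> j)"
        using j(1) lg(3) IR by (algebra)
      then show ?thesis using j lg I.I_r_closed I.a_closed by simp
    qed
    ultimately show ?case using j(1) lg(3) IR by (intro bexI[of _ ?j]) auto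
  qed
  from this[OF N order_refl] gen
  obtain j where j: "j \<in> carrier R" "\<one> \<ominus> j \<in> I" "\<forall>x\<in>carrier M. j \<odot>\<^bsub>M\<^esub> x \<in> N"
    by auto
  have "\<one> \<ominus> (\<one> \<ominus> j) = j" using j(1) by algebra
  then show ?thesis using j by (intro bexI[of _ "\<one> \<ominus> j"]) auto
qed

text \<open>
  A submodule \<open>N\<close> of a finitely generated module \<open>M\<close> is all of \<open>M\<close> if \<open>M = N + \<pp> M\<close> for every maximal
  ideal \<open>\<pp>\<close>: by Nakayama's lemma the ideal of those \<open>r\<close> with \<open>r M \<subseteq> N\<close> lies in no maximal ideal.
\<close>

lemma surj_of_surj_mod_maximal:
  assumes noeth: "noetherian_ring R"
    and S: "finite S" "S \<subseteq> carrier M"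
    and gen: "\<And>F. submodule F R M \<Longrightarrow> S \<subseteq> F \<Longrightarrow> F = carrier M"
    and N: "submodule N R M"
    and surj: "\<And>\<pp> Q. maximalideal \<pp> R \<Longrightarrow> subgroup Q (add_monoid M) \<Longrightarrow> N \<subseteq> Q \<Longrightarrow>
      (\<And>r x. r \<in> \<pp> \<Longrightarrow> x \<in> carrier M \<Longrightarrow> r \<odot>\<^bsub>M\<^esub> x \<in> Q) \<Longrightarrow> Q = carrier M"
  shows "N = carrier M"
proof -
  note NE = submoduleE[OF N]
  have NM: "x \<in> carrier M" if "x \<in> N" for x using that NE(1) by auto
  have N0: "\<zero>\<^bsub>M\<^esub> \<in> N" using NE(2,3,5) NM by (metis M.r_neg equals0I)
  let ?I = "{r \<in> carrier R. \<forall>x\<in>carrier M. r \<odot>\<^bsub>M\<^esub> x \<in> N}"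
  have I: "ideal ?I R"
  proof (rule idealI)
    show "ring R" by (rule R.ring_axioms)
    show "subgroup ?I (add_monoid R)"
    proof (rule R.add.subgroupI)
      have "\<zero> \<in> ?I" using N0 by simp
      then show "?I \<noteq> {}" by blast
      fix r assume r: "r \<in> ?I"
      then show "\<ominus> r \<in> ?I" using NE(3) by (simp add: smult_l_minus)
      fix r' assume "r' \<in> ?I"
      then show "r \<oplus> r' \<in> ?I" using r NE(5) by (simp add: smult_l_distr)
    qed auto
    fix a x assume a: "a \<in> ?I" and x: "x \<in> carrier R"
    show "x \<otimes> a \<in> ?I" using a x NE(4) by (simp add: smult_assoc1)
    then show "a \<otimes> x \<in> ?I" using a x by (simp add: R.m_comm)
  qed
  have "?I = carrier R"
  proof (rule ccontr)
    assume "?I \<noteq> carrier R"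
    then obtain \<pp> where p: "maximalideal \<pp> R" "?I \<subseteq> \<pp>"
      using noetherian_ring.exists_maximalideal[OF noeth I] by blast
    interpret p: maximalideal \<pp> R by fact
    obtain i where i: "i \<in> \<pp>" "\<forall>x\<in>carrier M. (\<one> \<ominus> i) \<odot>\<^bsub>M\<^esub> x \<in> N"
      using nakayama[OF N p.ideal_axioms S gen surj[OF p(1)]] by blast
    then have iR: "i \<in> carrier R" using p.a_subset by auto
    then have "\<one> \<ominus> i \<in> \<pp>" using i p(2) by auto
    then have "(\<one> \<ominus> i) \<oplus> i \<in> \<pp>" using i(1) p.a_closed by blast
    moreover have "(\<one> \<ominus> i) \<oplus> i = \<one>" using iR by algebra
    ultimately show False using p.I_notcarr p.one_imp_carrier by auto
  qed
  then have "\<one> \<in> ?I" by simp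
  then show ?thesis using NE(1) by fastforce
qed

text \<open>
  Nakayama's lemma for \<open>N = 0\<close> and the principal ideal of \<open>a\<close> gives \<open>b\<close> with \<open>(1 - b a) M = 0\<close>.
\<close>

lemma smult_inj_of_surj:
  assumes S: "finite S" "S \<subseteq> carrier M"
    and gen: "\<And>F. submodule F R M \<Longrightarrow> S \<subseteq> F \<Longrightarrow> F = carrier M"
    and a: "a \<in> carrier R" and surj: "(\<lambda>x. a \<odot>\<^bsub>M\<^esub> x) ` carrier M = carrier M"
    and x: "x \<in> carrier M" "a \<odot>\<^bsub>M\<^esub> x = \<zero>\<^bsub>M\<^esub>"
  shows "x = \<zero>\<^bsub>M\<^esub>"
proof -
  have aI: "a \<in> PIdl a" using a by (rule R.cgenideal_self)
  have "\<exists>i\<in>PIdl a. \<forall>x\<in>carrier M. (\<one> \<ominus> i) \<odot>\<^bsub>M\<^esub> x \<in> {\<zero>\<^bsub>M\<^esub>}"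
  proof (rule nakayama[OF _ R.cgenideal_ideal[OF a] S gen])
    show "submodule {\<zero>\<^bsub>M\<^esub>} R M" by (rule submoduleI) auto
    fix Q assume Q: "subgroup Q (add_monoid M)"
      "\<And>r x. r \<in> PIdl a \<Longrightarrow> x \<in> carrier M \<Longrightarrow> r \<odot>\<^bsub>M\<^esub> x \<in> Q"
    have "Q \<subseteq> carrier M" using subgroup.subset[OF Q(1)] by simp
    moreover have "carrier M \<subseteq> Q" using surj Q(2)[OF aI] by force
    ultimately show "Q = carrier M" by auto
  qed auto
  then obtain b where b: "b \<in> carrier R" "(\<one> \<ominus> b \<otimes> a) \<odot>\<^bsub>M\<^esub> x = \<zero>\<^bsub>M\<^esub>"
    using x(1) unfolding cgenideal_def by auto
  have "x = (\<one> \<ominus> b \<otimes> a \<oplus> b \<otimes> a) \<odot>\<^bsub>M\<^esub> x"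
  proof -
    have "\<one> \<ominus> b \<otimes> a \<oplus> b \<otimes> a = \<one>" using a b(1) by algebra
    then show ?thesis using x by simp
  qed
  also have "\<dots> = (\<one> \<ominus> b \<otimes> a) \<odot>\<^bsub>M\<^esub> x \<oplus>\<^bsub>M\<^esub> (b \<otimes> a) \<odot>\<^bsub>M\<^esub> x"
    using a b x by (intro smult_l_distr) auto
  also have "\<dots> = \<zero>\<^bsub>M\<^esub>" using a b x by (simp add: smult_assoc1)
  finally show ?thesis .
qed

end

context left_module
begin

lemma smult_l_zero: "x \<in> carrier M \<Longrightarrow> \<zero> \<odot>\<^bsub>M\<^esub> x = \<zero>\<^bsub>M\<^esub>"
  using smult_l_distr[of \<zero> \<zero> x] smult_closed[of \<zero> x] by (metis A.zero_closed A.l_zero M.add.r_cancel_one')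

lemma smult_r_zero: "a \<in> carrier A \<Longrightarrow> a \<odot>\<^bsub>M\<^esub> \<zero>\<^bsub>M\<^esub> = \<zero>\<^bsub>M\<^esub>"
  using smult_r_distr[of a "\<zero>\<^bsub>M\<^esub>" "\<zero>\<^bsub>M\<^esub>"] smult_closed[of a "\<zero>\<^bsub>M\<^esub>"]
  by (metis M.zero_closed M.l_zero M.add.r_cancel_one')

lemma smult_r_minus: "a \<in> carrier A \<Longrightarrow> x \<in> carrier M \<Longrightarrow> a \<odot>\<^bsub>M\<^esub> (\<ominus>\<^bsub>M\<^esub> x) = \<ominus>\<^bsub>M\<^esub> (a \<odot>\<^bsub>M\<^esub> x)"
  by (metis M.add.inv_closed M.l_neg M.minus_equality smult_closed smult_r_distr smult_r_zero)

text \<open>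
  Over a noncommutative ring an element that acts surjectively still acts bijectively if the module
  is finitely generated over a set \<open>Z\<close> of central elements.
\<close>

lemma smult_surj_imp_bij:
  assumes S: "finite S" "S \<subseteq> carrier M"
    and Z: "Z \<subseteq> carrier A" "\<And>z b. z \<in> Z \<Longrightarrow> b \<in> carrier A \<Longrightarrow> z \<otimes> b = b \<otimes> z"
    and gen: "\<And>F. subgroup F (add_monoid M) \<Longrightarrow> (\<And>z x. z \<in> Z \<Longrightarrow> x \<in> F \<Longrightarrow> z \<odot>\<^bsub>M\<^esub> x \<in> F) \<Longrightarrow>
       S \<subseteq> F \<Longrightarrow> F = carrier M"
    and a: "a \<in> carrier A" and surj: "(\<lambda>x. a \<odot>\<^bsub>M\<^esub> x) ` carrier M = carrier M"
  shows "bij_betw (\<lambda>x. a \<odot>\<^bsub>M\<^esub> x) (carrier M) (carrier M)"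
proof -
  \<comment> \<open>The double centralizer of \<open>a\<close> is a commutative ring that contains \<open>a\<close> and \<open>Z\<close>.\<close>
  define Ca where "Ca = {b \<in> carrier A. a \<otimes> b = b \<otimes> a}"
  define B where "B = {b \<in> carrier A. \<forall>d\<in>Ca. d \<otimes> b = b \<otimes> d}"
  have BA: "b \<in> carrier A" if "b \<in> B" for b using that unfolding B_def by auto
  have aB: "a \<in> B" using a unfolding B_def Ca_def by auto
  have ZB: "z \<in> B" if "z \<in> Z" for z using that Z unfolding B_def Ca_def by auto
  have comm: "b \<otimes> b' = b' \<otimes> b" if "b \<in> B" "b' \<in> B" for b b'
  proof -
    have "b \<in> Ca" using that(1) a unfolding B_def Ca_def by simp
    then show ?thesis using that(2) unfolding B_def by auto
  qed
  have sub: "subring B A"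
  proof (rule subringI)
    show "\<one> \<in> B" unfolding B_def Ca_def by auto
    fix h assume "h \<in> B" then show "\<ominus> h \<in> B" unfolding B_def Ca_def by (auto simp: r_minus l_minus)
    fix h' assume h: "h \<in> B" "h' \<in> B"
    then show "h \<oplus> h' \<in> B" unfolding B_def Ca_def by (auto simp: r_distr l_distr)
    show "h \<otimes> h' \<in> B"
    proof -
      have "d \<otimes> (h \<otimes> h') = h \<otimes> h' \<otimes> d" if "d \<in> Ca" for d
      proof -
        have d: "d \<in> carrier A" using that unfolding Ca_def by auto
        have c: "d \<otimes> h = h \<otimes> d" "d \<otimes> h' = h' \<otimes> d" using h that unfolding B_def by blast+
        have "d \<otimes> (h \<otimes> h') = (d \<otimes> h) \<otimes> h'" using d h BA by (simp add: A.m_assoc)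
        also have "\<dots> = h \<otimes> (d \<otimes> h')" unfolding c(1) using d h BA by (simp add: A.m_assoc)
        also have "\<dots> = h \<otimes> h' \<otimes> d" unfolding c(2) using d h BA by (simp add: A.m_assoc)
        finally show ?thesis .
      qed
      moreover have "h \<otimes> h' \<in> carrier A" using h BA by simp
      ultimately show ?thesis unfolding B_def by blast
    qed
  qed (auto simp: B_def)
  interpret B: cring "A\<lparr>carrier := B\<rparr>"
    using subcring_iff[OF subringE(1)[OF sub]] subcringI[OF sub comm] by blast
  interpret BM: module "A\<lparr>carrier := B\<rparr>" M
    by (intro moduleI B.is_cring M.abelian_group_axioms)
      (use BA in \<open>auto simp: smult_closed smult_l_distr smult_r_distr smult_assoc smult_one\<close>)
  have inj: "x = \<zero>\<^bsub>M\<^esub>" if "x \<in> carrier M" "a \<odot>\<^bsub>M\<^esub> x = \<zero>\<^bsub>M\<^esub>" for x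
  proof (rule BM.smult_inj_of_surj[OF S _ _ surj that])
    show "a \<in> carrier (A\<lparr>carrier := B\<rparr>)" using aB by simp
    fix F assume F: "submodule F (A\<lparr>carrier := B\<rparr>) M" "S \<subseteq> F"
    show "F = carrier M"
      using F(2) ZB BM.submoduleE(4)[OF F(1)] submodule.axioms(1)[OF F(1)] by (intro gen) auto
  qed
  have "inj_on (\<lambda>x. a \<odot>\<^bsub>M\<^esub> x) (carrier M)"
  proof (rule inj_onI)
    fix x y assume xy: "x \<in> carrier M" "y \<in> carrier M" "a \<odot>\<^bsub>M\<^esub> x = a \<odot>\<^bsub>M\<^esub> y"
    have "a \<odot>\<^bsub>M\<^esub> (x \<oplus>\<^bsub>M\<^esub> \<ominus>\<^bsub>M\<^esub> y) = \<zero>\<^bsub>M\<^esub>"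
      using xy a by (simp add: smult_r_distr smult_r_minus smult_closed M.r_neg)
    then have "x \<oplus>\<^bsub>M\<^esub> \<ominus>\<^bsub>M\<^esub> y = \<zero>\<^bsub>M\<^esub>" using inj xy by simp
    then show "x = y" using xy by (metis M.add.inv_closed M.minus_equality M.minus_minus)
  qed
  then show ?thesis using surj by (simp add: bij_betw_def)
qed

end

section \<open>Finite-dimensional spaces over a residue field\<close>

text \<open>
  An \<open>R\<close>-module that is annihilated by the maximal ideal \<open>\<pp>\<close> and generated by the finite set \<open>S\<close>, i.e.
  a finite-dimensional vector space over \<open>R/\<pp>\<close>.  Coefficients are taken in \<open>R\<close>, and nonzero means
  outside \<open>\<pp>\<close>.
\<close>

locale residue_space = module R V for R (structure) and V (structure) +
  fixes \<pp> and S
  assumes maximal: "maximalideal \<pp> R"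
    and annihilates: "\<lbrakk>r \<in> \<pp>; x \<in> carrier V\<rbrakk> \<Longrightarrow> r \<odot>\<^bsub>V\<^esub> x = \<zero>\<^bsub>V\<^esub>"
    and finite_S: "finite S" and S_subset: "S \<subseteq> carrier V"
    and generates: "\<lbrakk>submodule F R V; S \<subseteq> F\<rbrakk> \<Longrightarrow> F = carrier V"
begin

sublocale p: maximalideal \<pp> R by (rule maximal)

lemma p_prime: "primeideal \<pp> R"
  using maximal by (rule R.maximalideal_prime)

lemma inverse_mod:
  assumes "r \<in> carrier R" "r \<notin> \<pp>"
  shows "\<exists>r'\<in>carrier R. \<forall>x\<in>carrier V. r' \<odot>\<^bsub>V\<^esub> (r \<odot>\<^bsub>V\<^esub> x) = x"
proof -
  have J: "ideal (\<pp> <+> PIdl r) R"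
    using p.ideal_axioms R.cgenideal_ideal[OF assms(1)] by (rule R.add_ideals)
  have pR: "a \<in> carrier R" if "a \<in> \<pp>" for a using that p.a_subset by auto
  have "\<pp> \<subseteq> \<pp> <+> PIdl r"
  proof
    fix a assume a: "a \<in> \<pp>"
    have "\<zero> = \<zero> \<otimes> r" using assms(1) by simp
    then have "\<zero> \<in> PIdl r" unfolding cgenideal_def by blast
    moreover have "a = a \<oplus> \<zero>" using a pR by simp
    ultimately show "a \<in> \<pp> <+> PIdl r" using a unfolding set_add_def' by blast
  qed
  moreover have "r \<in> \<pp> <+> PIdl r"
  proof -
    have "r = \<zero> \<oplus> r" using assms(1) by simp
    then show ?thesis
      using R.cgenideal_self[OF assms(1)] p.zero_closed unfolding set_add_def' by blast
  qed
  ultimately have "\<pp> <+> PIdl r = carrier R"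
    using p.I_maximal[OF J] assms(2) additive_subgroup.a_subset[OF ideal.axioms(1)[OF J]] by blast
  then have "\<one> \<in> \<pp> <+> PIdl r" by simp
  then obtain a b where ab: "a \<in> \<pp>" "b \<in> carrier R" "\<one> = a \<oplus> b \<otimes> r"
    unfolding set_add_def' cgenideal_def by auto
  show ?thesis
  proof (intro bexI[of _ b] ballI)
    fix x assume x: "x \<in> carrier V"
    have "x = (a \<oplus> b \<otimes> r) \<odot>\<^bsub>V\<^esub> x" using x ab(3)[symmetric] by simp
    also have "\<dots> = a \<odot>\<^bsub>V\<^esub> x \<oplus>\<^bsub>V\<^esub> (b \<otimes> r) \<odot>\<^bsub>V\<^esub> x"
      using x ab assms(1) pR by (intro smult_l_distr) auto
    also have "\<dots> = b \<odot>\<^bsub>V\<^esub> (r \<odot>\<^bsub>V\<^esub> x)"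
      using x ab assms(1) pR annihilates by (simp add: smult_assoc1)
    finally show "b \<odot>\<^bsub>V\<^esub> (r \<odot>\<^bsub>V\<^esub> x) = x" by simp
  qed (rule ab)
qed

lemma smult_eq_zero_imp_mem:
  assumes "r \<in> carrier R" "x \<in> carrier V" "r \<odot>\<^bsub>V\<^esub> x = \<zero>\<^bsub>V\<^esub>" "x \<noteq> \<zero>\<^bsub>V\<^esub>"
  shows "r \<in> \<pp>"
  using inverse_mod[OF assms(1)] assms by force

lemma submodule_zero: "submodule F R V \<Longrightarrow> \<zero>\<^bsub>V\<^esub> \<in> F"
  using subgroup.one_closed[OF submodule.axioms(1)] by force

lemma submodule_smult_cancel:
  assumes "submodule F R V" "r \<in> carrier R" "r \<notin> \<pp>" "x \<in> carrier V" "r \<odot>\<^bsub>V\<^esub> x \<in> F"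
  shows "x \<in> F"
  using inverse_mod[OF assms(2,3)] assms submoduleE(4)[OF assms(1)] by metis

text \<open>A linear combination of the members of a family of vectors.\<close>

definition comb :: "'i set \<Rightarrow> ('i \<Rightarrow> 'a) \<Rightarrow> ('i \<Rightarrow> 'c) \<Rightarrow> 'c"
  where "comb I f v = (\<Oplus>\<^bsub>V\<^esub>i\<in>I. f i \<odot>\<^bsub>V\<^esub> v i)"

lemma comb_closed:
  "\<lbrakk>f \<in> I \<rightarrow> carrier R; v \<in> I \<rightarrow> carrier V\<rbrakk> \<Longrightarrow> comb I f v \<in> carrier V"
  unfolding comb_def by (rule M.finsum_closed) auto

lemma comb_in_submodule:
  assumes "submodule F R V" "finite I" "f \<in> I \<rightarrow> carrier R" "v \<in> I \<rightarrow> F"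
  shows "comb I f v \<in> F"
  using assms(2-4)
proof (induction I)
  case empty then show ?case using submodule_zero[OF assms(1)] by (simp add: comb_def)
next
  case (insert i I)
  note F = submoduleE[OF assms(1)]
  have "comb (insert i I) f v = f i \<odot>\<^bsub>V\<^esub> v i \<oplus>\<^bsub>V\<^esub> comb I f v"
    unfolding comb_def using insert F(1) by (intro M.finsum_insert) auto
  then show ?case using insert F by auto
qed

lemma comb_diff:
  assumes "finite I" "f \<in> I \<rightarrow> carrier R" "g \<in> I \<rightarrow> carrier R" "v \<in> I \<rightarrow> carrier V"
    "r \<in> carrier R" "r' \<in> carrier R"
  shows "comb I (\<lambda>i. r \<otimes> f i \<ominus> r' \<otimes> g i) v = r \<odot>\<^bsub>V\<^esub> comb I f v \<ominus>\<^bsub>V\<^esub> r' \<odot>\<^bsub>V\<^esub> comb I g v"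
  using assms
proof (induction I)
  case empty then show ?case by (simp add: comb_def M.minus_eq M.r_neg)
next
  case (insert i I)
  have e: "comb (insert i I) k v = k i \<odot>\<^bsub>V\<^esub> v i \<oplus>\<^bsub>V\<^esub> comb I k v" if "k \<in> insert i I \<rightarrow> carrier R" for k
    unfolding comb_def using insert that by (intro M.finsum_insert) auto
  have c: "comb I f v \<in> carrier V" "comb I g v \<in> carrier V" using insert by (auto intro!: comb_closed)
  have mem: "f i \<in> carrier R" "g i \<in> carrier R" "v i \<in> carrier V" using insert by auto
  have "comb (insert i I) (\<lambda>i. r \<otimes> f i \<ominus> r' \<otimes> g i) v
    = (r \<otimes> f i \<ominus> r' \<otimes> g i) \<odot>\<^bsub>V\<^esub> v i \<oplus>\<^bsub>V\<^esub> (r \<odot>\<^bsub>V\<^esub> comb I f v \<ominus>\<^bsub>V\<^esub> r' \<odot>\<^bsub>V\<^esub> comb I g v)"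
    using insert by (subst e) auto
  also have "\<dots> = r \<odot>\<^bsub>V\<^esub> (f i \<odot>\<^bsub>V\<^esub> v i \<oplus>\<^bsub>V\<^esub> comb I f v) \<ominus>\<^bsub>V\<^esub> r' \<odot>\<^bsub>V\<^esub> (g i \<odot>\<^bsub>V\<^esub> v i \<oplus>\<^bsub>V\<^esub> comb I g v)"
    using c mem insert.prems(4,5)
    by (simp add: M.minus_eq R.minus_eq smult_l_distr smult_r_distr smult_assoc1 smult_l_minus M.minus_add M.a_ac)
  finally show ?case using insert by (simp add: e)
qed

lemma comb_fun_upd_zero:
  assumes "finite I" "i \<in> I" "g \<in> I - {i} \<rightarrow> carrier R" "v \<in> I \<rightarrow> carrier V"
  shows "comb I (g(i := \<zero>)) v = comb (I - {i}) g v"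
proof -
  have "comb (insert i (I - {i})) (g(i := \<zero>)) v = \<zero> \<odot>\<^bsub>V\<^esub> v i \<oplus>\<^bsub>V\<^esub> comb (I - {i}) (g(i := \<zero>)) v"
    unfolding comb_def using assms
    by (subst M.finsum_insert) (auto simp: Pi_iff split: if_splits intro!: smult_closed)
  moreover have "comb (I - {i}) (g(i := \<zero>)) v = comb (I - {i}) g v"
    unfolding comb_def
  proof (rule M.finsum_cong')
    show "(\<lambda>j. g j \<odot>\<^bsub>V\<^esub> v j) \<in> I - {i} \<rightarrow> carrier V"
      using funcset_mem[OF assms(3)] funcset_mem[OF assms(4)] by simp
  qed auto
  moreover have "comb (I - {i}) g v \<in> carrier V" using assms by (intro comb_closed) auto
  moreover have "insert i (I - {i}) = I" "v i \<in> carrier V" using assms by auto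
  ultimately show ?thesis by simp
qed

text \<open>
  More than \<open>card B\<close> vectors are linearly dependent modulo \<open>L\<close> if \<open>L\<close> and \<open>B\<close> generate the space.  For
  \<open>B\<close> with one more element \<open>s\<close>, two dependencies modulo \<open>L + R s\<close>, the second of which avoids an index
  that occurs in the first, combine to one in which \<open>s\<close> cancels.
\<close>

lemma exists_dependency_mod:
  assumes "finite B" "B \<subseteq> carrier V" "submodule L R V"
    and "\<And>F. submodule F R V \<Longrightarrow> L \<union> B \<subseteq> F \<Longrightarrow> F = carrier V"
    and "finite I" "card I > card B" "v \<in> I \<rightarrow> carrier V"
  shows "\<exists>f\<in>I \<rightarrow> carrier R. (\<exists>i\<in>I. f i \<notin> \<pp>) \<and> comb I f v \<in> L"
  using assms
proof (induction B arbitrary: L I)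
  case empty
  have L: "L = carrier V" using empty.prems(3)[OF empty.prems(2)] by simp
  have "I \<noteq> {}" using empty.prems(5) by auto
  then obtain i where "i \<in> I" by blast
  moreover have "\<one> \<notin> \<pp>" using p.I_notcarr p.one_imp_carrier by auto
  moreover have "comb I (\<lambda>_. \<one>) v \<in> L" using empty.prems(6) L by (simp add: comb_closed)
  ultimately show ?case by (intro bexI[of _ "\<lambda>_. \<one>"]) auto
next
  case (insert s B)
  note L = submoduleE[OF insert.prems(2)]
  have LV: "l \<in> carrier V" if "l \<in> L" for l using that L(1) by auto
  note L0 = submodule_zero[OF insert.prems(2)]
  have s: "s \<in> carrier V" using insert.prems by auto
  let ?L = "{l \<oplus>\<^bsub>V\<^esub> b \<odot>\<^bsub>V\<^esub> s | l b. l \<in> L \<and> b \<in> carrier R}"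
  have L': "submodule ?L R V" by (rule span_insert_submodule[OF insert.prems(2) s])
  have LL: "L \<subseteq> ?L"
  proof
    fix l assume "l \<in> L"
    then show "l \<in> ?L" using LV s by (intro CollectI exI[of _ l] exI[of _ \<zero>]) auto
  qed
  have sL: "s \<in> ?L" using L0 s by (intro CollectI exI[of _ "\<zero>\<^bsub>V\<^esub>"] exI[of _ \<one>]) auto
  have gen: "F = carrier V" if "submodule F R V" "?L \<union> B \<subseteq> F" for F
    using that LL sL by (intro insert.prems(3)) blast+
  have IH: "\<exists>f\<in>J \<rightarrow> carrier R. (\<exists>i\<in>J. f i \<notin> \<pp>) \<and> comb J f v \<in> ?L"
    if "finite J" "card J > card B" "J \<subseteq> I" for J
    using insert.prems that by (intro insert.IH[OF _ L' gen]) auto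
  have vI: "v \<in> I \<rightarrow> carrier V" and finI: "finite I" using insert.prems by auto
  obtain f i0 where f: "f \<in> I \<rightarrow> carrier R" "i0 \<in> I" "f i0 \<notin> \<pp>" "comb I f v \<in> ?L"
    using IH[of I] insert by auto
  obtain l r where lr: "comb I f v = l \<oplus>\<^bsub>V\<^esub> r \<odot>\<^bsub>V\<^esub> s" "l \<in> L" "r \<in> carrier R" using f(4) by auto
  show ?case
  proof (cases "r \<in> \<pp>")
    case True
    then have "comb I f v = l" using lr s annihilates LV by simp
    then show ?thesis using f lr by auto
  next
    case r: False
    have "card (I - {i0}) > card B" using insert.hyps insert.prems(5) f(2) finI by simp
    then have "\<exists>g\<in>I - {i0} \<rightarrow> carrier R. (\<exists>i\<in>I - {i0}. g i \<notin> \<pp>) \<and> comb (I - {i0}) g v \<in> ?L"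
      using finI by (intro IH) simp_all
    then obtain g i1 where g: "g \<in> I - {i0} \<rightarrow> carrier R" "i1 \<in> I - {i0}" "g i1 \<notin> \<pp>" "comb (I - {i0}) g v \<in> ?L"
      by (elim bexE conjE)
    obtain l' r' where lr': "comb (I - {i0}) g v = l' \<oplus>\<^bsub>V\<^esub> r' \<odot>\<^bsub>V\<^esub> s" "l' \<in> L" "r' \<in> carrier R"
      using g(4) by auto
    let ?g = "g(i0 := \<zero>)"
    have gI: "?g \<in> I \<rightarrow> carrier R" using g(1) by auto
    have cg: "comb I ?g v = l' \<oplus>\<^bsub>V\<^esub> r' \<odot>\<^bsub>V\<^esub> s"
      using comb_fun_upd_zero[OF finI f(2) g(1) vI] lr' by simp
    show ?thesis
    proof (cases "r' \<in> \<pp>")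
      case True
      then have "comb I ?g v = l'" using cg lr' s annihilates LV by simp
      then have "comb I ?g v \<in> L" using lr'(2) by simp
      moreover have "i1 \<in> I" "?g i1 \<notin> \<pp>" using g by auto
      ultimately show ?thesis using gI by blast
    next
      case r': False
      let ?h = "\<lambda>i. r \<otimes> ?g i \<ominus> r' \<otimes> f i"
      have fi0: "f i0 \<in> carrier R" using f by auto
      have "?h i0 = \<ominus> (r' \<otimes> f i0)" using lr(3) lr'(3) fi0 by (simp add: R.minus_eq)
      moreover have "r' \<otimes> f i0 \<notin> \<pp>"
        using primeideal.I_prime[OF p_prime lr'(3) fi0] r' f(3) by auto
      ultimately have "?h i0 \<notin> \<pp>"
        using p.a_inv_closed[of "\<ominus> (r' \<otimes> f i0)"] lr'(3) fi0 by auto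
      moreover have "comb I ?h v = r \<odot>\<^bsub>V\<^esub> (l' \<oplus>\<^bsub>V\<^esub> r' \<odot>\<^bsub>V\<^esub> s) \<ominus>\<^bsub>V\<^esub> r' \<odot>\<^bsub>V\<^esub> (l \<oplus>\<^bsub>V\<^esub> r \<odot>\<^bsub>V\<^esub> s)"
        using comb_diff[OF finI gI f(1) vI lr(3) lr'(3)] cg lr(1) by simp
      moreover have "\<dots> = r \<odot>\<^bsub>V\<^esub> l' \<oplus>\<^bsub>V\<^esub> \<ominus>\<^bsub>V\<^esub> (r' \<odot>\<^bsub>V\<^esub> l)"
      proof -
        have "r \<odot>\<^bsub>V\<^esub> (r' \<odot>\<^bsub>V\<^esub> s) = r' \<odot>\<^bsub>V\<^esub> (r \<odot>\<^bsub>V\<^esub> s)"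
          using lr(3) lr'(3) s by (simp add: smult_assoc1[symmetric] R.m_comm)
        moreover have "(a \<oplus>\<^bsub>V\<^esub> z) \<ominus>\<^bsub>V\<^esub> (b \<oplus>\<^bsub>V\<^esub> z) = a \<oplus>\<^bsub>V\<^esub> \<ominus>\<^bsub>V\<^esub> b"
          if "a \<in> carrier V" "b \<in> carrier V" "z \<in> carrier V" for a b z
        proof -
          have "(a \<oplus>\<^bsub>V\<^esub> z) \<ominus>\<^bsub>V\<^esub> (b \<oplus>\<^bsub>V\<^esub> z) = a \<oplus>\<^bsub>V\<^esub> (\<ominus>\<^bsub>V\<^esub> b \<oplus>\<^bsub>V\<^esub> (z \<oplus>\<^bsub>V\<^esub> \<ominus>\<^bsub>V\<^esub> z))"
            using that by (simp add: M.minus_eq M.minus_add M.a_ac)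
          then show ?thesis using that by (simp add: M.r_neg)
        qed
        ultimately show ?thesis using lr lr' s LV by (simp add: smult_r_distr)
      qed
      moreover have "r \<odot>\<^bsub>V\<^esub> l' \<oplus>\<^bsub>V\<^esub> \<ominus>\<^bsub>V\<^esub> (r' \<odot>\<^bsub>V\<^esub> l) \<in> L" using lr lr' L(3-5) by simp
      ultimately have "?h i0 \<notin> \<pp>" "comb I ?h v \<in> L" by simp_all
      moreover have "?h \<in> I \<rightarrow> carrier R"
        using funcset_mem[OF gI] funcset_mem[OF f(1)] lr(3) lr'(3) by simp
      ultimately show ?thesis using f(2) by (intro bexI[of _ ?h] conjI bexI[of _ i0])
    qed
  qed
qed

lemma exists_dependency:
  assumes "finite I" "card I > card S" "v \<in> I \<rightarrow> carrier V"
  shows "\<exists>f\<in>I \<rightarrow> carrier R. (\<exists>i\<in>I. f i \<notin> \<pp>) \<and> comb I f v = \<zero>\<^bsub>V\<^esub>"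
proof -
  have "submodule {\<zero>\<^bsub>V\<^esub>} R V" by (rule submoduleI) auto
  then have "\<exists>f\<in>I \<rightarrow> carrier R. (\<exists>i\<in>I. f i \<notin> \<pp>) \<and> comb I f v \<in> {\<zero>\<^bsub>V\<^esub>}"
    by (rule exists_dependency_mod[OF finite_S S_subset _ _ assms]) (simp add: generates)
  then show ?thesis by simp
qed

text \<open>
  The vectors \<open>v 0, \<dots>, v (n - 1)\<close> lie in \<open>F\<close> and are linearly independent over \<open>R/\<pp>\<close>.
\<close>

definition indep :: "nat \<Rightarrow> (nat \<Rightarrow> 'c) \<Rightarrow> 'c set \<Rightarrow> bool"
  where "indep n v F \<longleftrightarrow> v \<in> {..<n} \<rightarrow> F \<and>
    (\<forall>f\<in>{..<n} \<rightarrow> carrier R. comb {..<n} f v = \<zero>\<^bsub>V\<^esub> \<longrightarrow> (\<forall>i<n. f i \<in> \<pp>))"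

text \<open>
  The largest number of linearly independent vectors in \<open>F\<close>; the set of these numbers is finite and
  contains 0 for every \<open>F \<subseteq> carrier V\<close>.
\<close>

definition rank :: "'c set \<Rightarrow> nat"
  where "rank F = Max {n. \<exists>v. indep n v F}"

lemma indep_le_card: "F \<subseteq> carrier V \<Longrightarrow> indep n v F \<Longrightarrow> n \<le> card S"
  using exists_dependency[of "{..<n}" v] unfolding indep_def by fastforce

lemma finite_indep_sizes:
  assumes "F \<subseteq> carrier V" shows "finite {n. \<exists>v. indep n v F}"
  by (rule finite_subset[of _ "{..card S}"]) (use indep_le_card[OF assms] in auto)

lemma indep_le_rank:
  "F \<subseteq> carrier V \<Longrightarrow> indep n v F \<Longrightarrow> n \<le> rank F"
  unfolding rank_def using finite_indep_sizes by (intro Max_ge) auto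

lemma rank_attained:
  assumes "F \<subseteq> carrier V"
  shows "\<exists>v. indep (rank F) v F"
proof -
  have "indep 0 undefined F" unfolding indep_def by auto
  then have "{n. \<exists>v. indep n v F} \<noteq> {}" by blast
  then show ?thesis using Max_in[OF finite_indep_sizes[OF assms]] unfolding rank_def by blast
qed

lemma rank_psubset:
  assumes F': "submodule F' R V" and F: "F' \<subset> F" "F \<subseteq> carrier V"
  shows "rank F' < rank F"
proof -
  obtain e where e: "e \<in> F" "e \<notin> F'" using F by auto
  have eV: "e \<in> carrier V" using e F by auto
  obtain v where v: "indep (rank F') v F'" using rank_attained F by blast
  let ?n = "rank F'"
  let ?w = "v(?n := e)"
  have vF: "v \<in> {..<?n} \<rightarrow> F'" using v by (auto simp: indep_def)
  then have vV: "v \<in> {..<?n} \<rightarrow> carrier V" using F by blast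
  have "indep (Suc ?n) ?w F"
    unfolding indep_def
  proof (intro conjI ballI impI allI)
    show "?w \<in> {..<Suc ?n} \<rightarrow> F" using vF e F by (fastforce simp: less_Suc_eq Pi_iff)
    fix f i assume f: "f \<in> {..<Suc ?n} \<rightarrow> carrier R" "comb {..<Suc ?n} f ?w = \<zero>\<^bsub>V\<^esub>" and i: "i < Suc ?n"
    have fn: "f ?n \<in> carrier R" and f': "f \<in> {..<?n} \<rightarrow> carrier R" using f by auto
    have "comb {..<Suc ?n} f ?w = f ?n \<odot>\<^bsub>V\<^esub> e \<oplus>\<^bsub>V\<^esub> comb {..<?n} f ?w"
      unfolding comb_def lessThan_Suc using vV eV fn f' by (subst M.finsum_insert) (auto simp: Pi_iff)
    also have "comb {..<?n} f ?w = comb {..<?n} f v"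
      unfolding comb_def using f' vV by (intro M.finsum_cong') auto
    finally have eq: "f ?n \<odot>\<^bsub>V\<^esub> e \<oplus>\<^bsub>V\<^esub> comb {..<?n} f v = \<zero>\<^bsub>V\<^esub>" using f(2) by metis
    have cF: "comb {..<?n} f v \<in> F'" using comb_in_submodule[OF F' _ f' vF] by simp
    then have cV: "comb {..<?n} f v \<in> carrier V" using F by auto
    have "f ?n \<odot>\<^bsub>V\<^esub> e = \<ominus>\<^bsub>V\<^esub> comb {..<?n} f v"
      using eq cV fn eV by (intro M.minus_equality[symmetric]) auto
    then have "f ?n \<odot>\<^bsub>V\<^esub> e \<in> F'" using cF submoduleE(3)[OF F'] by simp
    then have fnp: "f ?n \<in> \<pp>" using submodule_smult_cancel[OF F' fn _ eV] e by blast
    then have "comb {..<?n} f v = \<zero>\<^bsub>V\<^esub>" using eq annihilates eV cV by simp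
    then have "\<forall>i<?n. f i \<in> \<pp>" using v f' by (auto simp: indep_def)
    then show "f i \<in> \<pp>" using i fnp by (auto simp: less_Suc_eq)
  qed
  then show ?thesis using indep_le_rank[OF F(2)] by fastforce
qed

lemma comb_image:
  assumes "finite I" "f \<in> I \<rightarrow> carrier R" "v \<in> I \<rightarrow> F" "submodule F R V"
    and "x \<in> F \<rightarrow> carrier V"
    and "\<And>u w. u \<in> F \<Longrightarrow> w \<in> F \<Longrightarrow> x (u \<oplus>\<^bsub>V\<^esub> w) = x u \<oplus>\<^bsub>V\<^esub> x w"
    and "\<And>r u. r \<in> carrier R \<Longrightarrow> u \<in> F \<Longrightarrow> x (r \<odot>\<^bsub>V\<^esub> u) = r \<odot>\<^bsub>V\<^esub> x u"
  shows "x (comb I f v) = comb I f (\<lambda>i. x (v i))"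
  using assms(1-3)
proof (induction I)
  case empty
  have "x \<zero>\<^bsub>V\<^esub> \<in> carrier V" using submodule_zero[OF assms(4)] assms(5) by blast
  then have "x \<zero>\<^bsub>V\<^esub> = \<zero>\<^bsub>V\<^esub>" using assms(7)[of \<zero> "\<zero>\<^bsub>V\<^esub>"] submodule_zero[OF assms(4)] by simp
  then show ?case by (simp add: comb_def)
next
  case (insert i I)
  note F = submoduleE[OF assms(4)]
  have "comb (insert i I) f v = f i \<odot>\<^bsub>V\<^esub> v i \<oplus>\<^bsub>V\<^esub> comb I f v"
    unfolding comb_def using insert F(1) by (intro M.finsum_insert) auto
  moreover have "comb (insert i I) f (\<lambda>i. x (v i)) = f i \<odot>\<^bsub>V\<^esub> x (v i) \<oplus>\<^bsub>V\<^esub> comb I f (\<lambda>i. x (v i))"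
    unfolding comb_def using insert assms(5) by (intro M.finsum_insert) auto
  moreover have "comb I f v \<in> F" using insert assms(4) by (intro comb_in_submodule) auto
  ultimately show ?case using insert assms(6,7) F(4) by auto
qed

text \<open>Finite-dimensionality: an injective linear endomorphism of a subspace is surjective.\<close>

lemma inj_imp_surj:
  assumes F: "submodule F R V" and x: "x \<in> F \<rightarrow> F"
    and add: "\<And>u w. u \<in> F \<Longrightarrow> w \<in> F \<Longrightarrow> x (u \<oplus>\<^bsub>V\<^esub> w) = x u \<oplus>\<^bsub>V\<^esub> x w"
    and smult: "\<And>r u. r \<in> carrier R \<Longrightarrow> u \<in> F \<Longrightarrow> x (r \<odot>\<^bsub>V\<^esub> u) = r \<odot>\<^bsub>V\<^esub> x u"
    and inj: "\<And>u. u \<in> F \<Longrightarrow> x u = \<zero>\<^bsub>V\<^esub> \<Longrightarrow> u = \<zero>\<^bsub>V\<^esub>"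
  shows "x ` F = F"
proof (rule ccontr)
  assume neq: "x ` F \<noteq> F"
  note FE = submoduleE[OF F]
  note F0 = submodule_zero[OF F]
  have sub: "x ` F \<subset> F" using neq x by auto
  have xV: "x \<in> F \<rightarrow> carrier V" using x FE(1) by blast
  have "x \<zero>\<^bsub>V\<^esub> \<in> carrier V" using F0 xV by blast
  then have x0: "x \<zero>\<^bsub>V\<^esub> = \<zero>\<^bsub>V\<^esub>" using smult[of \<zero> "\<zero>\<^bsub>V\<^esub>"] F0 by simp
  have "submodule (x ` F) R V"
  proof (rule submoduleI)
    show "x ` F \<subseteq> carrier V" using xV by auto
    show "\<zero>\<^bsub>V\<^esub> \<in> x ` F" using F0 x0 by force
    fix a assume "a \<in> x ` F" then obtain u where u: "a = x u" "u \<in> F" by auto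
    have uV: "u \<in> carrier V" using u FE(1) by auto
    have "\<ominus>\<^bsub>V\<^esub> a = x ((\<ominus> \<one>) \<odot>\<^bsub>V\<^esub> u)" using u uV smult[of "\<ominus> \<one>" u] funcset_mem[OF xV] by (simp add: smult_l_minus)
    then show "\<ominus>\<^bsub>V\<^esub> a \<in> x ` F" using FE(4) u by auto
    { fix b assume "b \<in> x ` F"
      then show "a \<oplus>\<^bsub>V\<^esub> b \<in> x ` F" using u add FE(5) by (metis (no_types, lifting) image_iff) }
    fix r assume "r \<in> carrier R" then show "r \<odot>\<^bsub>V\<^esub> a \<in> x ` F"
      using u smult FE(4) by (metis (no_types, lifting) image_iff)
  qed
  then have less: "rank (x ` F) < rank F" using rank_psubset[OF _ sub] FE(1) by blast
  obtain v where v: "indep (rank F) v F" using rank_attained FE(1) by blast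
  have vF: "v \<in> {..<rank F} \<rightarrow> F" using v by (auto simp: indep_def)
  have "indep (rank F) (\<lambda>i. x (v i)) (x ` F)"
    unfolding indep_def
  proof (intro conjI ballI impI)
    show "(\<lambda>i. x (v i)) \<in> {..<rank F} \<rightarrow> x ` F" using vF by auto
    fix f assume f: "f \<in> {..<rank F} \<rightarrow> carrier R" "comb {..<rank F} f (\<lambda>i. x (v i)) = \<zero>\<^bsub>V\<^esub>"
    have "x (comb {..<rank F} f v) = \<zero>\<^bsub>V\<^esub>"
      using comb_image[OF _ f(1) vF F xV add smult] f(2) by simp
    moreover have "comb {..<rank F} f v \<in> F" using comb_in_submodule[OF F _ f(1) vF] by simp
    ultimately have "comb {..<rank F} f v = \<zero>\<^bsub>V\<^esub>" using inj by blast
    then show "\<forall>i<rank F. f i \<in> \<pp>" using v f(1) by (auto simp: indep_def)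
  qed
  moreover have "x ` F \<subseteq> carrier V" using xV by auto
  ultimately have "rank F \<le> rank (x ` F)" using indep_le_rank by blast
  then show False using less by simp
qed

text \<open>
  A set that indexes vectors \<open>e q\<close> is finite if for every finite part \<open>Q'\<close> and every \<open>q \<in> Q'\<close> some
  linear map vanishes on all \<open>e q'\<close> with \<open>q' \<in> Q' - {q}\<close> but not on \<open>e q\<close>: the vectors \<open>e q\<close> for \<open>q \<in> Q'\<close>
  are then independent.
\<close>

lemma finite_of_separated:
  assumes e: "\<And>q. q \<in> Q \<Longrightarrow> e q \<in> carrier V"
    and sep: "\<And>Q' q. finite Q' \<Longrightarrow> Q' \<subseteq> Q \<Longrightarrow> q \<in> Q' \<Longrightarrow>
      \<exists>x\<in>carrier V \<rightarrow> carrier V. (\<forall>u\<in>carrier V. \<forall>w\<in>carrier V. x (u \<oplus>\<^bsub>V\<^esub> w) = x u \<oplus>\<^bsub>V\<^esub> x w) \<and>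
        (\<forall>r\<in>carrier R. \<forall>u\<in>carrier V. x (r \<odot>\<^bsub>V\<^esub> u) = r \<odot>\<^bsub>V\<^esub> x u) \<and>
        x (e q) \<noteq> \<zero>\<^bsub>V\<^esub> \<and> (\<forall>q'\<in>Q' - {q}. x (e q') = \<zero>\<^bsub>V\<^esub>)"
  shows "finite Q"
proof (rule conjunct1[OF finite_if_finite_subsets_card_bdd])
  fix Q' assume "Q' \<subseteq> Q" and "finite Q'"
  note Q' = this
  obtain h where h: "bij_betw h {..<card Q'} Q'"
    using ex_bij_betw_nat_finite[OF Q'(2)] unfolding atLeast0LessThan by blast
  let ?n = "card Q'"
  have hQ: "h i \<in> Q'" if "i < ?n" for i using that h by (auto simp: bij_betw_def)
  have v: "(\<lambda>i. e (h i)) \<in> {..<?n} \<rightarrow> carrier V" using subsetD[OF Q'(1) hQ] e by simp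
  have "indep ?n (\<lambda>i. e (h i)) (carrier V)"
    unfolding indep_def
  proof (intro conjI ballI impI allI v)
    fix f j assume f: "f \<in> {..<?n} \<rightarrow> carrier R" "comb {..<?n} f (\<lambda>i. e (h i)) = \<zero>\<^bsub>V\<^esub>" and j: "j < ?n"
    obtain x where x: "x \<in> carrier V \<rightarrow> carrier V"
      "\<And>u w. u \<in> carrier V \<Longrightarrow> w \<in> carrier V \<Longrightarrow> x (u \<oplus>\<^bsub>V\<^esub> w) = x u \<oplus>\<^bsub>V\<^esub> x w"
      "\<And>r u. r \<in> carrier R \<Longrightarrow> u \<in> carrier V \<Longrightarrow> x (r \<odot>\<^bsub>V\<^esub> u) = r \<odot>\<^bsub>V\<^esub> x u"
      "x (e (h j)) \<noteq> \<zero>\<^bsub>V\<^esub>" "\<And>q'. q' \<in> Q' - {h j} \<Longrightarrow> x (e q') = \<zero>\<^bsub>V\<^esub>"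
      using sep[OF Q'(2,1) hQ[OF j]] by blast
    have fR: "f i \<in> carrier R" if "i < ?n" for i using that f by auto
    have xj: "x (e (h j)) \<in> carrier V" using x(1) v j by auto
    have "x (comb {..<?n} f (\<lambda>i. e (h i))) = comb {..<?n} f (\<lambda>i. x (e (h i)))"
      by (rule comb_image[OF _ f(1) v carrier_is_submodule x(1-3)]) auto
    also have "\<dots> = (\<Oplus>\<^bsub>V\<^esub>i\<in>{..<?n}. if j = i then f i \<odot>\<^bsub>V\<^esub> x (e (h i)) else \<zero>\<^bsub>V\<^esub>)"
      unfolding comb_def
    proof (rule M.finsum_cong')
      fix i assume i: "i \<in> {..<?n}"
      show "f i \<odot>\<^bsub>V\<^esub> x (e (h i)) = (if j = i then f i \<odot>\<^bsub>V\<^esub> x (e (h i)) else \<zero>\<^bsub>V\<^esub>)"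
      proof (cases "j = i")
        case False
        then have "h i \<in> Q' - {h j}" using i j h hQ by (auto simp: bij_betw_def inj_on_def)
        then show ?thesis using x(5) False fR i by auto
      qed auto
    qed (use xj fR j in auto)
    also have "\<dots> = f j \<odot>\<^bsub>V\<^esub> x (e (h j))"
    proof (rule M.finsum_singleton)
      show "(\<lambda>i. f i \<odot>\<^bsub>V\<^esub> x (e (h i))) \<in> {..<?n} \<rightarrow> carrier V"
        using fR funcset_mem[OF x(1)] funcset_mem[OF v] by simp
    qed (use j in auto)
    finally have "f j \<odot>\<^bsub>V\<^esub> x (e (h j)) = x \<zero>\<^bsub>V\<^esub>" using f(2) by simp
    moreover have "x \<zero>\<^bsub>V\<^esub> \<in> carrier V" using x(1) by blast
    then have "x \<zero>\<^bsub>V\<^esub> = \<zero>\<^bsub>V\<^esub>" using x(3)[of \<zero> "\<zero>\<^bsub>V\<^esub>"] by simp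
    ultimately show "f j \<in> \<pp>" using smult_eq_zero_imp_mem[OF fR[OF j] xj] x(4) by simp
  qed
  then show "card Q' \<le> card S" by (rule indep_le_card[OF order_refl])
qed

end

section \<open>Characters of finite abelian groups\<close>

lemma (in group) finite_mult_closed_imp_subgroup:
  assumes "finite (carrier G)" "H \<subseteq> carrier G" "H \<noteq> {}"
    and closed: "\<And>x y. x \<in> H \<Longrightarrow> y \<in> H \<Longrightarrow> x \<otimes> y \<in> H"
  shows "subgroup H G"
proof (rule subgroupI)
  fix h assume h: "h \<in> H"
  then have hG: "h \<in> carrier G" using assms by auto
  have pow: "h [^] Suc k \<in> H" for k
  proof (induction k)
    case 0 then show ?case using h hG by simp
  next
    case (Suc k) then show ?case using closed h by (simp only: nat_pow_Suc)
  qed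
  let ?n = "order G"
  have n: "?n > 0" using assms(1) order_gt_0_iff_finite by blast
  have one: "h [^] ?n = \<one>" using hG by (rule pow_order_eq_1)
  \<comment> \<open>The exponent \<open>2 n - 1\<close> is positive even for the trivial group.\<close>
  have "h [^] (?n + ?n - 1) \<otimes> h = \<one>"
  proof -
    have "h [^] (?n + ?n - 1) \<otimes> h = h [^] Suc (?n + ?n - 1)" by (simp only: nat_pow_Suc)
    also have "Suc (?n + ?n - 1) = ?n + ?n" using n by simp
    also have "h [^] (?n + ?n) = \<one>" using one hG by (simp add: nat_pow_mult[symmetric])
    finally show ?thesis .
  qed
  then have "inv h = h [^] (?n + ?n - 1)" using hG by (intro inv_equality) auto
  moreover have "?n + ?n - 1 = Suc (?n + ?n - 2)" using n by simp
  ultimately show "inv h \<in> H" using pow by metis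
qed (use assms in auto)

context comm_group
begin

text \<open>
  The projection of \<open>f\<close> to the eigenspace of translation by \<open>g\<close> for the eigenvalue \<open>w ^ j\<close>, up to the
  factor \<open>n\<close>; here \<open>g\<close> has order dividing \<open>n\<close> and \<open>w\<close> is an \<open>n\<close>-th root of unity.
\<close>

definition eigenprojection :: "nat \<Rightarrow> complex \<Rightarrow> 'a \<Rightarrow> nat \<Rightarrow> ('a \<Rightarrow> complex) \<Rightarrow> 'a \<Rightarrow> complex"
  where "eigenprojection n w g j f x = (\<Sum>k<n. inverse w ^ (j * k) * f (g [^] k \<otimes> x))"

lemma eigenprojection_commute:
  assumes "g \<in> carrier G" "a \<in> carrier G" "\<And>x. x \<in> carrier G \<Longrightarrow> f (a \<otimes> x) = \<mu> * f x" "x \<in> carrier G"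
  shows "eigenprojection n w g j f (a \<otimes> x) = \<mu> * eigenprojection n w g j f x"
proof -
  have "f (g [^] k \<otimes> (a \<otimes> x)) = \<mu> * f (g [^] k \<otimes> x)" for k :: nat
  proof -
    have "g [^] k \<otimes> (a \<otimes> x) = a \<otimes> (g [^] k \<otimes> x)" using assms by (intro m_lcomm) auto
    then show ?thesis using assms(3)[of "g [^] k \<otimes> x"] assms(1,4) by simp
  qed
  then show ?thesis unfolding eigenprojection_def by (simp add: sum_distrib_left mult_ac)
qed

lemma eigenprojection_eigen:
  assumes g: "g \<in> carrier G" "g [^] n = \<one>" and x: "x \<in> carrier G" and w: "w ^ n = 1" and n: "n > 0"
  shows "eigenprojection n w g j f (g \<otimes> x) = w ^ j * eigenprojection n w g j f x"
proof -
  have w0: "w \<noteq> 0" using w n by (metis power_eq_0_iff zero_neq_one)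
  define F where "F k = inverse w ^ (j * k) * f (g [^] k \<otimes> x)" for k
  have "F n = F 0"
    using g x w by (simp add: F_def mult.commute[of j] power_mult power_inverse)
  then have shift: "(\<Sum>k<n. F (Suc k)) = (\<Sum>k<n. F k)"
    using sum.lessThan_Suc_shift[of F n] by simp
  have "eigenprojection n w g j f (g \<otimes> x) = (\<Sum>k<n. w ^ j * F (Suc k))"
    unfolding eigenprojection_def
  proof (rule sum.cong[OF refl])
    fix k
    have "w ^ j * inverse w ^ (j * Suc k) = inverse w ^ (j * k)"
      using w0 by (simp add: power_add power_inverse field_simps)
    moreover have "g [^] k \<otimes> (g \<otimes> x) = g [^] Suc k \<otimes> x" using g x by (simp add: m_assoc)
    ultimately show "inverse w ^ (j * k) * f (g [^] k \<otimes> (g \<otimes> x)) = w ^ j * F (Suc k)"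
      unfolding F_def by (simp only: mult.assoc[symmetric])
  qed
  then show ?thesis
    by (simp add: eigenprojection_def F_def[symmetric] sum_distrib_left[symmetric] shift)
qed

lemma sum_eigenprojection:
  assumes "n > 0" "w ^ n = 1" "\<And>k. 0 < k \<Longrightarrow> k < n \<Longrightarrow> w ^ k \<noteq> 1" "x \<in> carrier G"
  shows "(\<Sum>j<n. eigenprojection n w g j f x) = of_nat n * f x"
proof -
  have geom: "(\<Sum>j<n. inverse w ^ (j * k)) = (if k = 0 then of_nat n else 0)" if "k < n" for k
  proof (cases "k = 0")
    case False
    have "inverse w ^ k \<noteq> 1" using assms(3)[of k] that False by (simp add: power_inverse)
    moreover have "(inverse w ^ k) ^ n = 1"
      using assms(2) by (simp add: power_inverse power_mult[symmetric] mult.commute[of k] power_mult)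
    ultimately have "(\<Sum>j<n. (inverse w ^ k) ^ j) = 0" by (simp add: geometric_sum)
    then show ?thesis using False by (simp add: power_mult[symmetric] mult.commute[of k])
  qed auto
  have "(\<Sum>j<n. eigenprojection n w g j f x)
    = (\<Sum>k<n. (\<Sum>j<n. inverse w ^ (j * k)) * f (g [^] k \<otimes> x))"
    unfolding eigenprojection_def by (subst sum.swap) (simp add: sum_distrib_right)
  also have "\<dots> = (\<Sum>k<n. if k = 0 then of_nat n * f x else 0)"
    using assms(4) by (intro sum.cong refl) (simp add: geom)
  also have "\<dots> = of_nat n * f x" using assms(1) by simp
  finally show ?thesis .
qed

text \<open>
  Characters separate the elements outside a subgroup \<open>H\<close> from \<open>H\<close>.  The character is read off from a
  common eigenvector of all translations on the \<open>H\<close>-invariant functions \<open>G \<rightarrow> \<complex>\<close>, chosen in an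
  eigenspace of \<open>c\<close> with eigenvalue different from 1.
\<close>

lemma exists_separating_character:
  assumes fin: "finite (carrier G)" and H: "subgroup H G" and c: "c \<in> carrier G" "c \<notin> H"
  shows "\<exists>\<chi>\<in>hom G complex_units. (\<forall>h\<in>H. \<chi> h = 1) \<and> \<chi> c \<noteq> 1"
proof -
  interpret H: subgroup H G by fact
  define n where "n = order G"
  define w where "w = cis (2 * pi / real n)"
  have n: "n > 0" unfolding n_def using fin order_gt_0_iff_finite by blast
  have pow_n: "g [^] n = \<one>" if "g \<in> carrier G" for g unfolding n_def using that by (rule pow_order_eq_1)
  have wk: "w ^ k = cis (2 * pi * real k / real n)" for k
    unfolding w_def by (simp add: DeMoivre mult_ac)
  have wn: "w ^ n = 1" using n by (simp add: wk)
  have prim: "w ^ k \<noteq> 1" if "0 < k" "k < n" for k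
  proof
    assume "w ^ k = 1"
    then have "cis (2 * pi * real k / real n) = cis (2 * pi * real 0 / real n)" by (simp add: wk)
    moreover have "inj_on (\<lambda>k. cis (2 * pi * real k / real n)) {..<n}"
      using bij_betw_roots_unity[OF n] by (simp add: bij_betw_def)
    ultimately have "k = 0" using that n by (elim inj_onD) auto
    then show False using that by simp
  qed
  define eig where "eig f g \<mu> \<longleftrightarrow> (\<forall>x\<in>carrier G. f (g \<otimes> x) = \<mu> * f x)" for f :: "'a \<Rightarrow> complex" and g \<mu>
  have "\<exists>f \<zeta>. (\<exists>x\<in>carrier G. f x \<noteq> 0) \<and> (\<forall>h\<in>H. eig f h 1) \<and> \<zeta> \<noteq> 1 \<and> eig f c \<zeta> \<and> (\<forall>g\<in>S. \<exists>\<mu>. eig f g \<mu>)"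
    if "S \<subseteq> carrier G" for S
    using finite_subset[OF that fin] that
  proof (induction S)
    case empty
    define f0 :: "'a \<Rightarrow> complex" where "f0 x = (if x \<in> H then 1 else 0)" for x
    have inv: "f0 (h \<otimes> x) = 1 * f0 x" if "h \<in> H" "x \<in> carrier G" for h x
    proof -
      have "x = inv h \<otimes> (h \<otimes> x)" using that by (simp add: m_assoc[symmetric])
      then have "h \<otimes> x \<in> H \<longleftrightarrow> x \<in> H" using that by (metis H.m_closed H.m_inv_closed)
      then show ?thesis by (simp add: f0_def)
    qed
    let ?E = "\<lambda>j. eigenprojection n w c j f0"
    have "\<exists>j<n. j \<noteq> 0 \<and> (\<exists>x\<in>carrier G. ?E j x \<noteq> 0)"
    proof (rule ccontr)
      assume "\<not> ?thesis"
      then have zero: "?E j x = 0" if "j < n" "j \<noteq> 0" "x \<in> carrier G" for j x using that by blast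
      have f0: "of_nat n * f0 x = ?E 0 x" if "x \<in> carrier G" for x
      proof -
        have "(\<Sum>j<n. ?E j x) = (\<Sum>j<n. if j = 0 then ?E 0 x else 0)"
          using zero that by (intro sum.cong) auto
        then show ?thesis using sum_eigenprojection[OF n wn prim that] n by simp
      qed
      have "?E 0 (c \<otimes> \<one>) = ?E 0 \<one>"
        using eigenprojection_eigen[OF c(1) pow_n[OF c(1)] one_closed wn n, of 0 f0] by simp
      then have "of_nat n * f0 c = of_nat n * f0 \<one>" using f0 c(1) by simp
      then show False using n c(2) by (simp add: f0_def)
    qed
    then obtain j where j: "j < n" "j \<noteq> 0" "\<exists>x\<in>carrier G. ?E j x \<noteq> 0" by blast
    show ?case
    proof (intro exI conjI)
      show "\<forall>h\<in>H. eig (?E j) h 1"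
        unfolding eig_def using inv c by (intro ballI eigenprojection_commute) auto
      show "w ^ j \<noteq> 1" using prim j by auto
      show "eig (?E j) c (w ^ j)"
        unfolding eig_def using eigenprojection_eigen[OF c(1) pow_n[OF c(1)] _ wn n] by blast
    qed (use j in auto)
  next
    case (insert g S)
    then have g: "g \<in> carrier G" by auto
    obtain f \<zeta> where f: "\<exists>x\<in>carrier G. f x \<noteq> 0" "\<forall>h\<in>H. eig f h 1" "\<zeta> \<noteq> 1" "eig f c \<zeta>"
      "\<forall>g\<in>S. \<exists>\<mu>. eig f g \<mu>" using insert by auto
    let ?E = "\<lambda>j. eigenprojection n w g j f"
    have keep: "eig (?E j) a \<mu>" if "eig f a \<mu>" "a \<in> carrier G" for j a \<mu>
      using that g unfolding eig_def by (auto intro!: eigenprojection_commute)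
    have "\<exists>j<n. \<exists>x\<in>carrier G. ?E j x \<noteq> 0"
    proof (rule ccontr)
      assume neg: "\<not> ?thesis"
      obtain x where x: "x \<in> carrier G" "f x \<noteq> 0" using f by auto
      have "(\<Sum>j<n. ?E j x) = 0" using neg x by (intro sum.neutral) auto
      then show False using sum_eigenprojection[OF n wn prim x(1)] x(2) n by simp
    qed
    then obtain j where j: "j < n" "\<exists>x\<in>carrier G. ?E j x \<noteq> 0" by blast
    have "eig (?E j) g (w ^ j)"
      unfolding eig_def using eigenprojection_eigen[OF g pow_n[OF g] _ wn n] by blast
    then have "\<forall>g\<in>insert g S. \<exists>\<mu>. eig (?E j) g \<mu>" using f(5) keep insert.prems by blast
    moreover have "\<forall>h\<in>H. eig (?E j) h 1" using f(2) keep H.subset by blast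
    ultimately show ?case using j(2) f(3,4) keep[OF f(4) c(1)] by blast
  qed
  then obtain f \<zeta> where f: "\<exists>x\<in>carrier G. f x \<noteq> 0" "\<forall>h\<in>H. eig f h 1" "\<zeta> \<noteq> 1" "eig f c \<zeta>"
    "\<forall>g\<in>carrier G. \<exists>\<mu>. eig f g \<mu>" by blast
  have f_mult: "f (g \<otimes> h) * f \<one> = f g * f h" if gh: "g \<in> carrier G" "h \<in> carrier G" for g h
  proof -
    obtain \<mu> where "eig f g \<mu>" using f(5) gh by auto
    then have "f (g \<otimes> h) = \<mu> * f h" "f (g \<otimes> \<one>) = \<mu> * f \<one>"
      using gh(2) one_closed unfolding eig_def by blast+
    then show ?thesis using gh by simp
  qed
  have nz: "f g \<noteq> 0" if g: "g \<in> carrier G" for g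
  proof
    assume fg: "f g = 0"
    obtain x where x: "x \<in> carrier G" "f x \<noteq> 0" using f by auto
    obtain \<mu> where mu: "eig f (x \<otimes> inv g) \<mu>" using f(5) g x by blast
    have "f (x \<otimes> inv g \<otimes> g) = \<mu> * f g" using mu g unfolding eig_def by blast
    then show False using fg x g by (simp add: m_assoc)
  qed
  let ?\<chi> = "\<lambda>g. f g / f \<one>"
  have "?\<chi> \<in> hom G complex_units"
  proof (rule homI)
    fix g h assume gh: "g \<in> carrier G" "h \<in> carrier G"
    show "?\<chi> g \<in> carrier complex_units" using nz gh by (simp add: complex_units_def)
    show "?\<chi> (g \<otimes> h) = ?\<chi> g \<otimes>\<^bsub>complex_units\<^esub> ?\<chi> h"
      using f_mult[OF gh] nz[OF one_closed] by (simp add: complex_units_def field_simps)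
  qed
  moreover have "?\<chi> h = 1" if "h \<in> H" for h
  proof -
    have "f (h \<otimes> \<one>) = 1 * f \<one>" using f(2) that one_closed unfolding eig_def by blast
    then show ?thesis using that nz[OF one_closed] by simp
  qed
  moreover have "?\<chi> c \<noteq> 1"
  proof -
    have "f (c \<otimes> \<one>) = \<zeta> * f \<one>" using f(4) unfolding eig_def by blast
    then show ?thesis using c f(3) nz[OF one_closed] by simp
  qed
  ultimately show ?thesis by (intro bexI[of _ ?\<chi>] conjI ballI)
qed

end

section \<open>Reduction modulo an ideal as a tensor product\<close>

text \<open>
  The map \<open>x \<mapsto> 1 \<otimes> x\<close> identifies \<open>M/\<pp> M\<close> with \<open>R/\<pp> \<otimes> M\<close>.  The facts below express this by the
  surjectivity, additivity and kernel of \<open>reduce\<close>; the action of linear maps on the tensor product is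
  determined by \<open>tensor_map_reduce\<close>.
\<close>

locale reduction = module R M + ideal \<pp> R for R (structure) and M (structure) and \<pp>
begin

abbreviation "residue \<equiv> quotient_module R \<pp>"
abbreviation "free \<equiv> tensor_free residue M"
abbreviation "rels \<equiv> tensor_relations R residue M"

text \<open>The class of \<open>1 \<otimes> x\<close>.\<close>

definition reduce :: "'c \<Rightarrow> ('a set \<times> 'c \<Rightarrow>\<^sub>0 int) set"
  where "reduce x = rels #>\<^bsub>free\<^esub> frag_of (\<pp> +> \<one>, x)"

lemma residue_carrier: "U \<in> carrier residue \<longleftrightarrow> (\<exists>r\<in>carrier R. U = \<pp> +> r)"
  unfolding quotient_module_def algebra_module_def FactRing_def A_RCOSETS_def'
  by auto

lemma coset_mem: "r \<in> carrier R \<Longrightarrow> \<pp> +> r \<in> carrier residue"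
  using residue_carrier by blast

lemma residue_add:
  "\<lbrakk>r \<in> carrier R; r' \<in> carrier R\<rbrakk> \<Longrightarrow> (\<pp> +> r) \<oplus>\<^bsub>residue\<^esub> (\<pp> +> r') = \<pp> +> (r \<oplus> r')"
  unfolding quotient_module_def algebra_module_def FactRing_def by (simp add: a_rcos_sum)

lemma residue_smult:
  "\<lbrakk>r \<in> carrier R; r' \<in> carrier R\<rbrakk> \<Longrightarrow> r \<odot>\<^bsub>residue\<^esub> (\<pp> +> r') = \<pp> +> (r \<otimes> r')"
  unfolding quotient_module_def algebra_module_def FactRing_def by (simp add: rcoset_mult_add)

lemma residue_add_closed:
  "\<lbrakk>U \<in> carrier residue; U' \<in> carrier residue\<rbrakk> \<Longrightarrow> U \<oplus>\<^bsub>residue\<^esub> U' \<in> carrier residue"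
  by (auto simp: residue_carrier residue_add)

lemma residue_smult_closed:
  "\<lbrakk>r \<in> carrier R; U \<in> carrier residue\<rbrakk> \<Longrightarrow> r \<odot>\<^bsub>residue\<^esub> U \<in> carrier residue"
  by (auto simp: residue_carrier residue_smult)

sublocale free: comm_group free
  unfolding tensor_free_def by (rule abelian_free_Abelian_group)

lemma free_carrier: "u \<in> carrier free \<longleftrightarrow> Poly_Mapping.keys u \<subseteq> carrier residue \<times> carrier M"
  by (simp add: tensor_free_def)

lemma free_mult: "u \<otimes>\<^bsub>free\<^esub> v = u + v" by (simp add: tensor_free_def)

lemma free_one: "\<one>\<^bsub>free\<^esub> = 0" by (simp add: tensor_free_def)

lemma free_inv: "u \<in> carrier free \<Longrightarrow> inv\<^bsub>free\<^esub> u = - u"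
  by (simp add: tensor_free_def)

lemma free_diff: "\<lbrakk>u \<in> carrier free; v \<in> carrier free\<rbrakk> \<Longrightarrow> u - v = u \<otimes>\<^bsub>free\<^esub> inv\<^bsub>free\<^esub> v"
  by (simp add: free_mult free_inv)

lemma free_diff_closed: "\<lbrakk>u \<in> carrier free; v \<in> carrier free\<rbrakk> \<Longrightarrow> u - v \<in> carrier free"
  by (simp add: free_diff)

lemma frag_of_closed: "\<lbrakk>U \<in> carrier residue; x \<in> carrier M\<rbrakk> \<Longrightarrow> frag_of (U, x) \<in> carrier free"
  by (simp add: tensor_free_def)

abbreviation "rel_add_l U U' y \<equiv> frag_of (U \<oplus>\<^bsub>residue\<^esub> U', y) - frag_of (U, y) - frag_of (U', y)"
abbreviation "rel_add_r U y y' \<equiv> frag_of (U, y \<oplus>\<^bsub>M\<^esub> y') - frag_of (U, y) - frag_of (U, y')"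
abbreviation "rel_smult r U y \<equiv> frag_of (r \<odot>\<^bsub>residue\<^esub> U, y) - frag_of (U, r \<odot>\<^bsub>M\<^esub> y)"

lemma rels_subset:
  assumes "subgroup H free"
    and "\<And>U U' y. \<lbrakk>U \<in> carrier residue; U' \<in> carrier residue; y \<in> carrier M\<rbrakk> \<Longrightarrow> rel_add_l U U' y \<in> H"
    and "\<And>U y y'. \<lbrakk>U \<in> carrier residue; y \<in> carrier M; y' \<in> carrier M\<rbrakk> \<Longrightarrow> rel_add_r U y y' \<in> H"
    and "\<And>r U y. \<lbrakk>r \<in> carrier R; U \<in> carrier residue; y \<in> carrier M\<rbrakk> \<Longrightarrow> rel_smult r U y \<in> H"
  shows "rels \<subseteq> H"
  unfolding tensor_relations_def
  by (rule free.generate_subgroup_incl[OF _ assms(1)]) (use assms(2-4) in blast)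

lemma rels_subgroup: "subgroup rels free"
  unfolding tensor_relations_def
  by (rule free.generate_is_subgroup)
    (auto intro!: free_diff_closed frag_of_closed residue_add_closed residue_smult_closed)

lemma rel_mem:
  "\<lbrakk>U \<in> carrier residue; U' \<in> carrier residue; y \<in> carrier M\<rbrakk> \<Longrightarrow> rel_add_l U U' y \<in> rels"
  "\<lbrakk>U \<in> carrier residue; y \<in> carrier M; y' \<in> carrier M\<rbrakk> \<Longrightarrow> rel_add_r U y y' \<in> rels"
  "\<lbrakk>r \<in> carrier R; U \<in> carrier residue; y \<in> carrier M\<rbrakk> \<Longrightarrow> rel_smult r U y \<in> rels"
  unfolding tensor_relations_def by (rule generate.incl, blast)+

lemma rels_normal: "rels \<lhd> free"
  using rels_subgroup by (rule free.subgroup_imp_normal)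

lemma coset_eqI:
  assumes "u \<in> carrier free" "v \<in> carrier free" "u - v \<in> rels"
  shows "rels #>\<^bsub>free\<^esub> u = rels #>\<^bsub>free\<^esub> v"
proof (rule free.repr_independence[OF _ assms(2) rels_subgroup, symmetric])
  have "u = (u - v) \<otimes>\<^bsub>free\<^esub> v" by (simp add: free_mult)
  then show "u \<in> rels #>\<^bsub>free\<^esub> v" unfolding r_coset_def using assms(3) by blast
qed

lemma coset_mult:
  "\<lbrakk>u \<in> carrier free; v \<in> carrier free\<rbrakk> \<Longrightarrow>
   (rels #>\<^bsub>free\<^esub> u) <#>\<^bsub>free\<^esub> (rels #>\<^bsub>free\<^esub> v) = rels #>\<^bsub>free\<^esub> (u + v)"
  using normal.rcos_sum[OF rels_normal] by (simp add: free_mult)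

lemma tensor_group_comm: "comm_group (tensor_group R residue M)"
  unfolding tensor_group_def using rels_subgroup by (rule free.abelian_FactGroup)

lemma tensor_group_mult: "A \<otimes>\<^bsub>tensor_group R residue M\<^esub> B = A <#>\<^bsub>free\<^esub> B"
  unfolding tensor_group_def FactGroup_def by simp

lemma tensor_group_one: "\<one>\<^bsub>tensor_group R residue M\<^esub> = rels"
  unfolding tensor_group_def FactGroup_def by simp

lemma tensor_group_carrier:
  "A \<in> carrier (tensor_group R residue M) \<longleftrightarrow> (\<exists>u\<in>carrier free. A = rels #>\<^bsub>free\<^esub> u)"
  unfolding tensor_group_def FactGroup_def RCOSETS_def by auto

lemma frag_one_closed: "x \<in> carrier M \<Longrightarrow> frag_of (\<pp> +> \<one>, x) \<in> carrier free"
  by (simp add: frag_of_closed coset_mem)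

lemma reduce_closed: "x \<in> carrier M \<Longrightarrow> reduce x \<in> carrier (tensor_group R residue M)"
  unfolding reduce_def tensor_group_carrier using frag_one_closed by blast

lemma reduce_add:
  assumes "x \<in> carrier M" "y \<in> carrier M"
  shows "reduce (x \<oplus>\<^bsub>M\<^esub> y) = reduce x \<otimes>\<^bsub>tensor_group R residue M\<^esub> reduce y"
proof -
  have "rels #>\<^bsub>free\<^esub> frag_of (\<pp> +> \<one>, x \<oplus>\<^bsub>M\<^esub> y)
    = rels #>\<^bsub>free\<^esub> (frag_of (\<pp> +> \<one>, x) + frag_of (\<pp> +> \<one>, y))"
  proof (rule coset_eqI)
    show "frag_of (\<pp> +> \<one>, x) + frag_of (\<pp> +> \<one>, y) \<in> carrier free"
      using free.m_closed[OF frag_one_closed frag_one_closed] assms by (simp add: free_mult)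
    have "rel_add_r (\<pp> +> \<one>) x y \<in> rels" using assms coset_mem by (intro rel_mem) auto
    then show "frag_of (\<pp> +> \<one>, x \<oplus>\<^bsub>M\<^esub> y) - (frag_of (\<pp> +> \<one>, x) + frag_of (\<pp> +> \<one>, y)) \<in> rels"
      by (simp add: diff_diff_eq)
  qed (use assms frag_one_closed in auto)
  then show ?thesis using assms frag_one_closed by (simp add: reduce_def tensor_group_mult coset_mult)
qed

lemma coset_frag:
  assumes "r \<in> carrier R" "x \<in> carrier M"
  shows "rels #>\<^bsub>free\<^esub> frag_of (\<pp> +> r, x) = reduce (r \<odot>\<^bsub>M\<^esub> x)"
  unfolding reduce_def
proof (rule coset_eqI)
  have "rel_smult r (\<pp> +> \<one>) x \<in> rels" using assms coset_mem by (intro rel_mem) auto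
  then show "frag_of (\<pp> +> r, x) - frag_of (\<pp> +> \<one>, r \<odot>\<^bsub>M\<^esub> x) \<in> rels"
    using assms by (simp add: residue_smult)
qed (use assms coset_mem frag_of_closed in auto)

lemma reduce_zero: "reduce \<zero>\<^bsub>M\<^esub> = rels"
proof -
  interpret Tg: comm_group "tensor_group R residue M" by (rule tensor_group_comm)
  have "reduce \<zero>\<^bsub>M\<^esub> = reduce \<zero>\<^bsub>M\<^esub> \<otimes>\<^bsub>tensor_group R residue M\<^esub> reduce \<zero>\<^bsub>M\<^esub>"
    using reduce_add[of "\<zero>\<^bsub>M\<^esub>" "\<zero>\<^bsub>M\<^esub>"] by simp
  then show ?thesis using reduce_closed[of "\<zero>\<^bsub>M\<^esub>"] tensor_group_one by (metis M.zero_closed Tg.l_cancel_one')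
qed

lemma reduce_surj:
  assumes "A \<in> carrier (tensor_group R residue M)"
  shows "\<exists>x\<in>carrier M. A = reduce x"
proof -
  interpret Tg: comm_group "tensor_group R residue M" by (rule tensor_group_comm)
  obtain u where u: "u \<in> carrier free" "A = rels #>\<^bsub>free\<^esub> u" using assms tensor_group_carrier by auto
  have "\<exists>x\<in>carrier M. rels #>\<^bsub>free\<^esub> u = reduce x"
    using u(1)[unfolded free_carrier]
  proof (induction u rule: free_Abelian_group_induct[consumes 1])
    case 1
    have "rels #>\<^bsub>free\<^esub> 0 = rels"
      using free.coset_join2[OF free.one_closed rels_subgroup subgroup.one_closed[OF rels_subgroup]]
      by (simp add: free_one)
    then show ?case using reduce_zero by auto
  next
    case (2 u v)
    then obtain x y where xy: "x \<in> carrier M" "y \<in> carrier M"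
      "rels #>\<^bsub>free\<^esub> u = reduce x" "rels #>\<^bsub>free\<^esub> v = reduce y" by auto
    have uv: "u \<in> carrier free" "v \<in> carrier free" "u - v \<in> carrier free"
      using 2 free_diff_closed by (auto simp: free_carrier)
    let ?D = "rels #>\<^bsub>free\<^esub> (u - v)"
    have "?D <#>\<^bsub>free\<^esub> reduce y = reduce x"
      using coset_mult[OF uv(3,2)] xy by simp
    moreover have "reduce (x \<ominus>\<^bsub>M\<^esub> y) <#>\<^bsub>free\<^esub> reduce y = reduce x"
    proof -
      have "x \<ominus>\<^bsub>M\<^esub> y \<oplus>\<^bsub>M\<^esub> y = x" using xy by (simp add: M.minus_eq M.a_assoc M.l_neg)
      then show ?thesis using reduce_add[of "x \<ominus>\<^bsub>M\<^esub> y" y] xy by (simp add: tensor_group_mult)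
    qed
    moreover have "?D \<in> carrier (tensor_group R residue M)" using uv tensor_group_carrier by blast
    ultimately have "?D = reduce (x \<ominus>\<^bsub>M\<^esub> y)"
      using Tg.r_cancel[of ?D "reduce y" "reduce (x \<ominus>\<^bsub>M\<^esub> y)"] xy reduce_closed by (simp add: tensor_group_mult)
    then show ?case using xy by (intro bexI[of _ "x \<ominus>\<^bsub>M\<^esub> y"]) auto
  next
    case (3 a)
    then obtain r x where "a = (\<pp> +> r, x)" "r \<in> carrier R" "x \<in> carrier M"
      using residue_carrier by (cases a) auto
    then show ?case using coset_frag by auto
  qed
  then show ?thesis using u by simp
qed

text \<open>
  The cosets in the union that defines \<open>tensor_map\<close> all agree, because \<open>f\<close> preserves the relations.
\<close>

lemma tensor_map_reduce:
  assumes f: "f \<in> carrier M \<rightarrow> carrier M"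
    and add: "\<And>x y. x \<in> carrier M \<Longrightarrow> y \<in> carrier M \<Longrightarrow> f (x \<oplus>\<^bsub>M\<^esub> y) = f x \<oplus>\<^bsub>M\<^esub> f y"
    and smult: "\<And>r x. r \<in> carrier R \<Longrightarrow> x \<in> carrier M \<Longrightarrow> f (r \<odot>\<^bsub>M\<^esub> x) = r \<odot>\<^bsub>M\<^esub> f x"
    and x: "x \<in> carrier M"
  shows "tensor_map R residue M f (reduce x) = reduce (f x)"
proof -
  let ?F = "frag_extend (\<lambda>(x, y). frag_of (x, f y))"
  have Fcl: "?F u \<in> carrier free" if "u \<in> carrier free" for u
    using that[unfolded free_carrier]
  proof (induction u rule: free_Abelian_group_induct[consumes 1])
    case 1 then show ?case using free.one_closed by (simp add: free_one)
  next
    case (2 u v) then show ?case by (simp add: frag_extend_diff free_diff_closed)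
  next
    case (3 a) then show ?case using f by (cases a) (auto intro!: frag_of_closed)
  qed
  have "rels \<subseteq> {u \<in> carrier free. ?F u \<in> rels}"
  proof (rule rels_subset)
    show "subgroup {u \<in> carrier free. ?F u \<in> rels} free"
    proof (rule free.subgroupI)
      have "\<one>\<^bsub>free\<^esub> \<in> {u \<in> carrier free. ?F u \<in> rels}"
        using subgroup.one_closed[OF rels_subgroup] free.one_closed by (simp add: free_one)
      then show "{u \<in> carrier free. ?F u \<in> rels} \<noteq> {}" by blast
      fix u assume u: "u \<in> {u \<in> carrier free. ?F u \<in> rels}"
      then have "inv\<^bsub>free\<^esub> (?F u) \<in> rels" using subgroup.m_inv_closed[OF rels_subgroup] by blast
      then show "inv\<^bsub>free\<^esub> u \<in> {u \<in> carrier free. ?F u \<in> rels}"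
        using u Fcl free.inv_closed[of u] by (simp add: free_inv frag_extend_minus)
      fix v assume v: "v \<in> {u \<in> carrier free. ?F u \<in> rels}"
      show "u \<otimes>\<^bsub>free\<^esub> v \<in> {u \<in> carrier free. ?F u \<in> rels}"
        using u v subgroup.m_closed[OF rels_subgroup] free.m_closed[of u v]
        by (simp add: free_mult frag_extend_add)
    qed auto
  qed (use f add smult rel_mem in \<open>auto simp: frag_extend_diff Pi_iff
      intro!: free_diff_closed frag_of_closed residue_add_closed residue_smult_closed\<close>)
  then have Frel: "?F u \<in> rels" if "u \<in> rels" for u using that by blast
  let ?e = "frag_of (\<pp> +> \<one>, x)"
  have e: "?e \<in> carrier free" "frag_of (\<pp> +> \<one>, f x) \<in> carrier free" using x f frag_one_closed by auto
  have "rels #>\<^bsub>free\<^esub> ?F u = reduce (f x)" if u: "u \<in> reduce x" for u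
  proof -
    obtain k where k: "k \<in> rels" "u = k + ?e" using u unfolding reduce_def r_coset_def by (auto simp: free_mult)
    have kf: "k \<in> carrier free" using k subgroup.subset[OF rels_subgroup] by auto
    have Fu: "?F u = ?F k + frag_of (\<pp> +> \<one>, f x)" using k by (simp add: frag_extend_add)
    have "?F u \<in> carrier free" using Fu free.m_closed[OF Fcl[OF kf] e(2)] by (simp add: free_mult)
    then show ?thesis unfolding reduce_def using e(2) by (rule coset_eqI) (simp add: Fu Frel[OF k(1)])
  qed
  moreover have "?e \<in> reduce x" unfolding reduce_def using e(1) rels_subgroup by (rule free.rcos_self)
  ultimately show ?thesis unfolding tensor_map_def by blast
qed

text \<open>
  The kernel of \<open>reduce\<close> lies in \<open>\<pp> M\<close>, the smallest subgroup \<open>Q\<close> as in the lemma: the map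
  \<open>(r + \<pp>, x) \<mapsto> r x\<close> into \<open>M/Q\<close> respects the relations, and it sends \<open>1 \<otimes> x\<close> to the class of \<open>x\<close>.
\<close>

lemma reduce_eq_zero_imp_mem:
  assumes Q: "subgroup Q (add_monoid M)"
    and pQ: "\<And>r x. r \<in> \<pp> \<Longrightarrow> x \<in> carrier M \<Longrightarrow> r \<odot>\<^bsub>M\<^esub> x \<in> Q"
    and x: "x \<in> carrier M" "reduce x = rels"
  shows "x \<in> Q"
proof -
  interpret Qn: normal Q "add_monoid M" using Q by (rule M.add.subgroup_imp_normal)
  let ?MQ = "add_monoid M Mod Q"
  interpret MQ: comm_group ?MQ using Q by (rule M.add.abelian_FactGroup)
  let ?c = "\<lambda>x. Q #>\<^bsub>add_monoid M\<^esub> x"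
  have cmem: "?c y \<in> carrier ?MQ" if "y \<in> carrier M" for y
    using that unfolding FactGroup_def RCOSETS_def by auto
  have cmult: "?c (y \<oplus>\<^bsub>M\<^esub> z) = ?c y \<otimes>\<^bsub>?MQ\<^esub> ?c z" if "y \<in> carrier M" "z \<in> carrier M" for y z
    using that Qn.rcos_sum[of y z] by (simp add: FactGroup_def)
  note [simp del] = mult_FactGroup one_FactGroup
  \<comment> \<open>The value does not depend on the representative, as \<open>r x \<in> Q\<close> for \<open>r \<in> \<pp>\<close>.\<close>
  define g where "g = (\<lambda>(U, y). ?c ((SOME r. r \<in> carrier R \<and> r \<in> U) \<odot>\<^bsub>M\<^esub> y))"
  have g: "g (\<pp> +> r, y) = ?c (r \<odot>\<^bsub>M\<^esub> y)" if ry: "r \<in> carrier R" "y \<in> carrier M" for r y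
  proof -
    define s where "s = (SOME s. s \<in> carrier R \<and> s \<in> \<pp> +> r)"
    have "s \<in> carrier R \<and> s \<in> \<pp> +> r"
      unfolding s_def by (rule someI[of _ r]) (simp add: ry a_rcos_self)
    then obtain a where a: "a \<in> \<pp>" "s = a \<oplus> r" "s \<in> carrier R" unfolding a_r_coset_def' by blast
    have aR: "a \<in> carrier R" using a a_subset by auto
    have "?c (s \<odot>\<^bsub>M\<^esub> y) = ?c (a \<odot>\<^bsub>M\<^esub> y) \<otimes>\<^bsub>?MQ\<^esub> ?c (r \<odot>\<^bsub>M\<^esub> y)"
      using a aR ry by (simp add: smult_l_distr cmult)
    also have "?c (a \<odot>\<^bsub>M\<^esub> y) = \<one>\<^bsub>?MQ\<^esub>"
      using M.add.coset_join2[OF _ Q pQ[OF a(1) ry(2)]] aR ry by (simp add: FactGroup_def)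
    also have "\<one>\<^bsub>?MQ\<^esub> \<otimes>\<^bsub>?MQ\<^esub> ?c (r \<odot>\<^bsub>M\<^esub> y) = ?c (r \<odot>\<^bsub>M\<^esub> y)"
      using ry by (intro MQ.l_one cmem) auto
    finally show ?thesis by (simp add: g_def s_def[symmetric])
  qed
  have gcl: "g ` (carrier residue \<times> carrier M) \<subseteq> carrier ?MQ"
    using g cmem by (auto simp: residue_carrier)
  obtain h where h: "h \<in> hom free ?MQ"
    "\<And>a. a \<in> carrier residue \<times> carrier M \<Longrightarrow> h (frag_of a) = g a"
    using MQ.free_Abelian_group_universal[OF gcl] unfolding tensor_free_def by blast
  interpret h: group_hom free ?MQ h using h(1) by unfold_locales
  have hdiff: "h (u - v) = h u \<otimes>\<^bsub>?MQ\<^esub> inv\<^bsub>?MQ\<^esub> h v" if "u \<in> carrier free" "v \<in> carrier free" for u v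
    using that by (simp add: free_diff)
  have hf: "h (frag_of (\<pp> +> r, y)) = ?c (r \<odot>\<^bsub>M\<^esub> y)" if "r \<in> carrier R" "y \<in> carrier M" for r y
    using that g h(2) coset_mem by auto
  have cancel2: "a \<otimes>\<^bsub>?MQ\<^esub> b \<otimes>\<^bsub>?MQ\<^esub> inv\<^bsub>?MQ\<^esub> a \<otimes>\<^bsub>?MQ\<^esub> inv\<^bsub>?MQ\<^esub> b = \<one>\<^bsub>?MQ\<^esub>"
    if "a \<in> carrier ?MQ" "b \<in> carrier ?MQ" for a b
  proof -
    have "a \<otimes>\<^bsub>?MQ\<^esub> b \<otimes>\<^bsub>?MQ\<^esub> inv\<^bsub>?MQ\<^esub> a = b" using that by (metis MQ.inv_solve_right MQ.m_closed MQ.m_comm)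
    then show ?thesis using that by (simp add: MQ.r_inv)
  qed
  have "rels \<subseteq> kernel free ?MQ h"
  proof (rule rels_subset)
    show "subgroup (kernel free ?MQ h) free" by (rule h.subgroup_kernel)
  next
    fix U U' y assume "U \<in> carrier residue" "U' \<in> carrier residue" and y: "y \<in> carrier M"
    then obtain r r' where U: "U = \<pp> +> r" "U' = \<pp> +> r'" "r \<in> carrier R" "r' \<in> carrier R"
      by (auto simp: residue_carrier)
    have cl: "frag_of (\<pp> +> (r \<oplus> r'), y) \<in> carrier free" "frag_of (\<pp> +> r, y) \<in> carrier free" "frag_of (\<pp> +> r', y) \<in> carrier free"
      using U y coset_mem frag_of_closed by auto
    have "h (rel_add_l U U' y) = \<one>\<^bsub>?MQ\<^esub>"
      using U y cl by (simp add: residue_add hdiff free_diff_closed hf smult_l_distr cmult cmem cancel2)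
    then show "rel_add_l U U' y \<in> kernel free ?MQ h"
      using U y cl by (simp add: kernel_def residue_add free_diff_closed)
  next
    fix U y y' assume "U \<in> carrier residue" and y: "y \<in> carrier M" "y' \<in> carrier M"
    then obtain r where U: "U = \<pp> +> r" "r \<in> carrier R" by (auto simp: residue_carrier)
    have cl: "frag_of (\<pp> +> r, y \<oplus>\<^bsub>M\<^esub> y') \<in> carrier free" "frag_of (\<pp> +> r, y) \<in> carrier free" "frag_of (\<pp> +> r, y') \<in> carrier free"
      using U y coset_mem frag_of_closed by auto
    have "h (rel_add_r U y y') = \<one>\<^bsub>?MQ\<^esub>"
      using U y cl by (simp add: hdiff free_diff_closed hf smult_r_distr cmult cmem cancel2)
    then show "rel_add_r U y y' \<in> kernel free ?MQ h"
      using U y cl by (simp add: kernel_def free_diff_closed)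
  next
    fix r U y assume r: "r \<in> carrier R" and "U \<in> carrier residue" and y: "y \<in> carrier M"
    then obtain s where U: "U = \<pp> +> s" "s \<in> carrier R" by (auto simp: residue_carrier)
    have cl: "frag_of (\<pp> +> (r \<otimes> s), y) \<in> carrier free" "frag_of (\<pp> +> s, r \<odot>\<^bsub>M\<^esub> y) \<in> carrier free"
      using U r y coset_mem frag_of_closed by auto
    have "(r \<otimes> s) \<odot>\<^bsub>M\<^esub> y = s \<odot>\<^bsub>M\<^esub> (r \<odot>\<^bsub>M\<^esub> y)"
      using r U y by (metis R.m_comm smult_assoc1)
    then have "h (rel_smult r U y) = \<one>\<^bsub>?MQ\<^esub>"
      using U r y cl by (simp add: residue_smult hdiff hf cmem)
    then show "rel_smult r U y \<in> kernel free ?MQ h"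
      using U r y cl by (simp add: kernel_def residue_smult free_diff_closed)
  qed
  moreover have "frag_of (\<pp> +> \<one>, x) \<in> rels"
    using x(2) frag_one_closed[OF x(1)] rels_subgroup unfolding reduce_def by (rule free.coset_join1)
  ultimately have "h (frag_of (\<pp> +> \<one>, x)) = \<one>\<^bsub>?MQ\<^esub>" unfolding kernel_def by auto
  then have "?c x = Q" using hf[of \<one> x] x(1) by (simp add: FactGroup_def)
  then show ?thesis using M.add.coset_join1[OF _ _ Q] x(1) by simp
qed

lemma reduce_annihilated:
  assumes "r \<in> \<pp>" "x \<in> carrier M"
  shows "reduce (r \<odot>\<^bsub>M\<^esub> x) = rels"
proof -
  have r: "r \<in> carrier R" using assms a_subset by auto
  have "\<pp> +> r = \<pp> +> \<zero>"
    using assms(1) r by (metis R.a_rcos_zero R.zero_closed ideal_axioms zero_closed)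
  then have "reduce (r \<odot>\<^bsub>M\<^esub> x) = reduce (\<zero> \<odot>\<^bsub>M\<^esub> x)" using r assms(2) coset_frag by (metis R.zero_closed)
  then show ?thesis using assms(2) reduce_zero by simp
qed

end

section \<open>Simple modules over a graded commutative ring\<close>

lemma restrict_scalars_simps [simp]:
  "carrier (restrict_scalars f M) = carrier M"
  "add (restrict_scalars f M) = add M"
  "ring.zero (restrict_scalars f M) = ring.zero M"
  "s \<odot>\<^bsub>restrict_scalars f M\<^esub> x = f s \<odot>\<^bsub>M\<^esub> x"
  by (simp_all add: restrict_scalars_def)

lemma subgroup_restrict_scalars [simp]:
  "subgroup F (add_monoid (restrict_scalars f M)) \<longleftrightarrow> subgroup F (add_monoid M)"
  unfolding subgroup_def m_inv_def by simp

lemma a_inv_restrict_scalars [simp]: "\<ominus>\<^bsub>restrict_scalars f M\<^esub> x = \<ominus>\<^bsub>M\<^esub> x"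
  unfolding a_inv_def m_inv_def by simp

lemma (in module) smult_commute:
  "\<lbrakk>a \<in> carrier R; b \<in> carrier R; x \<in> carrier M\<rbrakk> \<Longrightarrow> a \<odot>\<^bsub>M\<^esub> (b \<odot>\<^bsub>M\<^esub> x) = b \<odot>\<^bsub>M\<^esub> (a \<odot>\<^bsub>M\<^esub> x)"
  by (metis R.m_comm smult_assoc1)

text \<open>
  If no character of \<open>G/N\<close> that is trivial on \<open>D\<close> detects \<open>c\<close>, then \<open>c \<in> N D\<close>; here \<open>D\<close> is closed
  under products, so that its image in the finite group \<open>G/N\<close> is a subgroup.
\<close>

lemma (in comm_group) factor_of_characters:
  assumes fin: "finite (carrier G)" and N: "subgroup N G"
    and D: "D \<subseteq> carrier G" "D \<noteq> {}" "\<And>x y. x \<in> D \<Longrightarrow> y \<in> D \<Longrightarrow> x \<otimes> y \<in> D"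
    and c: "c \<in> carrier G"
    and chars: "\<And>\<chi>. \<chi> \<in> hom (G Mod N) complex_units \<Longrightarrow> \<chi> (N #> c) \<noteq> 1 \<Longrightarrow> \<exists>d\<in>D. \<chi> (N #> d) \<noteq> 1"
  shows "\<exists>n\<in>N. \<exists>d\<in>D. c = n \<otimes> d"
proof -
  interpret Q: comm_group "G Mod N" using N by (rule abelian_FactGroup)
  interpret N: normal N G using N by (rule subgroup_imp_normal)
  have car: "carrier (G Mod N) = (\<lambda>x. N #> x) ` carrier G"
    unfolding FactGroup_def RCOSETS_def by auto
  let ?H = "(\<lambda>x. N #> x) ` D"
  have finQ: "finite (carrier (G Mod N))" using fin by (simp add: car)
  have "subgroup ?H (G Mod N)"
  proof (rule Q.finite_mult_closed_imp_subgroup[OF finQ])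
    show "?H \<subseteq> carrier (G Mod N)" using D(1) by (auto simp: car)
    show "?H \<noteq> {}" using D(2) by simp
    fix a b assume "a \<in> ?H" "b \<in> ?H"
    then obtain x y where xy: "x \<in> D" "y \<in> D" "a = N #> x" "b = N #> y" by auto
    then have "a \<otimes>\<^bsub>G Mod N\<^esub> b = N #> (x \<otimes> y)" using N.rcos_sum[of x y] D(1) by auto
    then show "a \<otimes>\<^bsub>G Mod N\<^esub> b \<in> ?H" using D(3) xy by blast
  qed
  then have "N #> c \<in> ?H"
    using Q.exists_separating_character[OF finQ, of ?H "N #> c"] chars c by (fastforce simp: car)
  then obtain d where d: "d \<in> D" "N #> c = N #> d" by auto
  then have "c \<in> N #> d" using rcos_self[OF c N] by simp
  then show ?thesis using d(1) unfolding r_coset_def by auto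
qed

text \<open>
  For a set \<open>B\<close> of commuting elements that is closed under subtraction and multiplication, this says
  that \<open>q\<close> is the kernel of a homomorphism from \<open>B\<close> onto a field.  A unit element in \<open>B\<close> is not needed,
  and so neither is the fact that 1 has degree one in a graded ring.
\<close>

definition field_kernel :: "('t, 'x) ring_scheme \<Rightarrow> 't set \<Rightarrow> 't set \<Rightarrow> bool"
  where "field_kernel T B q \<longleftrightarrow> q \<subset> B \<and>
    (\<forall>x\<in>q. \<forall>y\<in>B. x \<otimes>\<^bsub>T\<^esub> y \<in> q) \<and>
    (\<forall>x\<in>q. \<forall>y\<in>B. x \<ominus>\<^bsub>T\<^esub> y \<in> q \<longrightarrow> y \<in> q) \<and>
    (\<forall>x\<in>B. \<forall>y\<in>B. x \<otimes>\<^bsub>T\<^esub> y \<in> q \<longrightarrow> x \<in> q \<or> y \<in> q) \<and>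
    (\<forall>x\<in>B - q. \<forall>y\<in>B. \<exists>z\<in>B. x \<otimes>\<^bsub>T\<^esub> z \<ominus>\<^bsub>T\<^esub> y \<in> q)"

lemma field_kernelD:
  assumes "field_kernel T B q"
  shows "q \<subset> B"
    and "\<lbrakk>x \<in> q; y \<in> B\<rbrakk> \<Longrightarrow> x \<otimes>\<^bsub>T\<^esub> y \<in> q"
    and "\<lbrakk>x \<in> q; y \<in> B; x \<ominus>\<^bsub>T\<^esub> y \<in> q\<rbrakk> \<Longrightarrow> y \<in> q"
    and "\<lbrakk>x \<in> B; y \<in> B; x \<otimes>\<^bsub>T\<^esub> y \<in> q\<rbrakk> \<Longrightarrow> x \<in> q \<or> y \<in> q"
    and "\<lbrakk>x \<in> B; x \<notin> q; y \<in> B\<rbrakk> \<Longrightarrow> \<exists>z\<in>B. x \<otimes>\<^bsub>T\<^esub> z \<ominus>\<^bsub>T\<^esub> y \<in> q"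
proof -
  note k = assms[unfolded field_kernel_def]
  show "q \<subset> B" using k by (rule conjunct1)
  show "\<lbrakk>x \<in> q; y \<in> B\<rbrakk> \<Longrightarrow> x \<otimes>\<^bsub>T\<^esub> y \<in> q"
    using k[THEN conjunct2, THEN conjunct1] by blast
  show "\<lbrakk>x \<in> q; y \<in> B; x \<ominus>\<^bsub>T\<^esub> y \<in> q\<rbrakk> \<Longrightarrow> y \<in> q"
    using k[THEN conjunct2, THEN conjunct2, THEN conjunct1] by blast
  show "\<lbrakk>x \<in> B; y \<in> B; x \<otimes>\<^bsub>T\<^esub> y \<in> q\<rbrakk> \<Longrightarrow> x \<in> q \<or> y \<in> q"
    using k[THEN conjunct2, THEN conjunct2, THEN conjunct2, THEN conjunct1] by blast
  show "\<lbrakk>x \<in> B; x \<notin> q; y \<in> B\<rbrakk> \<Longrightarrow> \<exists>z\<in>B. x \<otimes>\<^bsub>T\<^esub> z \<ominus>\<^bsub>T\<^esub> y \<in> q"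
    using k[THEN conjunct2, THEN conjunct2, THEN conjunct2, THEN conjunct2] by blast
qed

lemma field_kernel_incomparable:
  assumes "field_kernel T B q" "field_kernel T B q'" "q \<noteq> q'"
  shows "\<exists>s\<in>q'. s \<notin> q"
proof (rule ccontr)
  assume "\<not> ?thesis"
  then have sub: "q' \<subseteq> q" by auto
  then obtain x where x: "x \<in> q" "x \<notin> q'" using assms(3) by auto
  have xB: "x \<in> B" using field_kernelD(1)[OF assms(1)] x(1) by auto
  have "y \<in> q" if y: "y \<in> B" for y
  proof -
    obtain z where z: "z \<in> B" "x \<otimes>\<^bsub>T\<^esub> z \<ominus>\<^bsub>T\<^esub> y \<in> q'"
      using field_kernelD(5)[OF assms(2) xB x(2) y] by auto
    have "x \<otimes>\<^bsub>T\<^esub> z \<in> q" using field_kernelD(2)[OF assms(1) x(1) z(1)] .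
    then show ?thesis using field_kernelD(3)[OF assms(1) _ y] z(2) sub by auto
  qed
  then show False using field_kernelD(1)[OF assms(1)] by auto
qed

text \<open>
  As in the Chinese remainder theorem: the product of elements of \<open>q' - q\<close>, for the other members \<open>q'\<close>
  of \<open>Q\<close>, and of an element outside \<open>q\<close>.
\<close>

lemma field_kernels_separated:
  assumes "finite Q" "\<And>q'. q' \<in> Q \<Longrightarrow> field_kernel T B q'" "field_kernel T B q"
    and comm: "\<And>x y. x \<in> B \<Longrightarrow> y \<in> B \<Longrightarrow> x \<otimes>\<^bsub>T\<^esub> y = y \<otimes>\<^bsub>T\<^esub> x"
    and closed: "\<And>x y. x \<in> B \<Longrightarrow> y \<in> B \<Longrightarrow> x \<otimes>\<^bsub>T\<^esub> y \<in> B"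
  shows "\<exists>s\<in>B. s \<notin> q \<and> (\<forall>q'\<in>Q - {q}. s \<in> q')"
  using assms(1,2)
proof (induction Q)
  case empty
  then show ?case using field_kernelD(1)[OF assms(3)] by auto
next
  case (insert p Q)
  have "\<exists>s\<in>B. s \<notin> q \<and> (\<forall>q'\<in>Q - {q}. s \<in> q')"
    using insert.prems by (intro insert.IH) simp
  then obtain s where s: "s \<in> B" "s \<notin> q" "\<And>q'. q' \<in> Q - {q} \<Longrightarrow> s \<in> q'" by blast
  show ?case
  proof (cases "p = q")
    case True then show ?thesis using s by auto
  next
    case False
    obtain s' where s': "s' \<in> p" "s' \<notin> q"
      using field_kernel_incomparable[OF assms(3) insert.prems[of p]] False by auto
    have ideal: "x \<otimes>\<^bsub>T\<^esub> y \<in> q'" if "q' \<in> insert p Q" "x \<in> q'" "y \<in> B" for q' x y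
      using field_kernelD(2)[OF insert.prems[OF that(1)] that(2,3)] .
    have s'B: "s' \<in> B" using field_kernelD(1)[OF insert.prems[of p]] s' by auto
    have "s \<otimes>\<^bsub>T\<^esub> s' \<notin> q" using field_kernelD(4)[OF assms(3) s(1) s'B] s s' by auto
    moreover have "s \<otimes>\<^bsub>T\<^esub> s' \<in> q'" if "q' \<in> insert p Q - {q}" for q'
    proof (cases "q' = p")
      case True
      then show ?thesis using ideal[OF _ s'(1) s(1)] comm[OF s(1) s'B] by simp
    next
      case False
      then show ?thesis using ideal[OF _ s(3) s'B] that by simp
    qed
    ultimately show ?thesis using closed[OF s(1) s'B] by blast
  qed
qed

text \<open>
  A module \<open>V\<close> over the graded \<open>R\<close>-algebra \<open>T\<close> that is a finite-dimensional space over the residue field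
  \<open>R/\<pp>\<close>.
\<close>

locale graded_fibre =
  V: module T V + grad: graded_algebra C R T \<phi> \<T> + C: comm_group C +
  RS: residue_space R "restrict_scalars \<phi> V" \<pp> S
  for C :: "('c, 'z) monoid_scheme" and R :: "('r, 'x) ring_scheme" and T :: "('t, 'y) ring_scheme"
    and \<phi> :: "'r \<Rightarrow> 't" and \<T> :: "'c \<Rightarrow> 't set" and V :: "('t, 'v) module" and \<pp> :: "'r set" and S :: "'v set" +
  assumes finite_C: "finite (carrier C)"
begin

text \<open>
  The part of \<open>T\<close> whose degree is the identity of \<open>C\<close>.
\<close>

abbreviation "T1 \<equiv> \<T> \<one>\<^bsub>C\<^esub>"

definition kills :: "'t \<Rightarrow> 'v set \<Rightarrow> bool"
  where "kills t E \<longleftrightarrow> (\<forall>e\<in>E. t \<odot>\<^bsub>V\<^esub> e = \<zero>\<^bsub>V\<^esub>)"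

text \<open>
  The annihilator of \<open>E\<close> in the degree-one part of \<open>T\<close>.
\<close>

definition vertex :: "'v set \<Rightarrow> 't set"
  where "vertex E = {t \<in> T1. kills t E}"

lemma comp_subgroup: "d \<in> carrier C \<Longrightarrow> subgroup (\<T> d) (add_monoid T)"
  using grad.decomposition unfolding internal_direct_sum_def by auto

lemma comp_carrier: "d \<in> carrier C \<Longrightarrow> t \<in> \<T> d \<Longrightarrow> t \<in> carrier T"
  using subgroup.subset[OF comp_subgroup] by auto

lemma T1_carrier: "t \<in> T1 \<Longrightarrow> t \<in> carrier T"
  using comp_carrier by auto

lemma T1_mult: "t \<in> T1 \<Longrightarrow> t' \<in> T1 \<Longrightarrow> t \<otimes>\<^bsub>T\<^esub> t' \<in> T1"
  using grad.component_mult[of "\<one>\<^bsub>C\<^esub>" "\<one>\<^bsub>C\<^esub>"] by simp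

lemma T1_smult: "r \<in> carrier R \<Longrightarrow> t \<in> T1 \<Longrightarrow> \<phi> r \<otimes>\<^bsub>T\<^esub> t \<in> T1"
  using submodule.smult_closed[OF grad.component_submodule[OF C.one_closed]]
  by (simp add: algebra_module_def)

lemma phi_carrier: "r \<in> carrier R \<Longrightarrow> \<phi> r \<in> carrier T"
  using ring_hom_closed[OF grad.structure_hom] by auto

lemma submodule_restrict:
  assumes "submodule F T V" shows "submodule F R (restrict_scalars \<phi> V)"
proof -
  interpret F: submodule F T V by fact
  have "subgroup F (add_monoid (restrict_scalars \<phi> V))"
    using F.subgroup_axioms by (simp only: subgroup_restrict_scalars)
  then show ?thesis
    by (rule submodule.intro) (simp add: submodule_axioms_def phi_carrier)
qed

lemma simple_carrier: "simple_submodule E T V \<Longrightarrow> e \<in> E \<Longrightarrow> e \<in> carrier V"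
  using V.submoduleE(1)[of E] unfolding simple_submodule_def by auto

lemma simple_nonzero:
  assumes "simple_submodule E T V" shows "\<exists>e\<in>E. e \<noteq> \<zero>\<^bsub>V\<^esub>"
proof -
  have "submodule E T V" "E \<noteq> {\<zero>\<^bsub>V\<^esub>}" using assms unfolding simple_submodule_def by auto
  then show ?thesis using V.submoduleE(2)[of E] by auto
qed

text \<open>
  An element of \<open>T\<close> acts on a simple module as zero or injectively, since \<open>T\<close> is commutative.
\<close>

lemma simple_kills:
  assumes E: "simple_submodule E T V" and t: "t \<in> carrier T"
    and e: "e \<in> E" "e \<noteq> \<zero>\<^bsub>V\<^esub>" "t \<odot>\<^bsub>V\<^esub> e = \<zero>\<^bsub>V\<^esub>"
  shows "kills t E"
proof -
  have sub: "submodule E T V" using E unfolding simple_submodule_def by auto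
  note EE = V.submoduleE[OF sub]
  let ?F = "{x \<in> E. t \<odot>\<^bsub>V\<^esub> x = \<zero>\<^bsub>V\<^esub>}"
  have EV: "x \<in> carrier V" if "x \<in> E" for x using that EE(1) by auto
  have E0: "\<zero>\<^bsub>V\<^esub> \<in> E" using subgroup.one_closed[OF submodule.axioms(1)[OF sub]] by simp
  have "submodule ?F T V"
  proof (rule V.submoduleI)
    fix a x assume a: "a \<in> carrier T" and x: "x \<in> ?F"
    have "t \<odot>\<^bsub>V\<^esub> (a \<odot>\<^bsub>V\<^esub> x) = a \<odot>\<^bsub>V\<^esub> (t \<odot>\<^bsub>V\<^esub> x)"
      using a t x EV by (intro V.smult_commute) auto
    then show "a \<odot>\<^bsub>V\<^esub> x \<in> ?F" using a x EE(4) by simp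
  qed (use EE E0 EV t in \<open>auto simp: V.smult_r_minus V.smult_r_distr\<close>)
  then have "?F = {\<zero>\<^bsub>V\<^esub>} \<or> ?F = E" using E unfolding simple_submodule_def by blast
  then show ?thesis using e unfolding kills_def by auto
qed

lemma simple_not_kills_mult:
  assumes E: "simple_submodule E T V" and t: "t \<in> carrier T" "t' \<in> carrier T"
    and n: "\<not> kills t E" "\<not> kills t' E"
  shows "\<not> kills (t \<otimes>\<^bsub>T\<^esub> t') E"
proof
  assume k: "kills (t \<otimes>\<^bsub>T\<^esub> t') E"
  obtain e where e: "e \<in> E" "e \<noteq> \<zero>\<^bsub>V\<^esub>" using simple_nonzero[OF E] by auto
  have eV: "e \<in> carrier V" using simple_carrier[OF E e(1)] .
  have "t' \<odot>\<^bsub>V\<^esub> e \<in> E" using V.submoduleE(4)[of E t' e] E t e unfolding simple_submodule_def by auto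
  moreover have "t' \<odot>\<^bsub>V\<^esub> e \<noteq> \<zero>\<^bsub>V\<^esub>" using simple_kills[OF E t(2) e] n by auto
  moreover have "t \<odot>\<^bsub>V\<^esub> (t' \<odot>\<^bsub>V\<^esub> e) = \<zero>\<^bsub>V\<^esub>" using k e(1) eV t V.smult_assoc1[of t t' e] by (simp add: kills_def)
  ultimately show False using simple_kills[OF E t(1)] n by auto
qed

lemma exists_homogeneous:
  assumes E: "simple_submodule E T V"
  shows "\<exists>d\<in>carrier C. \<exists>t\<in>\<T> d. \<not> kills t E"
proof (rule ccontr)
  assume neg: "\<not> ?thesis"
  obtain e where e: "e \<in> E" "e \<noteq> \<zero>\<^bsub>V\<^esub>" using simple_nonzero[OF E] by auto
  have eV: "e \<in> carrier V" using simple_carrier[OF E e(1)] .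
  obtain f where f: "f \<in> (\<Pi>\<^sub>E i\<in>carrier C. \<T> i)" "\<one>\<^bsub>T\<^esub> = (\<Oplus>\<^bsub>T\<^esub>i\<in>carrier C. f i)"
    using grad.decomposition V.R.one_closed unfolding internal_direct_sum_def by metis
  have fi: "f i \<in> \<T> i" "f i \<in> carrier T" if "i \<in> carrier C" for i
    using f(1) that comp_carrier by (auto simp: PiE_iff)
  have "(\<Oplus>\<^bsub>T\<^esub>i\<in>I. f i) \<odot>\<^bsub>V\<^esub> e = \<zero>\<^bsub>V\<^esub>" if "I \<subseteq> carrier C" for I
    using finite_subset[OF that finite_C] that
  proof (induction I)
    case empty then show ?case using eV by simp
  next
    case (insert i I)
    have cl: "f \<in> I \<rightarrow> carrier T" using insert fi by auto
    have "f i \<odot>\<^bsub>V\<^esub> e = \<zero>\<^bsub>V\<^esub>" using neg fi insert e unfolding kills_def by auto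
    then show ?case using insert cl fi eV V.R.finsum_closed[OF cl] by (simp add: V.smult_l_distr)
  qed
  then have "\<one>\<^bsub>T\<^esub> \<odot>\<^bsub>V\<^esub> e = \<zero>\<^bsub>V\<^esub>" using f(2) by simp
  then show False using e eV by simp
qed

lemma comp_pow: "d \<in> carrier C \<Longrightarrow> t \<in> \<T> d \<Longrightarrow> t [^]\<^bsub>T\<^esub> Suc k \<in> \<T> (d [^]\<^bsub>C\<^esub> Suc k)"
proof (induction k)
  case 0 then show ?case using comp_carrier by simp
next
  case (Suc k)
  then have "t [^]\<^bsub>T\<^esub> Suc k \<otimes>\<^bsub>T\<^esub> t \<in> \<T> (d [^]\<^bsub>C\<^esub> Suc k \<otimes>\<^bsub>C\<^esub> d)"
    using grad.component_mult[of "d [^]\<^bsub>C\<^esub> Suc k" d] C.nat_pow_closed by blast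
  then show ?case by simp
qed

lemma order_pos: "order C > 0"
  using finite_C C.order_gt_0_iff_finite by blast

lemma pow_order_T1: "d \<in> carrier C \<Longrightarrow> t \<in> \<T> d \<Longrightarrow> t [^]\<^bsub>T\<^esub> order C \<in> T1"
  using comp_pow[of d t "order C - 1"] order_pos C.pow_order_eq_1[of d] by simp

lemma kills_pow:
  assumes E: "simple_submodule E T V" and t: "t \<in> carrier T"
  shows "kills (t [^]\<^bsub>T\<^esub> Suc k) E \<longleftrightarrow> kills t E"
proof
  assume k: "kills t E"
  show "kills (t [^]\<^bsub>T\<^esub> Suc k) E"
    using k t simple_carrier[OF E] unfolding kills_def by (simp add: V.smult_assoc1)
next
  show "kills t E" if "kills (t [^]\<^bsub>T\<^esub> Suc k) E"
    using that
  proof (induction k)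
    case 0 then show ?case using t by simp
  next
    case (Suc k)
    then show ?case using simple_not_kills_mult[OF E _ t, of "t [^]\<^bsub>T\<^esub> Suc k"] t by fastforce
  qed
qed

text \<open>
  Together with \<open>pow_order_T1\<close> this shows that the vertex of \<open>E\<close> determines which homogeneous elements
  of \<open>T\<close> annihilate \<open>E\<close>.
\<close>

lemma kills_pow_order:
  assumes "simple_submodule E T V" "t \<in> carrier T"
  shows "kills (t [^]\<^bsub>T\<^esub> order C) E \<longleftrightarrow> kills t E"
  using kills_pow[OF assms, of "order C - 1"] order_pos by simp

lemma vertex_field_kernel:
  assumes E: "simple_submodule E T V"
  shows "field_kernel T T1 (vertex E)"
proof -
  note EV = simple_carrier[OF E]
  have sub: "submodule E T V" using E unfolding simple_submodule_def by auto
  note EE = V.submoduleE[OF sub]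
  obtain e where e: "e \<in> E" "e \<noteq> \<zero>\<^bsub>V\<^esub>" using simple_nonzero[OF E] by auto
  have eV: "e \<in> carrier V" using EV[OF e(1)] .
  have diff: "(a \<ominus>\<^bsub>T\<^esub> b) \<odot>\<^bsub>V\<^esub> x = a \<odot>\<^bsub>V\<^esub> x \<ominus>\<^bsub>V\<^esub> b \<odot>\<^bsub>V\<^esub> x"
    if "a \<in> carrier T" "b \<in> carrier T" "x \<in> carrier V" for a b x
    using that by (simp add: V.R.minus_eq V.M.minus_eq V.smult_l_distr V.smult_l_minus)
  have T1_diff: "a \<ominus>\<^bsub>T\<^esub> b \<in> T1" if "a \<in> T1" "b \<in> T1" for a b
    using subgroup.m_closed[OF comp_subgroup[OF C.one_closed] that(1)
        subgroup.m_inv_closed[OF comp_subgroup[OF C.one_closed] that(2)]]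
    by (simp add: V.R.minus_eq a_inv_def)
  show ?thesis
    unfolding field_kernel_def
  proof (intro conjI ballI impI)
    obtain d t where t: "d \<in> carrier C" "t \<in> \<T> d" "\<not> kills t E" using exists_homogeneous[OF E] by auto
    then have "t [^]\<^bsub>T\<^esub> order C \<notin> vertex E" "t [^]\<^bsub>T\<^esub> order C \<in> T1"
      using pow_order_T1 kills_pow_order[OF E] comp_carrier by (auto simp: vertex_def)
    then show "vertex E \<subset> T1" unfolding vertex_def by auto
  next
    fix x y assume "x \<in> vertex E" "y \<in> T1"
    then have xy: "x \<in> T1" "kills x E" "y \<in> T1" "x \<in> carrier T" "y \<in> carrier T"
      using T1_carrier by (auto simp: vertex_def)
    have "(x \<otimes>\<^bsub>T\<^esub> y) \<odot>\<^bsub>V\<^esub> u = \<zero>\<^bsub>V\<^esub>" if "u \<in> E" for u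
      using that xy EV EE(4) by (simp add: kills_def V.smult_assoc1)
    then show "x \<otimes>\<^bsub>T\<^esub> y \<in> vertex E" using T1_mult xy by (auto simp: vertex_def kills_def)
  next
    fix x y assume "x \<in> vertex E" "y \<in> T1" "x \<ominus>\<^bsub>T\<^esub> y \<in> vertex E"
    then have xy: "x \<in> T1" "kills x E" "y \<in> T1" "x \<in> carrier T" "y \<in> carrier T" "kills (x \<ominus>\<^bsub>T\<^esub> y) E"
      using T1_carrier by (auto simp: vertex_def)
    have "y \<odot>\<^bsub>V\<^esub> u = \<zero>\<^bsub>V\<^esub>" if u: "u \<in> E" for u
    proof -
      have "x \<odot>\<^bsub>V\<^esub> u \<ominus>\<^bsub>V\<^esub> y \<odot>\<^bsub>V\<^esub> u = \<zero>\<^bsub>V\<^esub>"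
        using xy u diff[of x y u] EV[OF u] by (simp add: kills_def)
      moreover have "x \<odot>\<^bsub>V\<^esub> u = (x \<odot>\<^bsub>V\<^esub> u \<ominus>\<^bsub>V\<^esub> y \<odot>\<^bsub>V\<^esub> u) \<oplus>\<^bsub>V\<^esub> y \<odot>\<^bsub>V\<^esub> u"
        using xy EV[OF u] by (simp add: V.M.minus_eq V.M.a_assoc V.M.l_neg)
      ultimately have "x \<odot>\<^bsub>V\<^esub> u = y \<odot>\<^bsub>V\<^esub> u" using xy EV[OF u] by simp
      then show ?thesis using xy(2) u by (simp add: kills_def)
    qed
    then show "y \<in> vertex E" using xy by (auto simp: vertex_def kills_def)
  next
    fix x y assume "x \<in> T1" "y \<in> T1" "x \<otimes>\<^bsub>T\<^esub> y \<in> vertex E"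
    then show "x \<in> vertex E \<or> y \<in> vertex E"
      using simple_not_kills_mult[OF E] T1_carrier by (auto simp: vertex_def)
  next
    fix x y assume x: "x \<in> T1 - vertex E" and y: "y \<in> T1"
    have xT: "x \<in> carrier T" and yT: "y \<in> carrier T" using x y T1_carrier by auto
    let ?F = "{t \<odot>\<^bsub>V\<^esub> e | t. t \<in> T1}"
    have FE: "?F \<subseteq> E" using EE(4) T1_carrier e by auto
    \<comment> \<open>\<open>x\<close> is injective on the finite-dimensional space \<open>T1 e\<close>, hence surjective.\<close>
    have surj: "(\<lambda>v. x \<odot>\<^bsub>V\<^esub> v) ` ?F = ?F"
    proof (rule RS.inj_imp_surj)
      show "submodule ?F R (restrict_scalars \<phi> V)"
      proof (rule RS.submoduleI)
        show "?F \<subseteq> carrier (restrict_scalars \<phi> V)" using FE EE(1) by auto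
        have "\<zero>\<^bsub>T\<^esub> \<in> T1" using subgroup.one_closed[OF comp_subgroup[OF C.one_closed]] by simp
        moreover have "\<zero>\<^bsub>T\<^esub> \<odot>\<^bsub>V\<^esub> e = \<zero>\<^bsub>V\<^esub>" using eV by simp
        ultimately show zero: "\<zero>\<^bsub>restrict_scalars \<phi> V\<^esub> \<in> ?F" by force
        fix a assume "a \<in> ?F"
        then obtain t where t: "t \<in> T1" "a = t \<odot>\<^bsub>V\<^esub> e" by auto
        have "\<zero>\<^bsub>T\<^esub> \<ominus>\<^bsub>T\<^esub> t \<in> T1" using T1_diff[OF \<open>\<zero>\<^bsub>T\<^esub> \<in> T1\<close> t(1)] .
        moreover have "(\<zero>\<^bsub>T\<^esub> \<ominus>\<^bsub>T\<^esub> t) \<odot>\<^bsub>V\<^esub> e = \<ominus>\<^bsub>V\<^esub> a"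
          using t eV T1_carrier by (simp add: V.R.minus_eq V.smult_l_minus)
        ultimately have "\<ominus>\<^bsub>V\<^esub> a \<in> ?F" by force
        then show "\<ominus>\<^bsub>restrict_scalars \<phi> V\<^esub> a \<in> ?F" by simp
        { fix b assume "b \<in> ?F"
          then obtain t' where t': "t' \<in> T1" "b = t' \<odot>\<^bsub>V\<^esub> e" by auto
          have "t \<oplus>\<^bsub>T\<^esub> t' \<in> T1" using subgroup.m_closed[OF comp_subgroup[OF C.one_closed] t(1) t'(1)] by simp
          moreover have "(t \<oplus>\<^bsub>T\<^esub> t') \<odot>\<^bsub>V\<^esub> e = a \<oplus>\<^bsub>V\<^esub> b" using t t' eV T1_carrier by (simp add: V.smult_l_distr)
          ultimately show "a \<oplus>\<^bsub>restrict_scalars \<phi> V\<^esub> b \<in> ?F" by force }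
        fix r assume r: "r \<in> carrier R"
        have "(\<phi> r \<otimes>\<^bsub>T\<^esub> t) \<odot>\<^bsub>V\<^esub> e = \<phi> r \<odot>\<^bsub>V\<^esub> a" using t r phi_carrier eV T1_carrier by (simp add: V.smult_assoc1)
        then show "r \<odot>\<^bsub>restrict_scalars \<phi> V\<^esub> a \<in> ?F" using T1_smult[OF r t(1)] by force
      qed
      show "(\<lambda>v. x \<odot>\<^bsub>V\<^esub> v) \<in> ?F \<rightarrow> ?F"
      proof
        fix v assume "v \<in> ?F"
        then obtain t where t: "t \<in> T1" "v = t \<odot>\<^bsub>V\<^esub> e" by auto
        have "x \<odot>\<^bsub>V\<^esub> v = (x \<otimes>\<^bsub>T\<^esub> t) \<odot>\<^bsub>V\<^esub> e" using t xT eV T1_carrier by (simp add: V.smult_assoc1)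
        then show "x \<odot>\<^bsub>V\<^esub> v \<in> ?F" using T1_mult x t by blast
      qed
      fix u assume u: "u \<in> ?F"
      have uE: "u \<in> E" using u FE by auto
      then have uV: "u \<in> carrier V" using EV by auto
      show "u = \<zero>\<^bsub>restrict_scalars \<phi> V\<^esub>" if "x \<odot>\<^bsub>V\<^esub> u = \<zero>\<^bsub>restrict_scalars \<phi> V\<^esub>"
        using simple_kills[OF E xT uE] that x by (auto simp: vertex_def)
      show "x \<odot>\<^bsub>V\<^esub> (u \<oplus>\<^bsub>restrict_scalars \<phi> V\<^esub> w) = x \<odot>\<^bsub>V\<^esub> u \<oplus>\<^bsub>restrict_scalars \<phi> V\<^esub> x \<odot>\<^bsub>V\<^esub> w" if "w \<in> ?F" for w
        using that uV xT eV T1_carrier by (auto simp: V.smult_r_distr)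
      show "x \<odot>\<^bsub>V\<^esub> (r \<odot>\<^bsub>restrict_scalars \<phi> V\<^esub> u) = r \<odot>\<^bsub>restrict_scalars \<phi> V\<^esub> (x \<odot>\<^bsub>V\<^esub> u)" if "r \<in> carrier R" for r
        using phi_carrier[OF that] uV xT V.smult_commute by simp
    qed
    have "y \<odot>\<^bsub>V\<^esub> e \<in> ?F" using y by auto
    then have "y \<odot>\<^bsub>V\<^esub> e \<in> (\<lambda>v. x \<odot>\<^bsub>V\<^esub> v) ` ?F" by (simp only: surj)
    then obtain z where z: "z \<in> T1" "x \<odot>\<^bsub>V\<^esub> (z \<odot>\<^bsub>V\<^esub> e) = y \<odot>\<^bsub>V\<^esub> e" by auto
    have zT: "z \<in> carrier T" using z T1_carrier by auto
    have "(x \<otimes>\<^bsub>T\<^esub> z \<ominus>\<^bsub>T\<^esub> y) \<odot>\<^bsub>V\<^esub> e = \<zero>\<^bsub>V\<^esub>"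
      using xT yT zT eV z by (simp add: diff V.smult_assoc1 V.M.minus_eq V.M.r_neg)
    then have "kills (x \<otimes>\<^bsub>T\<^esub> z \<ominus>\<^bsub>T\<^esub> y) E" using simple_kills[OF E _ e] xT yT zT by simp
    then show "\<exists>z\<in>T1. x \<otimes>\<^bsub>T\<^esub> z \<ominus>\<^bsub>T\<^esub> y \<in> vertex E"
      using z T1_diff T1_mult x y by (auto simp: vertex_def)
  qed
qed

text \<open>
  A nonzero submodule of \<open>K\<close> of minimal rank is simple.
\<close>

lemma exists_simple_submodule:
  assumes K: "submodule K T V" "K \<noteq> {\<zero>\<^bsub>V\<^esub>}"
  shows "\<exists>E. simple_submodule E T V \<and> E \<subseteq> K"
proof -
  let ?P = "\<lambda>F. submodule F T V \<and> F \<noteq> {\<zero>\<^bsub>V\<^esub>} \<and> F \<subseteq> K"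
  define E where "E = arg_min RS.rank ?P"
  have E: "?P E" unfolding E_def by (rule arg_min_natI[of ?P K]) (use K in auto)
  have min: "RS.rank E \<le> RS.rank F" if "?P F" for F
    unfolding E_def by (rule arg_min_nat_le[of ?P]) (use that in auto)
  have "F = {\<zero>\<^bsub>V\<^esub>} \<or> F = E" if F: "submodule F T V" "F \<subseteq> E" for F
  proof (rule ccontr)
    assume "\<not> ?thesis"
    then have "?P F" "F \<subset> E" using F E by auto
    moreover have "E \<subseteq> carrier (restrict_scalars \<phi> V)" using V.submoduleE(1)[of E] E by simp
    ultimately have "RS.rank F < RS.rank E" "RS.rank E \<le> RS.rank F"
      using RS.rank_psubset[OF submodule_restrict[OF F(1)]] min[of F] by simp_all
    then show False by simp
  qed
  then show ?thesis using E unfolding simple_submodule_def by blast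
qed

text \<open>
  Nonzero vectors, one from a simple module for each vertex, are separated by elements of the
  degree-one part.
\<close>

lemma finite_vertices: "finite {vertex E | E. simple_submodule E T V}" (is "finite ?Q")
proof -
  have "\<exists>e. \<forall>q\<in>?Q. \<exists>E. simple_submodule E T V \<and> q = vertex E \<and> e q \<in> E \<and> e q \<noteq> \<zero>\<^bsub>V\<^esub>"
    by (rule bchoice) (use simple_nonzero in fastforce)
  then obtain e where e: "\<And>q. q \<in> ?Q \<Longrightarrow> \<exists>E. simple_submodule E T V \<and> q = vertex E \<and> e q \<in> E \<and> e q \<noteq> \<zero>\<^bsub>V\<^esub>"
    by auto
  have mem: "t \<in> q \<longleftrightarrow> t \<odot>\<^bsub>V\<^esub> e q = \<zero>\<^bsub>V\<^esub>" if q: "q \<in> ?Q" and t: "t \<in> T1" for q t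
  proof -
    obtain E where "simple_submodule E T V" "q = vertex E" "e q \<in> E" "e q \<noteq> \<zero>\<^bsub>V\<^esub>" using e[OF q] by auto
    then show ?thesis using simple_kills[of E t "e q"] t T1_carrier by (auto simp: vertex_def kills_def)
  qed
  have eV: "e q \<in> carrier V" if q: "q \<in> ?Q" for q using e[OF q] simple_carrier by auto
  show ?thesis
  proof (rule RS.finite_of_separated)
    show "e q \<in> carrier (restrict_scalars \<phi> V)" if "q \<in> ?Q" for q using eV[OF that] by simp
    fix Q' q assume Q': "finite Q'" "Q' \<subseteq> ?Q" "q \<in> Q'"
    have "\<exists>s\<in>T1. s \<notin> q \<and> (\<forall>q'\<in>Q' - {q}. s \<in> q')"
    proof (rule field_kernels_separated[OF Q'(1)])
      show "field_kernel T T1 q'" if "q' \<in> Q'" for q' using vertex_field_kernel Q' that by auto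
      show "field_kernel T T1 q" using vertex_field_kernel Q' by auto
    qed (use T1_mult T1_carrier V.R.m_comm in auto)
    then obtain s where s: "s \<in> T1" "s \<notin> q" "\<And>q'. q' \<in> Q' - {q} \<Longrightarrow> s \<in> q'" by auto
    have sT: "s \<in> carrier T" using s T1_carrier by auto
    have s_ne: "s \<odot>\<^bsub>V\<^esub> e q \<noteq> \<zero>\<^bsub>V\<^esub>" using mem[of q s] s Q' by auto
    have s_eq: "s \<odot>\<^bsub>V\<^esub> e q' = \<zero>\<^bsub>V\<^esub>" if "q' \<in> Q' - {q}" for q' using mem[of q' s] s that Q' by auto
    have lin: "s \<odot>\<^bsub>V\<^esub> (\<phi> r \<odot>\<^bsub>V\<^esub> u) = \<phi> r \<odot>\<^bsub>V\<^esub> (s \<odot>\<^bsub>V\<^esub> u)" if "r \<in> carrier R" "u \<in> carrier V" for r u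
      using that phi_carrier sT by (intro V.smult_commute) auto
    show "\<exists>x\<in>carrier (restrict_scalars \<phi> V) \<rightarrow> carrier (restrict_scalars \<phi> V).
       (\<forall>u\<in>carrier (restrict_scalars \<phi> V). \<forall>w\<in>carrier (restrict_scalars \<phi> V).
          x (u \<oplus>\<^bsub>restrict_scalars \<phi> V\<^esub> w) = x u \<oplus>\<^bsub>restrict_scalars \<phi> V\<^esub> x w) \<and>
       (\<forall>r\<in>carrier R. \<forall>u\<in>carrier (restrict_scalars \<phi> V).
          x (r \<odot>\<^bsub>restrict_scalars \<phi> V\<^esub> u) = r \<odot>\<^bsub>restrict_scalars \<phi> V\<^esub> x u) \<and>
       x (e q) \<noteq> \<zero>\<^bsub>restrict_scalars \<phi> V\<^esub> \<and> (\<forall>q'\<in>Q' - {q}. x (e q') = \<zero>\<^bsub>restrict_scalars \<phi> V\<^esub>)"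
      by (rule bexI[of _ "\<lambda>u. s \<odot>\<^bsub>V\<^esub> u"]) (use s_ne s_eq lin sT in \<open>auto simp: V.smult_r_distr\<close>)
  qed
qed

lemma degrees_mult_closed:
  assumes E: "simple_submodule E T V"
    and d: "d \<in> carrier C" "t \<in> \<T> d" "\<not> kills t E" "d' \<in> carrier C" "t' \<in> \<T> d'" "\<not> kills t' E"
  shows "\<exists>t\<in>\<T> (d \<otimes>\<^bsub>C\<^esub> d'). \<not> kills t E"
  using simple_not_kills_mult[OF E comp_carrier[OF d(1,2)] comp_carrier[OF d(4,5)] d(3,6)]
    grad.component_mult[OF d(1,4,2,5)] by blast

end

section \<open>Monomials in the group algebra\<close>

locale group_algebra_data = T: cring T + W: group W
  for T :: "('t, 'x) ring_scheme" and W :: "('w, 'z) monoid_scheme"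
begin

abbreviation "B \<equiv> group_algebra T W"
abbreviation "gmonom \<equiv> group_algebra_monom T W"

lemma B_carrier:
  "f \<in> carrier B \<longleftrightarrow> f \<in> carrier W \<rightarrow>\<^sub>E carrier T \<and> finite {w \<in> carrier W. f w \<noteq> \<zero>\<^bsub>T\<^esub>}"
  by (simp add: group_algebra_def)

lemma monom_closed: "\<lbrakk>t \<in> carrier T; w \<in> carrier W\<rbrakk> \<Longrightarrow> gmonom t w \<in> carrier B"
  unfolding B_carrier group_algebra_monom_def
  by (auto intro: finite_subset[of _ "{w}"])

lemma monom_add:
  "\<lbrakk>t \<in> carrier T; t' \<in> carrier T\<rbrakk> \<Longrightarrow> gmonom (t \<oplus>\<^bsub>T\<^esub> t') w = gmonom t w \<oplus>\<^bsub>B\<^esub> gmonom t' w"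
  by (rule ext) (simp add: group_algebra_monom_def group_algebra_def restrict_def)

lemma one_eq_monom: "\<one>\<^bsub>B\<^esub> = gmonom \<one>\<^bsub>T\<^esub> \<one>\<^bsub>W\<^esub>"
  by (simp add: group_algebra_monom_def group_algebra_def)

lemma monom_mult_left:
  assumes t: "t \<in> carrier T" and w: "w \<in> carrier W" and g: "g \<in> carrier B"
  shows "gmonom t w \<otimes>\<^bsub>B\<^esub> g = (\<lambda>v\<in>carrier W. t \<otimes>\<^bsub>T\<^esub> g (inv\<^bsub>W\<^esub> w \<otimes>\<^bsub>W\<^esub> v))"
proof -
  have gT: "g v \<in> carrier T" if "v \<in> carrier W" for v using g that by (auto simp: B_carrier PiE_iff)
  have supp: "{u \<in> carrier W. gmonom t w u \<noteq> \<zero>\<^bsub>T\<^esub>} = (if t = \<zero>\<^bsub>T\<^esub> then {} else {w})"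
    using w by (auto simp: group_algebra_monom_def)
  have "(\<Oplus>\<^bsub>T\<^esub>u\<in>{u \<in> carrier W. gmonom t w u \<noteq> \<zero>\<^bsub>T\<^esub>}. gmonom t w u \<otimes>\<^bsub>T\<^esub> g (inv\<^bsub>W\<^esub> u \<otimes>\<^bsub>W\<^esub> v))
    = t \<otimes>\<^bsub>T\<^esub> g (inv\<^bsub>W\<^esub> w \<otimes>\<^bsub>W\<^esub> v)" if v: "v \<in> carrier W" for v
  proof (cases "t = \<zero>\<^bsub>T\<^esub>")
    case True then show ?thesis unfolding supp using gT v w by simp
  next
    case False
    have "gmonom t w w = t" using w by (simp add: group_algebra_monom_def)
    then show ?thesis unfolding supp using gT v w t False by simp
  qed
  then show ?thesis unfolding group_algebra_def by (auto intro!: restrict_ext)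
qed

lemma monom_mult:
  assumes "t \<in> carrier T" "w \<in> carrier W" "t' \<in> carrier T" "w' \<in> carrier W"
  shows "gmonom t w \<otimes>\<^bsub>B\<^esub> gmonom t' w' = gmonom (t \<otimes>\<^bsub>T\<^esub> t') (w \<otimes>\<^bsub>W\<^esub> w')"
proof -
  have "inv\<^bsub>W\<^esub> w \<otimes>\<^bsub>W\<^esub> v = w' \<longleftrightarrow> v = w \<otimes>\<^bsub>W\<^esub> w'" if "v \<in> carrier W" for v
    using assms that by (metis W.inv_closed W.inv_inv W.inv_solve_left W.m_closed)
  then show ?thesis
    unfolding monom_mult_left[OF assms(1,2) monom_closed[OF assms(3,4)]]
    using assms by (auto simp: group_algebra_monom_def intro!: restrict_ext)
qed

lemma coeff_central:
  assumes t: "t \<in> carrier T" and g: "g \<in> carrier B"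
  shows "gmonom t \<one>\<^bsub>W\<^esub> \<otimes>\<^bsub>B\<^esub> g = g \<otimes>\<^bsub>B\<^esub> gmonom t \<one>\<^bsub>W\<^esub>"
proof -
  have gT: "g v \<in> carrier T" if "v \<in> carrier W" for v using g that by (auto simp: B_carrier PiE_iff)
  let ?S = "{u \<in> carrier W. g u \<noteq> \<zero>\<^bsub>T\<^esub>}"
  have fin: "finite ?S" using g by (simp add: B_carrier)
  have "(\<Oplus>\<^bsub>T\<^esub>u\<in>?S. g u \<otimes>\<^bsub>T\<^esub> gmonom t \<one>\<^bsub>W\<^esub> (inv\<^bsub>W\<^esub> u \<otimes>\<^bsub>W\<^esub> v)) = t \<otimes>\<^bsub>T\<^esub> g v" if v: "v \<in> carrier W" for v
  proof -
    have "(\<Oplus>\<^bsub>T\<^esub>u\<in>?S. g u \<otimes>\<^bsub>T\<^esub> gmonom t \<one>\<^bsub>W\<^esub> (inv\<^bsub>W\<^esub> u \<otimes>\<^bsub>W\<^esub> v))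
      = (\<Oplus>\<^bsub>T\<^esub>u\<in>?S. if v = u then g u \<otimes>\<^bsub>T\<^esub> t else \<zero>\<^bsub>T\<^esub>)"
    proof (rule T.finsum_cong')
      fix u assume u: "u \<in> ?S"
      have "inv\<^bsub>W\<^esub> u \<otimes>\<^bsub>W\<^esub> v = \<one>\<^bsub>W\<^esub> \<longleftrightarrow> v = u"
        using u v by (metis (no_types, lifting) W.inv_closed W.inv_solve_left W.one_closed W.r_one W.inv_inv mem_Collect_eq)
      then show "g u \<otimes>\<^bsub>T\<^esub> gmonom t \<one>\<^bsub>W\<^esub> (inv\<^bsub>W\<^esub> u \<otimes>\<^bsub>W\<^esub> v) = (if v = u then g u \<otimes>\<^bsub>T\<^esub> t else \<zero>\<^bsub>T\<^esub>)"
        using u v gT by (simp add: group_algebra_monom_def)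
    qed (use gT t in auto)
    also have "\<dots> = t \<otimes>\<^bsub>T\<^esub> g v"
    proof (cases "v \<in> ?S")
      case True
      have "(\<Oplus>\<^bsub>T\<^esub>u\<in>?S. if v = u then g u \<otimes>\<^bsub>T\<^esub> t else \<zero>\<^bsub>T\<^esub>) = g v \<otimes>\<^bsub>T\<^esub> t"
        using True fin by (rule T.finsum_singleton) (use gT t in auto)
      then show ?thesis using gT[OF v] t by (simp add: T.m_comm)
    next
      case False
      then have "(\<Oplus>\<^bsub>T\<^esub>u\<in>?S. if v = u then g u \<otimes>\<^bsub>T\<^esub> t else \<zero>\<^bsub>T\<^esub>) = (\<Oplus>\<^bsub>T\<^esub>u\<in>?S. \<zero>\<^bsub>T\<^esub>)"
        by (intro T.finsum_cong') auto
      then show ?thesis using False v t by simp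
    qed
    finally show ?thesis .
  qed
  moreover have "gmonom t \<one>\<^bsub>W\<^esub> \<otimes>\<^bsub>B\<^esub> g = (\<lambda>v\<in>carrier W. t \<otimes>\<^bsub>T\<^esub> g v)"
    unfolding monom_mult_left[OF t W.one_closed g] by (rule restrict_ext) simp
  ultimately show ?thesis unfolding group_algebra_def by (auto intro!: restrict_ext)
qed

end

lemma (in left_module) finsum_smult_singleton:
  assumes "finite I" "i \<in> I" "b \<in> I \<rightarrow> carrier A" "x \<in> carrier M"
    and "\<And>j. j \<in> I - {i} \<Longrightarrow> b j \<odot>\<^bsub>M\<^esub> x = \<zero>\<^bsub>M\<^esub>"
  shows "(\<Oplus>\<^bsub>A\<^esub>j\<in>I. b j) \<odot>\<^bsub>M\<^esub> x = b i \<odot>\<^bsub>M\<^esub> x"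
proof -
  have zero: "(\<Oplus>\<^bsub>A\<^esub>j\<in>J. b j) \<odot>\<^bsub>M\<^esub> x = \<zero>\<^bsub>M\<^esub>" if "J \<subseteq> I - {i}" for J
    using finite_subset[OF that] assms(1) that
  proof (induction J rule: infinite_finite_induct)
    case (insert j J)
    have cl: "b \<in> J \<rightarrow> carrier A" "b j \<in> carrier A" using insert.prems assms(3) by auto
    have "b j \<odot>\<^bsub>M\<^esub> x = \<zero>\<^bsub>M\<^esub>" using assms(5) insert.prems by simp
    moreover have "(\<Oplus>\<^bsub>A\<^esub>j\<in>J. b j) \<odot>\<^bsub>M\<^esub> x = \<zero>\<^bsub>M\<^esub>"
      using insert.IH insert.prems by simp
    ultimately show ?case
      using insert.hyps cl assms(4) A.finsum_closed[OF cl(1)] by (simp add: smult_l_distr)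
  qed (use assms(4) smult_l_zero in auto)
  have cl: "b \<in> I - {i} \<rightarrow> carrier A" "b i \<in> carrier A" using assms by auto
  have "I = insert i (I - {i})" using assms(2) by auto
  then have "(\<Oplus>\<^bsub>A\<^esub>j\<in>I. b j) = (\<Oplus>\<^bsub>A\<^esub>j\<in>insert i (I - {i}). b j)" by simp
  also have "\<dots> = b i \<oplus>\<^bsub>A\<^esub> (\<Oplus>\<^bsub>A\<^esub>j\<in>I - {i}. b j)"
    using assms(1) cl by (intro A.finsum_insert) auto
  finally have "(\<Oplus>\<^bsub>A\<^esub>j\<in>I. b j) \<odot>\<^bsub>M\<^esub> x = b i \<odot>\<^bsub>M\<^esub> x \<oplus>\<^bsub>M\<^esub> \<zero>\<^bsub>M\<^esub>"
    using cl assms(4) A.finsum_closed[OF cl(1)] zero[of "I - {i}"] by (simp add: smult_l_distr)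
  then show ?thesis using cl assms(4) smult_closed by simp
qed

lemma finsum_in_subgroup:
  assumes "abelian_group M" "subgroup H (add_monoid M)" "finite I" "f \<in> I \<rightarrow> H"
  shows "(\<Oplus>\<^bsub>M\<^esub>i\<in>I. f i) \<in> H"
proof -
  interpret abelian_group M by fact
  have HM: "H \<subseteq> carrier M" using subgroup.subset[OF assms(2)] by simp
  show ?thesis
    using assms(3,4)
  proof (induction I)
    case empty then show ?case using subgroup.one_closed[OF assms(2)] by simp
  next
    case (insert i I)
    have "f \<in> I \<rightarrow> carrier M" "f i \<in> carrier M" using insert.prems HM by auto
    moreover have "f i \<oplus>\<^bsub>M\<^esub> (\<Oplus>\<^bsub>M\<^esub>i\<in>I. f i) \<in> H"
      using subgroup.m_closed[OF assms(2)] insert by simp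
    ultimately show ?case using insert.hyps by simp
  qed
qed

lemma fg_module_generates:
  assumes "abelian_group M" "fg_module A M"
  shows "\<exists>S\<subseteq>carrier M. finite S \<and> (\<forall>F. subgroup F (add_monoid M) \<longrightarrow>
    (\<forall>a\<in>carrier A. \<forall>x\<in>S. a \<odot>\<^bsub>M\<^esub> x \<in> F) \<longrightarrow> F = carrier M)"
proof -
  obtain S where S: "S \<subseteq> carrier M" "finite S"
    "\<And>x. x \<in> carrier M \<Longrightarrow> \<exists>f\<in>S \<rightarrow> carrier A. x = (\<Oplus>\<^bsub>M\<^esub>s\<in>S. f s \<odot>\<^bsub>M\<^esub> s)"
    using assms(2) unfolding fg_module_def by metis
  have "F = carrier M" if F: "subgroup F (add_monoid M)" "\<forall>a\<in>carrier A. \<forall>x\<in>S. a \<odot>\<^bsub>M\<^esub> x \<in> F" for F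
  proof
    show "F \<subseteq> carrier M" using subgroup.subset[OF F(1)] by simp
    show "carrier M \<subseteq> F"
    proof
      fix x assume "x \<in> carrier M"
      then obtain f where f: "f \<in> S \<rightarrow> carrier A" "x = (\<Oplus>\<^bsub>M\<^esub>s\<in>S. f s \<odot>\<^bsub>M\<^esub> s)" using S(3) by blast
      have "(\<lambda>s. f s \<odot>\<^bsub>M\<^esub> s) \<in> S \<rightarrow> F" using f(1) F(2) by auto
      then show "x \<in> F" unfolding f(2) by (rule finsum_in_subgroup[OF assms(1) F(1) S(2)])
    qed
  qed
  then show ?thesis using S(1,2) by blast
qed

section \<open>A homogeneous element acting invertibly\<close>

text \<open>
  The situation of the theorem, without the element \<open>c\<close> and the condition on characters.
\<close>

locale graded_setup =
  R: noetherian_domain R + C: comm_group C + T: cring T + gT: graded_algebra C R T \<phi> \<T> + W: group W +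
  gA: graded_algebra C R A \<psi> \<A> + gM: graded_module C A \<A> M \<M>
  for R :: "'r ring" and C :: "'c monoid" and T :: "'t ring" and W :: "'w monoid"
    and A :: "'a ring" and M :: "('a, 'm) module"
    and \<phi> :: "'r \<Rightarrow> 't" and \<psi> :: "'r \<Rightarrow> 'a"
    and \<T> :: "'c \<Rightarrow> 't set" and \<A> :: "'c \<Rightarrow> 'a set" and \<M> :: "'c \<Rightarrow> 'm set" +
  fixes \<nu> :: "'w \<Rightarrow> 'c" and \<pi> :: "('w \<Rightarrow> 't) \<Rightarrow> 'a"
  assumes semilocal: "semilocal R" and finite_C: "finite (carrier C)" and nu: "\<nu> \<in> hom W C"
    and fg: "fg_module R (algebra_module A \<psi>)"
    and pi: "graded_algebra_hom C R
           (group_algebra T W) (group_algebra_coeff T W \<circ> \<phi>) (group_algebra_grading T W C \<nu> \<T>)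
           A \<psi> \<A> \<pi>"
    and pi_surj: "\<pi> ` carrier (group_algebra T W) = carrier A"
begin

sublocale G: group_algebra_data T W by unfold_locales

abbreviation "\<iota> \<equiv> \<pi> \<circ> group_algebra_coeff T W"

text \<open>
  The image in \<open>A\<close> of a group element.
\<close>

definition unit_of :: "'w \<Rightarrow> 'a"
  where "unit_of w = \<pi> (G.gmonom \<one>\<^bsub>T\<^esub> w)"

lemma pi_hom: "\<pi> \<in> ring_hom G.B A"
  using pi unfolding graded_algebra_hom_def by auto

lemma iota_eq: "\<iota> t = \<pi> (G.gmonom t \<one>\<^bsub>W\<^esub>)"
  by (simp add: group_algebra_coeff_def)

lemma iota_closed: "t \<in> carrier T \<Longrightarrow> \<iota> t \<in> carrier A"
  unfolding iota_eq by (intro ring_hom_closed[OF pi_hom] G.monom_closed) auto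

lemma iota_add: "\<lbrakk>t \<in> carrier T; t' \<in> carrier T\<rbrakk> \<Longrightarrow> \<iota> (t \<oplus>\<^bsub>T\<^esub> t') = \<iota> t \<oplus>\<^bsub>A\<^esub> \<iota> t'"
  unfolding iota_eq by (simp add: G.monom_add ring_hom_add[OF pi_hom] G.monom_closed)

lemma iota_mult: "\<lbrakk>t \<in> carrier T; t' \<in> carrier T\<rbrakk> \<Longrightarrow> \<iota> (t \<otimes>\<^bsub>T\<^esub> t') = \<iota> t \<otimes>\<^bsub>A\<^esub> \<iota> t'"
  unfolding iota_eq
  using G.monom_mult[of t "\<one>\<^bsub>W\<^esub>" t' "\<one>\<^bsub>W\<^esub>"] by (simp add: ring_hom_mult[OF pi_hom, symmetric] G.monom_closed)

lemma iota_one: "\<iota> \<one>\<^bsub>T\<^esub> = \<one>\<^bsub>A\<^esub>"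
  unfolding iota_eq using ring_hom_one[OF pi_hom] G.one_eq_monom by simp

lemma iota_phi: "r \<in> carrier R \<Longrightarrow> \<iota> (\<phi> r) = \<psi> r"
  using pi unfolding graded_algebra_hom_def by simp

lemma iota_central:
  assumes "t \<in> carrier T" "a \<in> carrier A"
  shows "\<iota> t \<otimes>\<^bsub>A\<^esub> a = a \<otimes>\<^bsub>A\<^esub> \<iota> t"
proof -
  obtain g where g: "g \<in> carrier G.B" "a = \<pi> g" using assms(2) pi_surj by blast
  show ?thesis
    unfolding iota_eq g(2)
    using G.coeff_central[OF assms(1) g(1)] G.monom_closed[OF assms(1) W.one_closed] g(1)
    by (simp add: ring_hom_mult[OF pi_hom, symmetric])
qed

lemma unit_of_closed: "w \<in> carrier W \<Longrightarrow> unit_of w \<in> carrier A"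
  unfolding unit_of_def by (intro ring_hom_closed[OF pi_hom] G.monom_closed) auto

lemma unit_of_inv: "w \<in> carrier W \<Longrightarrow> unit_of (inv\<^bsub>W\<^esub> w) \<otimes>\<^bsub>A\<^esub> unit_of w = \<one>\<^bsub>A\<^esub>"
  unfolding unit_of_def
  by (simp add: ring_hom_mult[OF pi_hom, symmetric] G.monom_closed G.monom_mult G.one_eq_monom[symmetric]
      ring_hom_one[OF pi_hom])

lemma nu_closed: "w \<in> carrier W \<Longrightarrow> \<nu> w \<in> carrier C"
  using nu by (auto simp: hom_def)

lemma T_comp_subgroup: "d \<in> carrier C \<Longrightarrow> subgroup (\<T> d) (add_monoid T)"
  using gT.decomposition unfolding internal_direct_sum_def by auto

lemma T_comp_carrier: "\<lbrakk>d \<in> carrier C; t \<in> \<T> d\<rbrakk> \<Longrightarrow> t \<in> carrier T"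
  using subgroup.subset[OF T_comp_subgroup] by auto

lemma A_comp_subgroup: "d \<in> carrier C \<Longrightarrow> subgroup (\<A> d) (add_monoid A)"
  using gA.decomposition unfolding internal_direct_sum_def by auto

lemma A_comp_carrier: "\<lbrakk>d \<in> carrier C; a \<in> \<A> d\<rbrakk> \<Longrightarrow> a \<in> carrier A"
  using subgroup.subset[OF A_comp_subgroup] by auto

lemma iota_unit_of_degree:
  assumes "d \<in> carrier C" "t \<in> \<T> d" "w \<in> carrier W"
  shows "\<iota> t \<otimes>\<^bsub>A\<^esub> unit_of w \<in> \<A> (d \<otimes>\<^bsub>C\<^esub> \<nu> w)"
proof -
  have t: "t \<in> carrier T" using T_comp_carrier assms by auto
  have dw: "d \<otimes>\<^bsub>C\<^esub> \<nu> w \<in> carrier C" using assms nu_closed by auto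
  have "G.gmonom t w \<in> group_algebra_grading T W C \<nu> \<T> (d \<otimes>\<^bsub>C\<^esub> \<nu> w)"
    unfolding group_algebra_grading_def
  proof (intro CollectI conjI ballI)
    show "G.gmonom t w \<in> carrier G.B" using G.monom_closed t assms by auto
    fix u assume u: "u \<in> carrier W"
    show "G.gmonom t w u \<in> \<T> (d \<otimes>\<^bsub>C\<^esub> \<nu> w \<otimes>\<^bsub>C\<^esub> inv\<^bsub>C\<^esub> \<nu> u)"
    proof (cases "u = w")
      case True
      have "d \<otimes>\<^bsub>C\<^esub> \<nu> w \<otimes>\<^bsub>C\<^esub> inv\<^bsub>C\<^esub> \<nu> w = d" using assms nu_closed by (simp add: C.m_assoc)
      then show ?thesis using True assms by (simp add: group_algebra_monom_def)
    next
      case False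
      have "\<zero>\<^bsub>T\<^esub> \<in> \<T> (d \<otimes>\<^bsub>C\<^esub> \<nu> w \<otimes>\<^bsub>C\<^esub> inv\<^bsub>C\<^esub> \<nu> u)"
        using subgroup.one_closed[OF T_comp_subgroup] dw u nu_closed by force
      then show ?thesis using False u by (simp add: group_algebra_monom_def)
    qed
  qed
  then have "\<pi> (G.gmonom t w) \<in> \<A> (d \<otimes>\<^bsub>C\<^esub> \<nu> w)"
    using pi dw unfolding graded_algebra_hom_def by blast
  moreover have "\<iota> t \<otimes>\<^bsub>A\<^esub> unit_of w = \<pi> (G.gmonom t w)"
    unfolding iota_eq unit_of_def using t assms(3)
    by (simp add: ring_hom_mult[OF pi_hom, symmetric] G.monom_closed G.monom_mult)
  ultimately show ?thesis by simp
qed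

lemma psi_closed: "r \<in> carrier R \<Longrightarrow> \<psi> r \<in> carrier A"
  using ring_hom_closed[OF gA.structure_hom] .

abbreviation "RM \<equiv> restrict_scalars \<psi> M"

lemma module_restrict_scalars: "module R RM"
proof (rule moduleI)
  show "cring R" by (rule R.is_cring)
  show "abelian_group RM"
    using gM.M.abelian_group_axioms
    by (intro abelian_groupI) (auto simp: gM.M.a_ac intro: gM.M.l_neg gM.M.add.l_inv_ex)
qed (use psi_closed ring_hom_add[OF gA.structure_hom] ring_hom_mult[OF gA.structure_hom]
      ring_hom_one[OF gA.structure_hom] in
    \<open>simp_all add: gM.smult_closed gM.smult_l_distr gM.smult_r_distr gM.smult_assoc gM.smult_one\<close>)

sublocale RM: module R RM by (rule module_restrict_scalars)

text \<open>
  \<open>M\<close> is finitely generated over \<open>R\<close>: the products of generators of \<open>A\<close> over \<open>R\<close> and of \<open>M\<close> over \<open>A\<close>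
  generate it.
\<close>

lemma exists_generators:
  "\<exists>S\<subseteq>carrier M. finite S \<and> (\<forall>F. submodule F R RM \<longrightarrow> S \<subseteq> F \<longrightarrow> F = carrier M)"
proof -
  obtain SA where SA: "SA \<subseteq> carrier A" "finite SA"
    "\<And>F. subgroup F (add_monoid A) \<Longrightarrow> \<forall>r\<in>carrier R. \<forall>b\<in>SA. \<psi> r \<otimes>\<^bsub>A\<^esub> b \<in> F \<Longrightarrow> F = carrier A"
  proof -
    have ab: "abelian_group (algebra_module A \<psi>)"
      by (intro abelian_groupI) (auto simp: algebra_module_def gA.B.a_ac intro: gA.B.add.l_inv_ex)
    have sub: "subgroup F (add_monoid (algebra_module A \<psi>)) \<longleftrightarrow> subgroup F (add_monoid A)" for F
      unfolding subgroup_def m_inv_def by (simp add: algebra_module_def)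
    show thesis
      using fg_module_generates[OF ab fg] that
      unfolding sub by (auto simp: algebra_module_def)
  qed
  obtain SM where SM: "SM \<subseteq> carrier M" "finite SM"
    "\<And>F. subgroup F (add_monoid M) \<Longrightarrow> \<forall>a\<in>carrier A. \<forall>x\<in>SM. a \<odot>\<^bsub>M\<^esub> x \<in> F \<Longrightarrow> F = carrier M"
    using fg_module_generates[OF gM.M.abelian_group_axioms gM.finitely_generated] by blast
  let ?S = "(\<lambda>(a, x). a \<odot>\<^bsub>M\<^esub> x) ` (SA \<times> SM)"
  have "F = carrier M" if F: "submodule F R RM" "?S \<subseteq> F" for F
  proof (rule SM(3))
    note FE = RM.submoduleE[OF F(1)]
    show FM: "subgroup F (add_monoid M)" using submodule.axioms(1)[OF F(1)] by (simp only: subgroup_restrict_scalars)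
    have F0: "\<zero>\<^bsub>M\<^esub> \<in> F" using subgroup.one_closed[OF FM] by simp
    have "{a \<in> carrier A. a \<odot>\<^bsub>M\<^esub> x \<in> F} = carrier A" (is "?G = _") if x: "x \<in> SM" for x
    proof (rule SA(3))
      have xM: "x \<in> carrier M" using x SM by auto
      show "subgroup ?G (add_monoid A)"
      proof (rule gA.B.add.subgroupI)
        have "\<zero>\<^bsub>A\<^esub> \<in> ?G" using F0 xM gM.smult_l_zero by simp
        then show "?G \<noteq> {}" by blast
        fix a assume a: "a \<in> ?G"
        have "\<zero>\<^bsub>M\<^esub> = (\<ominus>\<^bsub>A\<^esub> a \<oplus>\<^bsub>A\<^esub> a) \<odot>\<^bsub>M\<^esub> x" using a xM gM.smult_l_zero by (simp add: gA.B.l_neg)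
        also have "\<dots> = (\<ominus>\<^bsub>A\<^esub> a) \<odot>\<^bsub>M\<^esub> x \<oplus>\<^bsub>M\<^esub> a \<odot>\<^bsub>M\<^esub> x" using a xM by (intro gM.smult_l_distr) auto
        finally have "(\<ominus>\<^bsub>A\<^esub> a) \<odot>\<^bsub>M\<^esub> x = \<ominus>\<^bsub>M\<^esub> (a \<odot>\<^bsub>M\<^esub> x)"
          using a xM by (intro gM.M.minus_equality[symmetric]) (auto simp: gM.smult_closed)
        then show "\<ominus>\<^bsub>A\<^esub> a \<in> ?G" using a FE(3) by simp
        fix b assume "b \<in> ?G"
        then show "a \<oplus>\<^bsub>A\<^esub> b \<in> ?G" using a xM FE(5) by (simp add: gM.smult_l_distr)
      qed auto
      show "\<forall>r\<in>carrier R. \<forall>b\<in>SA. \<psi> r \<otimes>\<^bsub>A\<^esub> b \<in> ?G"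
      proof (intro ballI)
        fix r b assume r: "r \<in> carrier R" and b: "b \<in> SA"
        have "b \<odot>\<^bsub>M\<^esub> x \<in> F" using F(2) b x by auto
        moreover have bA: "b \<in> carrier A" using b SA by auto
        ultimately show "\<psi> r \<otimes>\<^bsub>A\<^esub> b \<in> ?G"
          using FE(4)[OF r] psi_closed[OF r] xM by (simp add: gM.smult_assoc)
      qed
    qed
    then show "\<forall>a\<in>carrier A. \<forall>x\<in>SM. a \<odot>\<^bsub>M\<^esub> x \<in> F" by blast
  qed
  moreover have "?S \<subseteq> carrier M" using subsetD[OF SA(1)] subsetD[OF SM(1)] gM.smult_closed by auto
  moreover have "finite ?S" using SA SM by simp
  ultimately show ?thesis by blast
qed


context
  fixes \<pp> assumes max: "maximalideal \<pp> R"
begin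

interpretation red: reduction R RM \<pp>
  by (intro reduction.intro RM.module_axioms maximalideal.axioms(1)[OF max])

text \<open>
  \<open>R/\<pp> \<otimes> M\<close> as a module over the whole of \<open>A\<close>, and over \<open>T\<close>.
\<close>

abbreviation "FA \<equiv> tensor_module R (quotient_module R \<pp>) RM (smult M)"
abbreviation "FT \<equiv> reduction_module R \<pp> \<psi> \<iota> M"
abbreviation "reduce \<equiv> red.reduce"

lemma FA_simps [simp]:
  "carrier FA = carrier (tensor_group R (quotient_module R \<pp>) RM)"
  "\<zero>\<^bsub>FA\<^esub> = red.rels"
  "x \<oplus>\<^bsub>FA\<^esub> y = x \<otimes>\<^bsub>tensor_group R (quotient_module R \<pp>) RM\<^esub> y"
  by (simp_all add: tensor_module_def red.tensor_group_one)

lemma FT_simps [simp]: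
  "carrier FT = carrier FA" "\<zero>\<^bsub>FT\<^esub> = \<zero>\<^bsub>FA\<^esub>" "x \<oplus>\<^bsub>FT\<^esub> y = x \<oplus>\<^bsub>FA\<^esub> y"
  "t \<odot>\<^bsub>FT\<^esub> x = \<iota> t \<odot>\<^bsub>FA\<^esub> x"
  by (simp_all add: reduction_module_def tensor_module_def restrict_scalars_def)

lemma reduce_closed: "x \<in> carrier M \<Longrightarrow> reduce x \<in> carrier FA"
  using red.reduce_closed by simp

lemma reduce_surj: "v \<in> carrier FA \<Longrightarrow> \<exists>x\<in>carrier M. v = reduce x"
  using red.reduce_surj by simp

lemma reduce_add: "\<lbrakk>x \<in> carrier M; y \<in> carrier M\<rbrakk> \<Longrightarrow> reduce (x \<oplus>\<^bsub>M\<^esub> y) = reduce x \<oplus>\<^bsub>FA\<^esub> reduce y"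
  using red.reduce_add[of x y] by simp

lemma reduce_zero: "reduce \<zero>\<^bsub>M\<^esub> = \<zero>\<^bsub>FA\<^esub>"
  using red.reduce_zero by simp

lemma reduce_smult:
  assumes a: "a \<in> carrier A" and x: "x \<in> carrier M"
  shows "a \<odot>\<^bsub>FA\<^esub> reduce x = reduce (a \<odot>\<^bsub>M\<^esub> x)"
proof -
  have "tensor_map R (quotient_module R \<pp>) RM (\<lambda>x. a \<odot>\<^bsub>M\<^esub> x) (reduce x) = reduce (a \<odot>\<^bsub>M\<^esub> x)"
  proof (rule red.tensor_map_reduce)
    fix r y assume r: "r \<in> carrier R" and y: "y \<in> carrier RM"
    have "a \<odot>\<^bsub>M\<^esub> (\<psi> r \<odot>\<^bsub>M\<^esub> y) = (a \<otimes>\<^bsub>A\<^esub> \<psi> r) \<odot>\<^bsub>M\<^esub> y"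
      using a r y psi_closed by (simp add: gM.smult_assoc)
    also have "\<dots> = (\<psi> r \<otimes>\<^bsub>A\<^esub> a) \<odot>\<^bsub>M\<^esub> y" using gA.structure_central[OF r a] by simp
    also have "\<dots> = \<psi> r \<odot>\<^bsub>M\<^esub> (a \<odot>\<^bsub>M\<^esub> y)" using a r y psi_closed by (simp add: gM.smult_assoc)
    finally show "a \<odot>\<^bsub>M\<^esub> (r \<odot>\<^bsub>RM\<^esub> y) = r \<odot>\<^bsub>RM\<^esub> (a \<odot>\<^bsub>M\<^esub> y)" by simp
  qed (use a x gM.smult_closed gM.smult_r_distr in auto)
  then show ?thesis by (simp add: tensor_module_def)
qed

lemma FA_left_module: "left_module A FA"
proof -
  interpret Tg: comm_group "tensor_group R (quotient_module R \<pp>) RM" by (rule red.tensor_group_comm)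
  have ab: "abelian_group FA"
  proof (rule abelian_groupI)
    show "\<zero>\<^bsub>FA\<^esub> \<in> carrier FA" using Tg.one_closed by (simp add: red.tensor_group_one)
    fix x assume "x \<in> carrier FA"
    then show "\<zero>\<^bsub>FA\<^esub> \<oplus>\<^bsub>FA\<^esub> x = x" using Tg.l_one[of x] by (simp add: red.tensor_group_one)
    show "\<exists>y\<in>carrier FA. y \<oplus>\<^bsub>FA\<^esub> x = \<zero>\<^bsub>FA\<^esub>"
      using Tg.l_inv_ex[of x] \<open>x \<in> carrier FA\<close> by (simp add: red.tensor_group_one)
  qed (simp, simp add: Tg.m_assoc, simp add: Tg.m_comm)
  show ?thesis
  proof (intro left_module.intro left_module_axioms.intro ab)
    show "ring A" by (rule gA.B.ring_axioms)
  next
    fix a v assume "a \<in> carrier A" "v \<in> carrier FA"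
    then show "a \<odot>\<^bsub>FA\<^esub> v \<in> carrier FA"
      using reduce_surj[of v] reduce_smult reduce_closed gM.smult_closed by metis
  next
    fix a b v assume ab: "a \<in> carrier A" "b \<in> carrier A" "v \<in> carrier FA"
    then obtain x where x: "x \<in> carrier M" "v = reduce x" using reduce_surj by blast
    show "(a \<oplus>\<^bsub>A\<^esub> b) \<odot>\<^bsub>FA\<^esub> v = a \<odot>\<^bsub>FA\<^esub> v \<oplus>\<^bsub>FA\<^esub> b \<odot>\<^bsub>FA\<^esub> v"
      unfolding x(2) using ab x(1) gM.smult_closed
      by (simp only: reduce_smult gM.smult_l_distr reduce_add[symmetric] gA.B.add.m_closed)
    show "(a \<otimes>\<^bsub>A\<^esub> b) \<odot>\<^bsub>FA\<^esub> v = a \<odot>\<^bsub>FA\<^esub> (b \<odot>\<^bsub>FA\<^esub> v)"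
      unfolding x(2) using ab x(1) gM.smult_closed
      by (simp only: reduce_smult gM.smult_assoc gA.B.m_closed)
  next
    fix a v w assume a: "a \<in> carrier A" "v \<in> carrier FA" "w \<in> carrier FA"
    then obtain x y where x: "x \<in> carrier M" "v = reduce x" "y \<in> carrier M" "w = reduce y"
      using reduce_surj by blast
    show "a \<odot>\<^bsub>FA\<^esub> (v \<oplus>\<^bsub>FA\<^esub> w) = a \<odot>\<^bsub>FA\<^esub> v \<oplus>\<^bsub>FA\<^esub> a \<odot>\<^bsub>FA\<^esub> w"
      unfolding x(2,4) using a(1) x(1,3) gM.smult_closed
      by (simp only: reduce_smult gM.smult_r_distr reduce_add[symmetric] gM.M.add.m_closed)
  next
    fix v assume "v \<in> carrier FA"
    then obtain x where x: "x \<in> carrier M" "v = reduce x" using reduce_surj by blast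
    show "\<one>\<^bsub>A\<^esub> \<odot>\<^bsub>FA\<^esub> v = v"
      unfolding x(2) using x(1) by (simp only: reduce_smult gM.smult_one gA.B.one_closed)
  qed
qed

interpretation FA: left_module A FA by (rule FA_left_module)

lemma FT_module: "module T FT"
proof (rule moduleI)
  show "cring T" by (rule T.is_cring)
  show "abelian_group FT"
    by (rule abelian_groupI)
      (use FA.M.add.m_closed FA.M.zero_closed FA.M.a_assoc FA.M.a_comm FA.M.l_zero FA.M.add.l_inv_ex
        in \<open>simp_all only: FT_simps\<close>)
qed (use iota_closed iota_add iota_mult iota_one FA.smult_closed FA.smult_l_distr FA.smult_r_distr
      FA.smult_assoc FA.smult_one in \<open>simp_all only: FT_simps\<close>)

text \<open>
  The generators of the fibre are the classes \<open>1 \<otimes> x\<close> of generators \<open>x\<close> of \<open>M\<close> over \<open>R\<close>.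
\<close>

lemma FT_graded_fibre:
  "\<exists>S. graded_fibre C R T \<phi> \<T> FT \<pp> S"
proof -
  interpret FT: module T FT by (rule FT_module)
  obtain S where S: "S \<subseteq> carrier M" "finite S" "\<And>F. submodule F R RM \<Longrightarrow> S \<subseteq> F \<Longrightarrow> F = carrier M"
    using exists_generators by blast
  let ?V = "restrict_scalars \<phi> FT"
  have phi: "\<phi> r \<in> carrier T" if "r \<in> carrier R" for r
    using ring_hom_closed[OF gT.structure_hom that] .
  have V_smult: "r \<odot>\<^bsub>?V\<^esub> v = \<psi> r \<odot>\<^bsub>FA\<^esub> v" if "r \<in> carrier R" for r v
    using iota_phi[OF that] by simp
  have "module R ?V"
  proof (rule moduleI)
    show "cring R" by (rule R.is_cring)
    show "abelian_group ?V"
      by (rule abelian_groupI)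
        (use FT.M.add.m_closed FT.M.zero_closed FT.M.a_assoc FT.M.a_comm FT.M.l_zero FT.M.add.l_inv_ex
          in \<open>simp_all only: restrict_scalars_simps\<close>)
  qed (use phi ring_hom_add[OF gT.structure_hom] ring_hom_mult[OF gT.structure_hom]
      ring_hom_one[OF gT.structure_hom] FT.smult_closed FT.smult_l_distr FT.smult_r_distr
      FT.smult_assoc1 FT.smult_one in \<open>simp_all only: restrict_scalars_simps\<close>)
  then interpret V: module R ?V .
  have "residue_space R ?V \<pp> (reduce ` S)"
  proof (intro residue_space.intro residue_space_axioms.intro V.module_axioms max)
    fix r v assume r: "r \<in> \<pp>" and "v \<in> carrier ?V"
    then obtain x where x: "x \<in> carrier M" "v = reduce x" using reduce_surj[of v] by auto
    have rR: "r \<in> carrier R" using r red.a_subset by auto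
    have "\<psi> r \<odot>\<^bsub>FA\<^esub> v = \<zero>\<^bsub>FA\<^esub>"
      unfolding x(2) using reduce_smult[OF psi_closed[OF rR] x(1)] red.reduce_annihilated[OF r, of x] x(1)
      by simp
    then show "r \<odot>\<^bsub>?V\<^esub> v = \<zero>\<^bsub>?V\<^esub>" using V_smult[OF rR] by simp
  next
    show "finite (reduce ` S)" using S by simp
    show "reduce ` S \<subseteq> carrier ?V" using S(1) reduce_closed by auto
    fix F assume F: "submodule F R ?V" "reduce ` S \<subseteq> F"
    note FE = V.submoduleE[OF F(1)]
    have "{x \<in> carrier M. reduce x \<in> F} = carrier M" (is "?G = _")
    proof (rule S(3))
      show "S \<subseteq> ?G" using S(1) F(2) by auto
      have radd: "reduce x \<oplus>\<^bsub>?V\<^esub> reduce y = reduce (x \<oplus>\<^bsub>M\<^esub> y)" if "x \<in> carrier M" "y \<in> carrier M" for x y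
        using reduce_add[OF that] by simp
      have rsmult: "r \<odot>\<^bsub>?V\<^esub> reduce x = reduce (\<psi> r \<odot>\<^bsub>M\<^esub> x)" if "r \<in> carrier R" "x \<in> carrier M" for r x
        using V_smult[OF that(1)] reduce_smult[OF psi_closed[OF that(1)] that(2)] by simp
      show "submodule ?G R RM"
      proof (rule RM.submoduleI)
        show "?G \<subseteq> carrier RM" by auto
        have F0: "\<zero>\<^bsub>?V\<^esub> \<in> F" using subgroup.one_closed[OF submodule.axioms(1)[OF F(1)]] by simp
        then show "\<zero>\<^bsub>RM\<^esub> \<in> ?G" using reduce_zero by simp
        fix x assume x: "x \<in> ?G"
        { fix y assume y: "y \<in> ?G"
          have "reduce x \<oplus>\<^bsub>?V\<^esub> reduce y \<in> F" using FE(5) x y by blast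
          then show "x \<oplus>\<^bsub>RM\<^esub> y \<in> ?G" using x y radd by simp }
        { fix r assume r: "r \<in> carrier R"
          have "r \<odot>\<^bsub>?V\<^esub> reduce x \<in> F" using FE(4) r x by blast
          then have "reduce (\<psi> r \<odot>\<^bsub>M\<^esub> x) \<in> F" using rsmult[OF r] x by simp
          then show "r \<odot>\<^bsub>RM\<^esub> x \<in> ?G" using x gM.smult_closed[OF psi_closed[OF r]] by simp }
        note sm = this
        have "\<ominus>\<^bsub>RM\<^esub> x = (\<ominus>\<^bsub>R\<^esub> \<one>\<^bsub>R\<^esub>) \<odot>\<^bsub>RM\<^esub> x" using x RM.smult_l_minus[of "\<one>\<^bsub>R\<^esub>" x] RM.smult_one[of x] by simp
        then show "\<ominus>\<^bsub>RM\<^esub> x \<in> ?G" using sm[of "\<ominus>\<^bsub>R\<^esub> \<one>\<^bsub>R\<^esub>"] by simp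
      qed
    qed
    then have "carrier FA \<subseteq> F" using reduce_surj by blast
    then show "F = carrier ?V" using FE(1) by auto
  qed
  then have "graded_fibre C R T \<phi> \<T> FT \<pp> (reduce ` S)"
    by (intro graded_fibre.intro graded_fibre_axioms.intro FT.module_axioms gT.graded_algebra_axioms
        C.comm_group_axioms finite_C)
  then show ?thesis by blast
qed

end

end

context graded_setup
begin

text \<open>
  The annihilators in the degree-one part of \<open>T\<close> of the simple \<open>T\<close>-submodules of \<open>R/\<pp> \<otimes> M\<close>.
\<close>

definition vertices :: "'r set \<Rightarrow> 't set set"
  where "vertices \<pp> = {graded_fibre.vertex C \<T> (FT \<pp>) E | E. simple_submodule E T (FT \<pp>)}"

lemma finite_vertices:
  assumes "maximalideal \<pp> R" shows "finite (vertices \<pp>)"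
proof -
  obtain S where "graded_fibre C R T \<phi> \<T> (FT \<pp>) \<pp> S" using FT_graded_fibre[OF assms] by blast
  then show ?thesis unfolding vertices_def by (rule graded_fibre.finite_vertices)
qed

lemma vertices_field_kernel:
  assumes "maximalideal \<pp> R" "q \<in> vertices \<pp>"
  shows "field_kernel T (\<T> \<one>\<^bsub>C\<^esub>) q"
proof -
  obtain S where "graded_fibre C R T \<phi> \<T> (FT \<pp>) \<pp> S" using FT_graded_fibre[OF assms(1)] by blast
  then show ?thesis using assms(2) graded_fibre.vertex_field_kernel unfolding vertices_def by blast
qed

text \<open>
  The condition on characters enters here: \<open>A\<^sub>c\<close> contains the image of a monomial \<open>t w\<close> whose coefficient
  does not annihilate the simple module with annihilator \<open>q\<close>.  That is stated through \<open>t ^ |C|\<close>, which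
  has degree one, so that it depends on \<open>q\<close> only.
\<close>

lemma exists_monomial_outside_vertex:
  assumes c: "c \<in> carrier C"
    and chars: "\<And>\<pp> E \<chi>.
           \<lbrakk>maximalideal \<pp> R; simple_submodule E T (FT \<pp>);
            \<chi> \<in> hom (C Mod \<nu> ` carrier W) complex_units;
            \<chi> (\<nu> ` carrier W #>\<^bsub>C\<^esub> c) \<noteq> 1\<rbrakk> \<Longrightarrow>
           \<exists>d \<in> carrier C. \<chi> (\<nu> ` carrier W #>\<^bsub>C\<^esub> d) \<noteq> 1 \<and>
             (\<exists>t \<in> \<T> d. \<exists>e \<in> E. t \<odot>\<^bsub>FT \<pp>\<^esub> e \<noteq> \<zero>\<^bsub>FT \<pp>\<^esub>)"
    and p: "maximalideal \<pp> R" and q: "q \<in> vertices \<pp>"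
  shows "\<exists>d\<in>carrier C. \<exists>t\<in>\<T> d. \<exists>w\<in>carrier W. c = d \<otimes>\<^bsub>C\<^esub> \<nu> w \<and> t [^]\<^bsub>T\<^esub> order C \<notin> q"
proof -
  obtain S where "graded_fibre C R T \<phi> \<T> (FT \<pp>) \<pp> S" using FT_graded_fibre[OF p] by blast
  then interpret F: graded_fibre C R T \<phi> \<T> "FT \<pp>" \<pp> S .
  obtain E where E: "simple_submodule E T (FT \<pp>)" "q = F.vertex E" using q unfolding vertices_def by auto
  interpret nu: group_hom W C \<nu> by unfold_locales (rule nu)
  \<comment> \<open>The degrees of the homogeneous elements that do not annihilate \<open>E\<close>.\<close>
  define D where "D = {d \<in> carrier C. \<exists>t\<in>\<T> d. \<not> F.kills t E}"
  have "\<exists>n\<in>\<nu> ` carrier W. \<exists>d\<in>D. c = n \<otimes>\<^bsub>C\<^esub> d"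
  proof (rule C.factor_of_characters[OF finite_C nu.img_is_subgroup _ _ _ c])
    show "D \<subseteq> carrier C" unfolding D_def by auto
    show "D \<noteq> {}" using F.exists_homogeneous[OF E(1)] unfolding D_def by auto
    show "x \<otimes>\<^bsub>C\<^esub> y \<in> D" if "x \<in> D" "y \<in> D" for x y
      using that F.degrees_mult_closed[OF E(1)] unfolding D_def by auto
    fix \<chi> assume chi: "\<chi> \<in> hom (C Mod \<nu> ` carrier W) complex_units" "\<chi> (\<nu> ` carrier W #>\<^bsub>C\<^esub> c) \<noteq> 1"
    obtain d t e where d: "d \<in> carrier C" "\<chi> (\<nu> ` carrier W #>\<^bsub>C\<^esub> d) \<noteq> 1" "t \<in> \<T> d" "e \<in> E"
      "t \<odot>\<^bsub>FT \<pp>\<^esub> e \<noteq> \<zero>\<^bsub>FT \<pp>\<^esub>"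
      using chars[OF p E(1) chi] by blast
    then have "d \<in> D" unfolding D_def F.kills_def by blast
    then show "\<exists>d\<in>D. \<chi> (\<nu> ` carrier W #>\<^bsub>C\<^esub> d) \<noteq> 1" using d(2) by blast
  qed
  then obtain w d t where w: "w \<in> carrier W" "d \<in> carrier C" "t \<in> \<T> d" "\<not> F.kills t E" "c = \<nu> w \<otimes>\<^bsub>C\<^esub> d"
    unfolding D_def by auto
  have "c = d \<otimes>\<^bsub>C\<^esub> \<nu> w" using w nu_closed C.m_comm by simp
  moreover have "t [^]\<^bsub>T\<^esub> order C \<notin> q"
    using F.kills_pow_order[OF E(1) T_comp_carrier[OF w(2,3)]] w(4) by (simp add: E(2) F.vertex_def)
  ultimately show ?thesis using w by blast
qed

text \<open>
  On a simple \<open>T\<close>-submodule with annihilator \<open>q\<close> in degree one, all summands of \<open>a\<close> except the one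
  indexed by \<open>q\<close> vanish, and that one is injective.  So the kernel of \<open>a\<close> has no simple submodule and
  is zero; surjectivity follows since the fibre is finite-dimensional.
\<close>

lemma sum_surj_on_fibre:
  assumes p: "maximalideal \<pp> R"
    and Q: "finite Q" "vertices \<pp> \<subseteq> Q"
    and s: "\<And>q. q \<in> Q \<Longrightarrow> s q \<in> \<T> \<one>\<^bsub>C\<^esub>" "\<And>q. q \<in> Q \<Longrightarrow> s q \<notin> q"
      "\<And>q q'. q \<in> Q \<Longrightarrow> q' \<in> Q - {q} \<Longrightarrow> s q \<in> q'"
    and t: "\<And>q. q \<in> Q \<Longrightarrow> d q \<in> carrier C" "\<And>q. q \<in> Q \<Longrightarrow> t q \<in> \<T> (d q)"
      "\<And>q. q \<in> Q \<Longrightarrow> t q [^]\<^bsub>T\<^esub> order C \<notin> q"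
    and w: "\<And>q. q \<in> Q \<Longrightarrow> w q \<in> carrier W"
    and a: "a = (\<Oplus>\<^bsub>A\<^esub>q\<in>Q. \<iota> (s q \<otimes>\<^bsub>T\<^esub> t q) \<otimes>\<^bsub>A\<^esub> unit_of (w q))"
  shows "(\<lambda>v. a \<odot>\<^bsub>FA \<pp>\<^esub> v) ` carrier (FA \<pp>) = carrier (FA \<pp>)"
proof -
  obtain S where "graded_fibre C R T \<phi> \<T> (FT \<pp>) \<pp> S" using FT_graded_fibre[OF p] by blast
  then interpret F: graded_fibre C R T \<phi> \<T> "FT \<pp>" \<pp> S .
  interpret FA: left_module A "FA \<pp>" by (rule FA_left_module[OF p])
  note [simp] = FT_simps[OF p]
  note [simp del] = FA_simps
  have sT: "s q \<in> carrier T" and tT: "t q \<in> carrier T" if "q \<in> Q" for q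
    using that s(1) t(1,2) T_comp_carrier C.one_closed by blast+
  let ?b = "\<lambda>q. \<iota> (s q \<otimes>\<^bsub>T\<^esub> t q) \<otimes>\<^bsub>A\<^esub> unit_of (w q)"
  have bA: "?b \<in> Q \<rightarrow> carrier A"
    using sT tT w iota_closed unit_of_closed by (intro Pi_I gA.B.m_closed) (auto simp del: comp_apply)
  have aA: "a \<in> carrier A" unfolding a using bA by (rule gA.B.finsum_closed)
  \<comment> \<open>\<open>T\<close> acts on the fibre through central elements of \<open>A\<close>.\<close>
  have comm: "a \<odot>\<^bsub>FA \<pp>\<^esub> (x \<odot>\<^bsub>FT \<pp>\<^esub> v) = x \<odot>\<^bsub>FT \<pp>\<^esub> (a \<odot>\<^bsub>FA \<pp>\<^esub> v)"
    if "x \<in> carrier T" "v \<in> carrier (FA \<pp>)" "a \<in> carrier A" for a x v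
    using that iota_closed[OF that(1)] iota_central[OF that(1,3)]
    by (simp add: FA.smult_assoc[symmetric] del: comp_apply)
  let ?K = "{v \<in> carrier (FA \<pp>). a \<odot>\<^bsub>FA \<pp>\<^esub> v = \<zero>\<^bsub>FA \<pp>\<^esub>}"
  have K: "submodule ?K T (FT \<pp>)"
  proof (rule F.V.submoduleI)
    show "?K \<subseteq> carrier (FT \<pp>)" by auto
    show "\<zero>\<^bsub>FT \<pp>\<^esub> \<in> ?K" using FA.smult_r_zero[OF aA] by simp
    fix v assume v: "v \<in> ?K"
    have tv: "x \<odot>\<^bsub>FT \<pp>\<^esub> v \<in> ?K" if x: "x \<in> carrier T" for x
    proof -
      have "a \<odot>\<^bsub>FA \<pp>\<^esub> (x \<odot>\<^bsub>FT \<pp>\<^esub> v) = x \<odot>\<^bsub>FT \<pp>\<^esub> \<zero>\<^bsub>FA \<pp>\<^esub>" using comm[OF x _ aA, of v] v by simp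
      also have "\<dots> = \<zero>\<^bsub>FA \<pp>\<^esub>" using F.V.smult_r_null[OF x] by simp
      finally show ?thesis using F.V.smult_closed[OF x, of v] v by simp
    qed
    then show "x \<odot>\<^bsub>FT \<pp>\<^esub> v \<in> ?K" if "x \<in> carrier T" for x using that .
    have "\<ominus>\<^bsub>FT \<pp>\<^esub> v = (\<ominus>\<^bsub>T\<^esub> \<one>\<^bsub>T\<^esub>) \<odot>\<^bsub>FT \<pp>\<^esub> v"
      using v F.V.smult_l_minus[of "\<one>\<^bsub>T\<^esub>" v] F.V.smult_one[of v] by simp
    then show "\<ominus>\<^bsub>FT \<pp>\<^esub> v \<in> ?K" using tv[of "\<ominus>\<^bsub>T\<^esub> \<one>\<^bsub>T\<^esub>"] by simp
    show "v \<oplus>\<^bsub>FT \<pp>\<^esub> u \<in> ?K" if "u \<in> ?K" for u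
      using v that aA by (simp add: FA.smult_r_distr)
  qed
  have "?K = {\<zero>\<^bsub>FT \<pp>\<^esub>}"
  proof (rule ccontr)
    assume "?K \<noteq> {\<zero>\<^bsub>FT \<pp>\<^esub>}"
    then obtain E where E: "simple_submodule E T (FT \<pp>)" "E \<subseteq> ?K"
      using F.exists_simple_submodule[OF K] by blast
    define q where "q = F.vertex E"
    have q: "q \<in> Q" using Q(2) E(1) unfolding vertices_def q_def by blast
    obtain e where e: "e \<in> E" "e \<noteq> \<zero>\<^bsub>FT \<pp>\<^esub>" using F.simple_nonzero[OF E(1)] by blast
    have eV: "e \<in> carrier (FA \<pp>)" and ae: "a \<odot>\<^bsub>FA \<pp>\<^esub> e = \<zero>\<^bsub>FA \<pp>\<^esub>" using E(2) e(1) by auto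
    have b_act: "?b q' \<odot>\<^bsub>FA \<pp>\<^esub> e = unit_of (w q') \<odot>\<^bsub>FA \<pp>\<^esub> ((s q' \<otimes>\<^bsub>T\<^esub> t q') \<odot>\<^bsub>FT \<pp>\<^esub> e)" if q': "q' \<in> Q" for q'
    proof -
      have st: "s q' \<otimes>\<^bsub>T\<^esub> t q' \<in> carrier T" using sT tT q' by simp
      have "?b q' \<odot>\<^bsub>FA \<pp>\<^esub> e = (s q' \<otimes>\<^bsub>T\<^esub> t q') \<odot>\<^bsub>FT \<pp>\<^esub> (unit_of (w q') \<odot>\<^bsub>FA \<pp>\<^esub> e)"
        using FA.smult_assoc[OF iota_closed[OF st] unit_of_closed[OF w[OF q']] eV] by simp
      then show ?thesis using comm[OF st eV unit_of_closed[OF w[OF q']]] by simp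
    qed
    have "?b q' \<odot>\<^bsub>FA \<pp>\<^esub> e = \<zero>\<^bsub>FA \<pp>\<^esub>" if q': "q' \<in> Q - {q}" for q'
    proof -
      have "s q' \<in> q" using s(3)[of q' q] q q' by auto
      then have se: "s q' \<odot>\<^bsub>FT \<pp>\<^esub> e = \<zero>\<^bsub>FT \<pp>\<^esub>" using e(1) unfolding q_def F.vertex_def F.kills_def by blast
      have c: "s q' \<in> carrier T" "t q' \<in> carrier T" using sT tT q' by auto
      have "(s q' \<otimes>\<^bsub>T\<^esub> t q') \<odot>\<^bsub>FT \<pp>\<^esub> e = t q' \<odot>\<^bsub>FT \<pp>\<^esub> (s q' \<odot>\<^bsub>FT \<pp>\<^esub> e)"
        using F.V.smult_assoc1[OF c(2,1), of e] eV T.m_comm[OF c] by simp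
      also have "\<dots> = \<zero>\<^bsub>FT \<pp>\<^esub>" unfolding se using c(2) by (rule F.V.smult_r_null)
      finally show ?thesis
        using b_act[of q'] q' FA.smult_r_zero[OF unit_of_closed[OF w[of q']]] by simp
    qed
    then have "a \<odot>\<^bsub>FA \<pp>\<^esub> e = ?b q \<odot>\<^bsub>FA \<pp>\<^esub> e"
      unfolding a by (rule FA.finsum_smult_singleton[OF Q(1) q bA eV])
    then have ue: "unit_of (w q) \<odot>\<^bsub>FA \<pp>\<^esub> ((s q \<otimes>\<^bsub>T\<^esub> t q) \<odot>\<^bsub>FT \<pp>\<^esub> e) = \<zero>\<^bsub>FA \<pp>\<^esub>"
      using ae b_act[OF q] by simp
    have st: "s q \<otimes>\<^bsub>T\<^esub> t q \<in> carrier T" using sT tT q by simp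
    define e' where "e' = (s q \<otimes>\<^bsub>T\<^esub> t q) \<odot>\<^bsub>FT \<pp>\<^esub> e"
    have e'V: "e' \<in> carrier (FA \<pp>)" using F.V.smult_closed[OF st, of e] eV unfolding e'_def by simp
    have "e' = (unit_of (inv\<^bsub>W\<^esub> (w q)) \<otimes>\<^bsub>A\<^esub> unit_of (w q)) \<odot>\<^bsub>FA \<pp>\<^esub> e'"
      using unit_of_inv[OF w[OF q]] FA.smult_one[OF e'V] by simp
    also have "\<dots> = unit_of (inv\<^bsub>W\<^esub> (w q)) \<odot>\<^bsub>FA \<pp>\<^esub> (unit_of (w q) \<odot>\<^bsub>FA \<pp>\<^esub> e')"
      using w[OF q] e'V unit_of_closed by (intro FA.smult_assoc) auto
    also have "\<dots> = \<zero>\<^bsub>FA \<pp>\<^esub>"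
      using ue w[OF q] FA.smult_r_zero unit_of_closed unfolding e'_def by simp
    finally have "(s q \<otimes>\<^bsub>T\<^esub> t q) \<odot>\<^bsub>FT \<pp>\<^esub> e = \<zero>\<^bsub>FT \<pp>\<^esub>" unfolding e'_def by simp
    then have "F.kills (s q \<otimes>\<^bsub>T\<^esub> t q) E" using F.simple_kills[OF E(1) st e] by blast
    then have "F.kills (s q) E \<or> F.kills (t q) E"
      using F.simple_not_kills_mult[OF E(1) sT[OF q] tT[OF q]] by blast
    then show False
    proof
      assume "F.kills (s q) E"
      then show False using s(1,2)[OF q] by (simp add: q_def F.vertex_def)
    next
      assume "F.kills (t q) E"
      then have "F.kills (t q [^]\<^bsub>T\<^esub> order C) E" using F.kills_pow_order[OF E(1) tT[OF q]] by blast
      then show False using t(3)[OF q] F.pow_order_T1[OF t(1)[OF q] t(2)[OF q]] by (simp add: q_def F.vertex_def)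
    qed
  qed
  then have inj: "v = \<zero>\<^bsub>FA \<pp>\<^esub>" if "v \<in> carrier (FA \<pp>)" "a \<odot>\<^bsub>FA \<pp>\<^esub> v = \<zero>\<^bsub>FA \<pp>\<^esub>" for v
    using that by auto
  show ?thesis
  proof (rule F.RS.inj_imp_surj)
    show "submodule (carrier (FA \<pp>)) R (restrict_scalars \<phi> (FT \<pp>))"
      using F.RS.carrier_is_submodule by simp
    show "(\<lambda>v. a \<odot>\<^bsub>FA \<pp>\<^esub> v) \<in> carrier (FA \<pp>) \<rightarrow> carrier (FA \<pp>)" using FA.smult_closed[OF aA] by blast
    fix v assume v: "v \<in> carrier (FA \<pp>)"
    show "v = \<zero>\<^bsub>restrict_scalars \<phi> (FT \<pp>)\<^esub>" if "a \<odot>\<^bsub>FA \<pp>\<^esub> v = \<zero>\<^bsub>restrict_scalars \<phi> (FT \<pp>)\<^esub>"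
      using inj[OF v] that by simp
    show "a \<odot>\<^bsub>FA \<pp>\<^esub> (v \<oplus>\<^bsub>restrict_scalars \<phi> (FT \<pp>)\<^esub> u)
      = a \<odot>\<^bsub>FA \<pp>\<^esub> v \<oplus>\<^bsub>restrict_scalars \<phi> (FT \<pp>)\<^esub> a \<odot>\<^bsub>FA \<pp>\<^esub> u" if "u \<in> carrier (FA \<pp>)" for u
      using FA.smult_r_distr[OF aA v that] by simp
    show "a \<odot>\<^bsub>FA \<pp>\<^esub> (r \<odot>\<^bsub>restrict_scalars \<phi> (FT \<pp>)\<^esub> v) = r \<odot>\<^bsub>restrict_scalars \<phi> (FT \<pp>)\<^esub> (a \<odot>\<^bsub>FA \<pp>\<^esub> v)"
      if "r \<in> carrier R" for r
      using comm[OF F.phi_carrier[OF that] v aA] by simp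
  qed
qed

text \<open>
  Surjectivity on \<open>R/\<pp> \<otimes> M\<close> means \<open>M = a M + \<pp> M\<close>.
\<close>

lemma bij_of_surj_on_fibres:
  assumes a: "a \<in> carrier A"
    and surj: "\<And>\<pp>. maximalideal \<pp> R \<Longrightarrow> (\<lambda>v. a \<odot>\<^bsub>FA \<pp>\<^esub> v) ` carrier (FA \<pp>) = carrier (FA \<pp>)"
  shows "bij_betw (\<lambda>x. a \<odot>\<^bsub>M\<^esub> x) (carrier M) (carrier M)"
proof -
  obtain S where S: "S \<subseteq> carrier M" "finite S" "\<And>F. submodule F R RM \<Longrightarrow> S \<subseteq> F \<Longrightarrow> F = carrier M"
    using exists_generators by blast
  let ?N = "(\<lambda>x. a \<odot>\<^bsub>M\<^esub> x) ` carrier M"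
  have psi_a: "\<psi> r \<odot>\<^bsub>M\<^esub> (a \<odot>\<^bsub>M\<^esub> x) = a \<odot>\<^bsub>M\<^esub> (\<psi> r \<odot>\<^bsub>M\<^esub> x)" if "r \<in> carrier R" "x \<in> carrier M" for r x
    using gM.smult_assoc[OF psi_closed[OF that(1)] a that(2)] gM.smult_assoc[OF a psi_closed[OF that(1)] that(2)]
      gA.structure_central[OF that(1) a] by simp
  have N: "submodule ?N R RM"
  proof (rule RM.submoduleI)
    show "?N \<subseteq> carrier RM" using gM.smult_closed[OF a] by auto
    have "\<zero>\<^bsub>M\<^esub> = a \<odot>\<^bsub>M\<^esub> \<zero>\<^bsub>M\<^esub>" using gM.smult_r_zero[OF a] by simp
    then show "\<zero>\<^bsub>RM\<^esub> \<in> ?N" by simp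
    fix y assume "y \<in> ?N"
    then obtain x where x: "x \<in> carrier M" "y = a \<odot>\<^bsub>M\<^esub> x" by auto
    have "\<ominus>\<^bsub>M\<^esub> y = a \<odot>\<^bsub>M\<^esub> (\<ominus>\<^bsub>M\<^esub> x)" using gM.smult_r_minus[OF a x(1)] x(2) by simp
    then show "\<ominus>\<^bsub>RM\<^esub> y \<in> ?N" using x(1) by simp
    show "y \<oplus>\<^bsub>RM\<^esub> z \<in> ?N" if z: "z \<in> ?N" for z
    proof -
      obtain x' where x': "x' \<in> carrier M" "z = a \<odot>\<^bsub>M\<^esub> x'" using z by auto
      have "y \<oplus>\<^bsub>M\<^esub> z = a \<odot>\<^bsub>M\<^esub> (x \<oplus>\<^bsub>M\<^esub> x')" using gM.smult_r_distr[OF a x(1) x'(1)] x x' by simp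
      then show ?thesis using x(1) x'(1) by simp
    qed
    show "r \<odot>\<^bsub>RM\<^esub> y \<in> ?N" if "r \<in> carrier R" for r
      using psi_a[OF that x(1)] x gM.smult_closed[OF psi_closed[OF that] x(1)] by simp
  qed
  have "?N = carrier RM"
  proof (rule RM.surj_of_surj_mod_maximal[OF R.noetherian_ring_axioms S(2) _ _ N])
    show "S \<subseteq> carrier RM" using S(1) by simp
    show "F = carrier RM" if "submodule F R RM" "S \<subseteq> F" for F using S(3)[OF that] by simp
    fix \<pp> Q assume p: "maximalideal \<pp> R" and Q: "subgroup Q (add_monoid RM)" "?N \<subseteq> Q"
      and pQ: "\<And>r x. r \<in> \<pp> \<Longrightarrow> x \<in> carrier RM \<Longrightarrow> r \<odot>\<^bsub>RM\<^esub> x \<in> Q"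
    interpret red: reduction R RM \<pp>
      by (intro reduction.intro RM.module_axioms maximalideal.axioms(1)[OF p])
    interpret FA: left_module A "FA \<pp>" by (rule FA_left_module[OF p])
    note [simp del] = FA_simps
    have "x \<in> Q" if x: "x \<in> carrier M" for x
    proof -
      have "red.reduce x \<in> (\<lambda>v. a \<odot>\<^bsub>FA \<pp>\<^esub> v) ` carrier (FA \<pp>)"
        using reduce_closed[OF p x] by (simp only: surj[OF p])
      then obtain v where v: "v \<in> carrier (FA \<pp>)" "red.reduce x = a \<odot>\<^bsub>FA \<pp>\<^esub> v" by auto
      obtain y where y: "y \<in> carrier M" "v = red.reduce y" using reduce_surj[OF p v(1)] by auto
      have ay: "a \<odot>\<^bsub>M\<^esub> y \<in> carrier M" using gM.smult_closed[OF a y(1)] .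
      let ?z = "x \<oplus>\<^bsub>M\<^esub> \<ominus>\<^bsub>M\<^esub> (a \<odot>\<^bsub>M\<^esub> y)"
      have z: "?z \<in> carrier M" using x ay by simp
      have xz: "x = ?z \<oplus>\<^bsub>M\<^esub> a \<odot>\<^bsub>M\<^esub> y" using x ay by (simp add: gM.M.a_assoc gM.M.l_neg)
      have "red.reduce x = red.reduce ?z \<oplus>\<^bsub>FA \<pp>\<^esub> red.reduce (a \<odot>\<^bsub>M\<^esub> y)"
        using reduce_add[OF p z ay] xz by simp
      moreover have "red.reduce x = red.reduce (a \<odot>\<^bsub>M\<^esub> y)"
        using v(2) y reduce_smult[OF p a y(1)] by simp
      ultimately have "red.reduce ?z = \<zero>\<^bsub>FA \<pp>\<^esub>"
        using reduce_closed[OF p z] reduce_closed[OF p ay] by (metis FA.M.add.r_cancel_one')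
      then have "?z \<in> Q"
        using red.reduce_eq_zero_imp_mem[OF Q(1) pQ, of ?z] z by (simp add: FA_simps[OF p])
      moreover have "a \<odot>\<^bsub>M\<^esub> y \<in> Q" using Q(2) y(1) by blast
      ultimately have "?z \<oplus>\<^bsub>M\<^esub> a \<odot>\<^bsub>M\<^esub> y \<in> Q" using subgroup.m_closed[OF Q(1)] by simp
      then show ?thesis using xz by simp
    qed
    then show "Q = carrier RM" using subgroup.subset[OF Q(1)] by auto
  qed
  then have N_eq: "?N = carrier M" by simp
  show ?thesis
  proof (rule gM.smult_surj_imp_bij[OF S(2,1) _ _ _ a N_eq])
    show "\<psi> ` carrier R \<subseteq> carrier A" using psi_closed by auto
    show "z \<otimes>\<^bsub>A\<^esub> b = b \<otimes>\<^bsub>A\<^esub> z" if "z \<in> \<psi> ` carrier R" "b \<in> carrier A" for z b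
      using that gA.structure_central by auto
    fix F assume F: "subgroup F (add_monoid M)" "\<And>z x. z \<in> \<psi> ` carrier R \<Longrightarrow> x \<in> F \<Longrightarrow> z \<odot>\<^bsub>M\<^esub> x \<in> F" "S \<subseteq> F"
    have "subgroup F (add_monoid RM)" using F(1) by (simp only: subgroup_restrict_scalars)
    then have "submodule F R RM" by (rule submodule.intro) (simp add: submodule_axioms_def F(2))
    then show "F = carrier M" using S(3) F(3) by blast
  qed
qed

lemma exists_homogeneous_bij:
  assumes c: "c \<in> carrier C"
    and chars: "\<And>\<pp> E \<chi>.
           \<lbrakk>maximalideal \<pp> R; simple_submodule E T (FT \<pp>);
            \<chi> \<in> hom (C Mod \<nu> ` carrier W) complex_units;
            \<chi> (\<nu> ` carrier W #>\<^bsub>C\<^esub> c) \<noteq> 1\<rbrakk> \<Longrightarrow>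
           \<exists>d \<in> carrier C. \<chi> (\<nu> ` carrier W #>\<^bsub>C\<^esub> d) \<noteq> 1 \<and>
             (\<exists>t \<in> \<T> d. \<exists>e \<in> E. t \<odot>\<^bsub>FT \<pp>\<^esub> e \<noteq> \<zero>\<^bsub>FT \<pp>\<^esub>)"
  shows "\<exists>a \<in> \<A> c. bij_betw (\<lambda>x. a \<odot>\<^bsub>M\<^esub> x) (carrier M) (carrier M)"
proof -
  define Q where "Q = (\<Union>\<pp>\<in>{\<pp>. maximalideal \<pp> R}. vertices \<pp>)"
  have fin: "finite Q"
    unfolding Q_def using semilocal finite_vertices by (auto simp: semilocal_def)
  have Qmem: "\<exists>\<pp>. maximalideal \<pp> R \<and> q \<in> vertices \<pp>" if "q \<in> Q" for q using that unfolding Q_def by auto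
  have kernel: "field_kernel T (\<T> \<one>\<^bsub>C\<^esub>) q" if "q \<in> Q" for q
    using Qmem[OF that] vertices_field_kernel by blast
  have T1: "x \<in> carrier T" if "x \<in> \<T> \<one>\<^bsub>C\<^esub>" for x using that T_comp_carrier C.one_closed by blast
  have "\<forall>q\<in>Q. \<exists>s\<in>\<T> \<one>\<^bsub>C\<^esub>. s \<notin> q \<and> (\<forall>q'\<in>Q - {q}. s \<in> q')"
  proof
    fix q assume q: "q \<in> Q"
    show "\<exists>s\<in>\<T> \<one>\<^bsub>C\<^esub>. s \<notin> q \<and> (\<forall>q'\<in>Q - {q}. s \<in> q')"
    proof (rule field_kernels_separated[OF fin kernel kernel[OF q]])
      fix x y assume xy: "x \<in> \<T> \<one>\<^bsub>C\<^esub>" "y \<in> \<T> \<one>\<^bsub>C\<^esub>"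
      show "x \<otimes>\<^bsub>T\<^esub> y = y \<otimes>\<^bsub>T\<^esub> x" using T.m_comm T1 xy by blast
      show "x \<otimes>\<^bsub>T\<^esub> y \<in> \<T> \<one>\<^bsub>C\<^esub>"
        using gT.component_mult[OF C.one_closed C.one_closed xy] by simp
    qed
  qed
  then obtain s where s: "\<forall>q\<in>Q. s q \<in> \<T> \<one>\<^bsub>C\<^esub> \<and> s q \<notin> q \<and> (\<forall>q'\<in>Q - {q}. s q \<in> q')" by metis
  have "\<forall>q\<in>Q. \<exists>d t w. d \<in> carrier C \<and> t \<in> \<T> d \<and> w \<in> carrier W \<and> c = d \<otimes>\<^bsub>C\<^esub> \<nu> w \<and> t [^]\<^bsub>T\<^esub> order C \<notin> q"
  proof
    fix q assume "q \<in> Q"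
    then obtain \<pp> where "maximalideal \<pp> R" "q \<in> vertices \<pp>" using Qmem by blast
    from exists_monomial_outside_vertex[OF c chars this]
    show "\<exists>d t w. d \<in> carrier C \<and> t \<in> \<T> d \<and> w \<in> carrier W \<and> c = d \<otimes>\<^bsub>C\<^esub> \<nu> w \<and> t [^]\<^bsub>T\<^esub> order C \<notin> q"
      by blast
  qed
  then obtain d t w where t: "\<forall>q\<in>Q. d q \<in> carrier C \<and> t q \<in> \<T> (d q) \<and> w q \<in> carrier W \<and>
      c = d q \<otimes>\<^bsub>C\<^esub> \<nu> (w q) \<and> t q [^]\<^bsub>T\<^esub> order C \<notin> q" by metis
  let ?b = "\<lambda>q. \<iota> (s q \<otimes>\<^bsub>T\<^esub> t q) \<otimes>\<^bsub>A\<^esub> unit_of (w q)"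
  define a where "a = (\<Oplus>\<^bsub>A\<^esub>q\<in>Q. ?b q)"
  have "?b q \<in> \<A> c" if q: "q \<in> Q" for q
  proof -
    have "s q \<otimes>\<^bsub>T\<^esub> t q \<in> \<T> (\<one>\<^bsub>C\<^esub> \<otimes>\<^bsub>C\<^esub> d q)" using s t q by (intro gT.component_mult) auto
    then have "s q \<otimes>\<^bsub>T\<^esub> t q \<in> \<T> (d q)" using t q by simp
    then have "?b q \<in> \<A> (d q \<otimes>\<^bsub>C\<^esub> \<nu> (w q))" using t q iota_unit_of_degree by blast
    then show ?thesis using t q by simp
  qed
  then have ac: "a \<in> \<A> c"
    unfolding a_def
    by (intro finsum_in_subgroup[OF gA.B.abelian_group_axioms A_comp_subgroup[OF c] fin]) blast
  have "bij_betw (\<lambda>x. a \<odot>\<^bsub>M\<^esub> x) (carrier M) (carrier M)"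
  proof (rule bij_of_surj_on_fibres[OF A_comp_carrier[OF c ac]])
    fix \<pp> assume p: "maximalideal \<pp> R"
    have sub: "vertices \<pp> \<subseteq> Q" unfolding Q_def using p by blast
    show "(\<lambda>v. a \<odot>\<^bsub>FA \<pp>\<^esub> v) ` carrier (FA \<pp>) = carrier (FA \<pp>)"
      by (rule sum_surj_on_fibre[OF p fin sub, where s = s and d = d and t = t and w = w])
        (use s t a_def in blast)+
  qed
  then show ?thesis using ac by blast
qed

end

theorem proposition3p6:
  fixes R :: "'r ring" and C :: "'c monoid" and T :: "'t ring" and W :: "'w monoid"
    and A :: "'a ring" and M :: "('a, 'm) module"
    and \<phi> :: "'r \<Rightarrow> 't" and \<psi> :: "'r \<Rightarrow> 'a" and \<nu> :: "'w \<Rightarrow> 'c"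
    and \<T> :: "'c \<Rightarrow> 't set" and \<A> :: "'c \<Rightarrow> 'a set" and \<M> :: "'c \<Rightarrow> 'm set"
    and \<pi> :: "('w \<Rightarrow> 't) \<Rightarrow> 'a" and c :: 'c
  assumes "noetherian_domain R" and "semilocal R"
    and "comm_group C" and "finite (carrier C)"
    and "cring T" and "graded_algebra C R T \<phi> \<T>"
    and "group W" and "\<nu> \<in> hom W C"
    and "graded_algebra C R A \<psi> \<A>" and "fg_module R (algebra_module A \<psi>)"
    and "graded_algebra_hom C R
           (group_algebra T W) (group_algebra_coeff T W \<circ> \<phi>) (group_algebra_grading T W C \<nu> \<T>)
           A \<psi> \<A> \<pi>"
    and "\<pi> ` carrier (group_algebra T W) = carrier A"
    and "c \<in> carrier C"
    and "graded_module C A \<A> M \<M>"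
    and "\<And>\<pp> E \<chi>.
           \<lbrakk>maximalideal \<pp> R;
            simple_submodule E T (reduction_module R \<pp> \<psi> (\<pi> \<circ> group_algebra_coeff T W) M);
            \<chi> \<in> hom (C Mod \<nu> ` carrier W) complex_units;
            \<chi> (\<nu> ` carrier W #>\<^bsub>C\<^esub> c) \<noteq> 1\<rbrakk> \<Longrightarrow>
           \<exists>d \<in> carrier C. \<chi> (\<nu> ` carrier W #>\<^bsub>C\<^esub> d) \<noteq> 1 \<and>
             (\<exists>t \<in> \<T> d. \<exists>e \<in> E.
                t \<odot>\<^bsub>reduction_module R \<pp> \<psi> (\<pi> \<circ> group_algebra_coeff T W) M\<^esub> e
                  \<noteq> \<zero>\<^bsub>reduction_module R \<pp> \<psi> (\<pi> \<circ> group_algebra_coeff T W) M\<^esub>)"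
  shows "\<exists>a \<in> \<A> c. bij_betw (\<lambda>x. a \<odot>\<^bsub>M\<^esub> x) (carrier M) (carrier M)"
proof -
  interpret graded_setup R C T W A M \<phi> \<psi> \<T> \<A> \<M> \<nu> \<pi>
    by (intro graded_setup.intro graded_setup_axioms.intro assms)
  show ?thesis by (rule exists_homogeneous_bij[OF assms(13,15)])
qed

end
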